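(* Let $M=\mathbb{Z}^{2m}\backslash\mathbb{R}^{2m}$ with $m$ arbitrary. For translation-invariant metrics $h$ on $M$ and translation-invariant symplectic structures $\omega$ on $M$ representing integer cohomology classes, the collection $\mathrm{Spec}(k\omega,h)$, $k\in\mathbb{Z}^+$, does not determine the symplectic structure $\omega$ on $M$ nor the symplectic structure $\Omega=\omega_0+\pi^*\omega$ on $T^*M$ (nor the restriction of $\Omega$ to the cotangent bundle with the zero section removed). In particular, quantum equivalent systems need not have the same classical phase space.
   Context: A metric or $2$-form on the torus $M=\mathbb{Z}^{2m}\backslash\mathbb{R}^{2m}$ ($m$ a positive integer) is translation-invariant if its pullback to $\mathbb{R}^{2m}$ is invariant under all translations. $\pi:T^*M\to M$ is the projection, and $\omega_0=-d\lambda$ is the Liouville form, where $\lambda$ is the canonical $1$-form on $T^*M$. The classical phase space associated with $(M,h,\omega)$ is the symplectic manifold $(T^*M,\Omega)$ with $\Omega=\omega_0+\pi^*\omega$. Let $\omega$ be a translation-invariant symplectic structure on $M$ representing an integer cohomology class and $h$ a translation-invariant (flat) Riemannian metric on $M$. Let $L$ be a Hermitian complex line bundle over $M$ with Chern class $[\omega]$, and $\nabla$ a Hermitian connection on $L$ with curvature $-2\pi i\omega$; denote also by $\nabla$ the induced connection on the tensor power $L^{\otimes k}$, $k\in\mathbb{Z}^+$. Let $\Delta=-\operatorname{trace}(\nabla^2)$ be the associated Laplacian (trace with respect to $h$) on sections of $L^{\otimes k}$, and let $\widehat H_k=\frac{\hbar^2}{2}\Delta$ with $\hbar=1/k$ be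 the quantum Hamiltonian. $\mathrm{Spec}(k\omega,h)$ denotes the spectrum of $\widehat H_k$, with multiplicities; it does not depend on the choices of $L$ and $\nabla$. Two systems $(M,h_1,\omega_1)$ and $(M,h_2,\omega_2)$ are quantum equivalent if $\mathrm{Spec}(k\omega_1,h_1)=\mathrm{Spec}(k\omega_2,h_2)$ for all $k\in\mathbb{Z}^+$.
   Formalization: Proved for every m ≥ 2; m = 1 is excluded because the claim fails there: for ω = d dx∧dy all multiplicities are k|d|, so the spectra determine ω up to sign, and ω and -ω (and the corresponding Ω) are symplectomorphic. *)

theory Defs
  imports "HOL-Analysis.Analysis" "HOL-Library.Function_Algebras"
begin

section \<open>Smooth maps and differential forms on open subsets of Euclidean spaces\<close>

text \<open>\<open>C\<^sup>k\<close> on an open set: all iterated directional derivatives up to order \<open>k\<close> exist as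
  Frechet derivatives and are continuous.\<close>

fun Ck_on :: "nat \<Rightarrow> ('a::real_normed_vector \<Rightarrow> 'b::real_normed_vector) \<Rightarrow> 'a set \<Rightarrow> bool" where
  "Ck_on 0 f S \<longleftrightarrow> continuous_on S f"
| "Ck_on (Suc k) f S \<longleftrightarrow>
     (\<forall>x\<in>S. f differentiable (at x)) \<and> (\<forall>v. Ck_on k (\<lambda>x. frechet_derivative f (at x) v) S)"

definition smooth_on :: "('a::real_normed_vector \<Rightarrow> 'b::real_normed_vector) \<Rightarrow> 'a set \<Rightarrow> bool" where
  "smooth_on f S \<longleftrightarrow> (\<forall>k. Ck_on k f S)"

text \<open>A 1-form is a function \<open>\<alpha> x v\<close> linear in \<open>v\<close>; a field of bilinear forms (a metric or a
  2-form) is a function \<open>\<beta> x u v\<close>.  The first argument is the base point.\<close>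

type_synonym 'a one_form = "'a \<Rightarrow> 'a \<Rightarrow> real"
type_synonym 'a bilin_field = "'a \<Rightarrow> 'a \<Rightarrow> 'a \<Rightarrow> real"

text \<open>The exterior derivatives, evaluated on constant (hence commuting) vector fields.\<close>

definition ext_d1 :: "('a::real_normed_vector) one_form \<Rightarrow> 'a bilin_field" where
  "ext_d1 \<alpha> x u v =
     frechet_derivative (\<lambda>y. \<alpha> y v) (at x) u - frechet_derivative (\<lambda>y. \<alpha> y u) (at x) v"

definition ext_d2 ::
    "('a::real_normed_vector) bilin_field \<Rightarrow> 'a \<Rightarrow> 'a \<Rightarrow> 'a \<Rightarrow> 'a \<Rightarrow> real" where
  "ext_d2 \<beta> x u v w =
     frechet_derivative (\<lambda>y. \<beta> y v w) (at x) u
   - frechet_derivative (\<lambda>y. \<beta> y u w) (at x) v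
   + frechet_derivative (\<lambda>y. \<beta> y u v) (at x) w"

definition pullback ::
    "('a::real_normed_vector \<Rightarrow> 'b::real_normed_vector) \<Rightarrow> 'b bilin_field \<Rightarrow> 'a bilin_field" where
  "pullback F \<beta> x u v =
     \<beta> (F x) (frechet_derivative F (at x) u) (frechet_derivative F (at x) v)"

section \<open>Quotients by lattice translations\<close>

text \<open>For a discrete group \<open>\<Gamma>\<close> of translations and a \<open>\<Gamma>\<close>-invariant open set \<open>U\<close>, the manifold
  \<open>\<Gamma>\<setminus>U\<close> is the set of orbits of points of \<open>U\<close>, with the smooth structure for which
  \<open>orbit \<Gamma>\<close> is a local diffeomorphism.  Forms on \<open>\<Gamma>\<setminus>U\<close> are given by their pullbacks
  to \<open>U\<close>, that is, by \<open>\<Gamma>\<close>-periodic forms.\<close>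

definition orbit :: "'a::real_normed_vector set \<Rightarrow> 'a \<Rightarrow> 'a set" where
  "orbit \<Gamma> x = (\<lambda>\<gamma>. x + \<gamma>) ` \<Gamma>"

definition quotient_mfd :: "'a::real_normed_vector set \<Rightarrow> 'a set \<Rightarrow> 'a set set" where
  "quotient_mfd \<Gamma> U = orbit \<Gamma> ` U"

text \<open>\<open>F\<close> represents \<open>\<phi> : \<Gamma>\<setminus>U \<rightarrow> \<Gamma>\<setminus>U\<close> over the open set \<open>W\<close>
  smoothly.\<close>

definition smooth_lift ::
    "'a::real_normed_vector set \<Rightarrow> 'a set \<Rightarrow> ('a set \<Rightarrow> 'a set) \<Rightarrow> 'a set \<Rightarrow> ('a \<Rightarrow> 'a) \<Rightarrow> bool"
  where
  "smooth_lift \<Gamma> U \<phi> W F \<longleftrightarrow>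
     open W \<and> W \<subseteq> U \<and> smooth_on F W \<and>
     (\<forall>x\<in>W. F x \<in> U \<and> \<phi> (orbit \<Gamma> x) = orbit \<Gamma> (F x))"

definition smooth_map ::
    "'a::real_normed_vector set \<Rightarrow> 'a set \<Rightarrow> ('a set \<Rightarrow> 'a set) \<Rightarrow> bool" where
  "smooth_map \<Gamma> U \<phi> \<longleftrightarrow> (\<forall>x\<in>U. \<exists>W F. x \<in> W \<and> smooth_lift \<Gamma> U \<phi> W F)"

definition diffeo ::
    "'a::real_normed_vector set \<Rightarrow> 'a set \<Rightarrow> ('a set \<Rightarrow> 'a set) \<Rightarrow> bool" where
  "diffeo \<Gamma> U \<phi> \<longleftrightarrow>
     bij_betw \<phi> (quotient_mfd \<Gamma> U) (quotient_mfd \<Gamma> U) \<and>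
     smooth_map \<Gamma> U \<phi> \<and>
     smooth_map \<Gamma> U (inv_into (quotient_mfd \<Gamma> U) \<phi>)"

definition symplectomorphic ::
    "'a::real_normed_vector set \<Rightarrow> 'a set \<Rightarrow> 'a bilin_field \<Rightarrow> 'a bilin_field \<Rightarrow> bool" where
  "symplectomorphic \<Gamma> U \<Omega>1 \<Omega>2 \<longleftrightarrow>
     (\<exists>\<phi>. diffeo \<Gamma> U \<phi> \<and>
        (\<forall>W F. smooth_lift \<Gamma> U \<phi> W F \<longrightarrow>
           (\<forall>x\<in>W. \<forall>u v. pullback F \<Omega>2 x u v = \<Omega>1 x u v)))"

section \<open>Metrics and symplectic structures on the torus\<close>

text \<open>The torus is the quotient of \<open>\<real>\<^sup>n\<close> by the integer lattice; \<open>n = CARD('n)\<close>.\<close>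

definition int_lattice :: "(real^'n::finite) set" where
  "int_lattice = {x. \<forall>i. x $ i \<in> \<int>}"

definition field_on_torus :: "(real^'n::finite) bilin_field \<Rightarrow> bool" where
  "field_on_torus \<beta> \<longleftrightarrow>
     (\<forall>x. bilinear (\<beta> x)) \<and>
     (\<forall>u v. smooth_on (\<lambda>x. \<beta> x u v) UNIV) \<and>
     (\<forall>x. \<forall>\<gamma>\<in>int_lattice. \<beta> (x + \<gamma>) = \<beta> x)"

definition translation_invariant :: "(real^'n::finite) bilin_field \<Rightarrow> bool" where
  "translation_invariant \<beta> \<longleftrightarrow> (\<forall>x a. \<beta> (x + a) = \<beta> x)"

definition riemannian_metric :: "(real^'n::finite) bilin_field \<Rightarrow> bool" where
  "riemannian_metric h \<longleftrightarrow>
     field_on_torus h \<and>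
     (\<forall>x u v. h x u v = h x v u) \<and>
     (\<forall>x u. u \<noteq> 0 \<longrightarrow> h x u u > 0)"

definition symplectic_structure :: "(real^'n::finite) bilin_field \<Rightarrow> bool" where
  "symplectic_structure \<omega> \<longleftrightarrow>
     field_on_torus \<omega> \<and>
     (\<forall>x u. \<omega> x u u = 0) \<and>
     (\<forall>x u v w. ext_d2 \<omega> x u v w = 0) \<and>
     (\<forall>x u. (\<forall>v. \<omega> x u v = 0) \<longrightarrow> u = 0)"

text \<open>A closed 2-form represents an integer class iff its periods are integers; the second
  homology of the torus is generated by the images of the parallelograms spanned by
  lattice vectors.\<close>

definition integer_class :: "(real^'n::finite) bilin_field \<Rightarrow> bool" where
  "integer_class \<omega> \<longleftrightarrow>
     (\<forall>x. \<forall>a\<in>int_lattice. \<forall>b\<in>int_lattice.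
        integral (cbox (0, 0) (1, 1)) (\<lambda>(s::real, t::real). \<omega> (x + s *\<^sub>R a + t *\<^sub>R b) a b) \<in> \<int>)"

section \<open>The classical phase space\<close>

text \<open>The cotangent bundle of the torus is \<open>(\<real>\<^sup>n \<times> \<real>\<^sup>n)/(\<int>\<^sup>n \<times> 0)\<close>, the covector
  \<open>p\<close> at \<open>q\<close> being \<open>\<lambda>v. p \<bullet> v\<close>; the bundle projection lifts to \<open>fst\<close>.\<close>

definition cotangent_group :: "((real^'n::finite) \<times> (real^'n)) set" where
  "cotangent_group = int_lattice \<times> {0}"

definition nonzero_covectors :: "((real^'n::finite) \<times> (real^'n)) set" where
  "nonzero_covectors = {z. snd z \<noteq> 0}"

definition canonical_one_form :: "((real^'n::finite) \<times> (real^'n)) one_form" where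
  "canonical_one_form z \<zeta> = snd z \<bullet> fst \<zeta>"

definition liouville_form :: "((real^'n::finite) \<times> (real^'n)) bilin_field" where
  "liouville_form z \<zeta> \<eta> = - ext_d1 canonical_one_form z \<zeta> \<eta>"

definition phase_form ::
    "(real^'n::finite) bilin_field \<Rightarrow> ((real^'n) \<times> (real^'n)) bilin_field" where
  "phase_form \<omega> z \<zeta> \<eta> = liouville_form z \<zeta> \<eta> + pullback fst \<omega> z \<zeta> \<eta>"

section \<open>Line bundles with connection and the quantum spectrum\<close>

text \<open>A Hermitian line bundle on the torus becomes trivial on \<open>\<real>\<^sup>n\<close>, so it is given by a unitary
  factor of automorphy \<open>e\<close> (only its values on the lattice matter): sections are the functions
  \<open>f\<close> with \<open>f (x + \<gamma>) = e \<gamma> x * f x\<close>.  A Hermitian connection is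
  \<open>\<nabla> = d + \<i>\<theta>\<close> for a real 1-form \<open>\<theta>\<close> on \<open>\<real>\<^sup>n\<close>, and \<open>\<nabla>\<close> must preserve the
  automorphy condition.\<close>

definition hermitian_line_bundle ::
    "(real^'n::finite \<Rightarrow> real^'n \<Rightarrow> complex) \<Rightarrow> bool" where
  "hermitian_line_bundle e \<longleftrightarrow>
     (\<forall>\<gamma>\<in>int_lattice. smooth_on (e \<gamma>) UNIV) \<and>
     (\<forall>\<gamma>\<in>int_lattice. \<forall>x. norm (e \<gamma> x) = 1) \<and>
     (\<forall>\<gamma>\<in>int_lattice. \<forall>\<delta>\<in>int_lattice. \<forall>x. e (\<gamma> + \<delta>) x = e \<gamma> (x + \<delta>) * e \<delta> x)"

definition hermitian_connection ::
    "(real^'n::finite \<Rightarrow> real^'n \<Rightarrow> complex) \<Rightarrow> (real^'n) one_form \<Rightarrow> bool" where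
  "hermitian_connection e \<theta> \<longleftrightarrow>
     (\<forall>x. linear (\<theta> x)) \<and>
     (\<forall>v. smooth_on (\<lambda>x. \<theta> x v) UNIV) \<and>
     (\<forall>\<gamma>\<in>int_lattice. \<forall>x v.
        frechet_derivative (e \<gamma>) (at x) v + \<i> * of_real (\<theta> (x + \<gamma>) v) * e \<gamma> x
          = e \<gamma> x * (\<i> * of_real (\<theta> x v)))"

definition curvature :: "(real^'n::finite) one_form \<Rightarrow> real^'n \<Rightarrow> real^'n \<Rightarrow> real^'n \<Rightarrow> complex" where
  "curvature \<theta> x u v = \<i> * of_real (ext_d1 \<theta> x u v)"

text \<open>With curvature \<open>-2\<pi>\<i>\<omega>\<close> the Chern class is \<open>[\<omega>]\<close> by Chern-Weil theory; the cohomology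
  of the torus has no torsion, so no separate condition on the Chern class is needed.\<close>

definition prequantum_bundle ::
    "(real^'n::finite) bilin_field \<Rightarrow> (real^'n \<Rightarrow> real^'n \<Rightarrow> complex) \<Rightarrow> (real^'n) one_form \<Rightarrow> bool"
  where
  "prequantum_bundle \<omega> e \<theta> \<longleftrightarrow>
     hermitian_line_bundle e \<and> hermitian_connection e \<theta> \<and>
     (\<forall>x u v. curvature \<theta> x u v = - 2 * of_real pi * \<i> * of_real (\<omega> x u v))"

definition power_bundle ::
    "nat \<Rightarrow> (real^'n::finite \<Rightarrow> real^'n \<Rightarrow> complex) \<Rightarrow> real^'n \<Rightarrow> real^'n \<Rightarrow> complex" where
  "power_bundle k e \<gamma> x = e \<gamma> x ^ k"

definition power_connection :: "nat \<Rightarrow> (real^'n::finite) one_form \<Rightarrow> (real^'n) one_form" where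
  "power_connection k \<theta> x v = real k * \<theta> x v"

definition smooth_sections ::
    "(real^'n::finite \<Rightarrow> real^'n \<Rightarrow> complex) \<Rightarrow> (real^'n \<Rightarrow> complex) set" where
  "smooth_sections e =
     {f. smooth_on f UNIV \<and> (\<forall>\<gamma>\<in>int_lattice. \<forall>x. f (x + \<gamma>) = e \<gamma> x * f x)}"

definition cov_deriv ::
    "(real^'n::finite) one_form \<Rightarrow> real^'n \<Rightarrow> (real^'n \<Rightarrow> complex) \<Rightarrow> real^'n \<Rightarrow> complex" where
  "cov_deriv \<theta> v f x = frechet_derivative f (at x) v + \<i> * of_real (\<theta> x v) * f x"

definition gram_matrix :: "(real^'n::finite) bilin_field \<Rightarrow> real^'n \<Rightarrow> real^'n^'n" where
  "gram_matrix h x = (\<chi> i j. h x (axis i 1) (axis j 1))"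

text \<open>\<open>- trace (\<nabla>\<^sup>2)\<close> for a translation-invariant metric \<open>h\<close>: constant vector fields are parallel
  for its Levi-Civita connection, so \<open>\<nabla>\<^sup>2\<close> on constant fields is the iterated covariant
  derivative and there is no Christoffel term.\<close>

definition bundle_laplacian ::
    "(real^'n::finite) bilin_field \<Rightarrow> (real^'n) one_form \<Rightarrow> (real^'n \<Rightarrow> complex) \<Rightarrow> real^'n \<Rightarrow> complex"
  where
  "bundle_laplacian h \<theta> f x =
     - (\<Sum>i\<in>UNIV. \<Sum>j\<in>UNIV. of_real (matrix_inv (gram_matrix h x) $ i $ j) *
          cov_deriv \<theta> (axis i 1) (cov_deriv \<theta> (axis j 1) f) x)"

text \<open>With \<open>\<hbar> = 1/k\<close>, acting on sections of the \<open>k\<close>-th tensor power.\<close>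

definition quantum_hamiltonian ::
    "(real^'n::finite) bilin_field \<Rightarrow> (real^'n) one_form \<Rightarrow> nat \<Rightarrow> (real^'n \<Rightarrow> complex) \<Rightarrow> real^'n \<Rightarrow> complex"
  where
  "quantum_hamiltonian h \<theta> k f x =
     of_real ((1 / real k)\<^sup>2 / 2) * bundle_laplacian h (power_connection k \<theta>) f x"

definition eigensections ::
    "(real^'n::finite) bilin_field \<Rightarrow> (real^'n \<Rightarrow> real^'n \<Rightarrow> complex) \<Rightarrow> (real^'n) one_form \<Rightarrow>
      nat \<Rightarrow> complex \<Rightarrow> (real^'n \<Rightarrow> complex) set" where
  "eigensections h e \<theta> k \<mu> =
     {f \<in> smooth_sections (power_bundle k e). \<forall>x. quantum_hamiltonian h \<theta> k f x = \<mu> * f x}"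

text \<open>The quantum Hamiltonian is elliptic and self-adjoint on a compact manifold, so its spectrum
  consists of eigenvalues of finite multiplicity with smooth eigensections.  The spectrum with
  multiplicities is recorded as the function that sends \<open>\<mu>\<close> to its multiplicity (0 if \<open>\<mu>\<close> is
  not an eigenvalue).\<close>

definition spectrum_mult ::
    "(real^'n::finite) bilin_field \<Rightarrow> (real^'n \<Rightarrow> real^'n \<Rightarrow> complex) \<Rightarrow> (real^'n) one_form \<Rightarrow>
      nat \<Rightarrow> complex \<Rightarrow> nat" where
  "spectrum_mult h e \<theta> k \<mu> =
     vector_space.dim (\<lambda>(c::complex) f x. c * f x) (eigensections h e \<theta> k \<mu>)"

text \<open>\<open>Spec(k\<omega>, h)\<close> does not depend on the choice of bundle and connection; accordingly the
  spectra are required to agree for all choices.  Lemma \<open>prequantum_bundle_exists\<close> below shows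
  that there always is one for the forms considered here.\<close>

definition quantum_equivalent ::
    "(real^'n::finite) bilin_field \<Rightarrow> (real^'n) bilin_field \<Rightarrow>
      (real^'n) bilin_field \<Rightarrow> (real^'n) bilin_field \<Rightarrow> bool" where
  "quantum_equivalent h1 \<omega>1 h2 \<omega>2 \<longleftrightarrow>
     (\<forall>k\<ge>1. \<forall>e1 \<theta>1 e2 \<theta>2.
        prequantum_bundle \<omega>1 e1 \<theta>1 \<longrightarrow> prequantum_bundle \<omega>2 e2 \<theta>2 \<longrightarrow>
        spectrum_mult h1 e1 \<theta>1 k = spectrum_mult h2 e2 \<theta>2 k)"

section \<open>Existence of prequantum bundles\<close>

lemma vector_space_complex_functions:
  "vector_space (\<lambda>(c::complex) (f::'a \<Rightarrow> complex) x. c * f x)"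
  by unfold_locales (auto simp: algebra_simps fun_eq_iff)

lemma Ck_on_const: "Ck_on k (\<lambda>x. c) UNIV"
  by (induction k arbitrary: c) (auto simp: frechet_derivative_const)

lemma Ck_on_linear:
  fixes l :: "'a::euclidean_space \<Rightarrow> real"
  assumes "linear l" shows "Ck_on k l UNIV"
proof (cases k)
  case 0
  then show ?thesis using assms by (simp add: linear_continuous_on linear_conv_bounded_linear)
next
  case (Suc j)
  have d: "(l has_derivative l) (at x)" for x
    using assms by (simp add: bounded_linear_imp_has_derivative linear_conv_bounded_linear)
  have "frechet_derivative l (at x) = l" for x
    using frechet_derivative_at[OF d[of x]] by simp
  then show ?thesis using Suc d by (auto simp: Ck_on_const differentiable_def)
qed

lemma deriv_cis_linear:
  fixes l :: "'a::euclidean_space \<Rightarrow> real"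
  assumes "linear l"
  shows "((\<lambda>x. c * cis (l x)) has_derivative (\<lambda>v. \<i> * of_real (l v) * (c * cis (l x)))) (at x)"
proof -
  have d: "(l has_derivative l) (at x)"
    using assms by (simp add: bounded_linear_imp_has_derivative linear_conv_bounded_linear)
  have i: "((\<lambda>x. \<i> * complex_of_real (l x)) has_derivative (\<lambda>v. \<i> * of_real (l v))) (at x)"
    using bounded_linear.has_derivative[OF bounded_linear_of_real d]
    by (rule has_derivative_mult_right)
  have "((\<lambda>x. exp (\<i> * complex_of_real (l x))) has_derivative
          (\<lambda>v. exp (\<i> * of_real (l x)) * (\<i> * of_real (l v)))) (at x)"
    using has_derivative_compose[OF i DERIV_exp[unfolded has_field_derivative_def]] .
  then have "((\<lambda>x. c * exp (\<i> * complex_of_real (l x))) has_derivative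
          (\<lambda>v. c * (exp (\<i> * of_real (l x)) * (\<i> * of_real (l v))))) (at x)"
    by (rule has_derivative_mult_right)
  then have "((\<lambda>x. c * exp (\<i> * complex_of_real (l x))) has_derivative
          (\<lambda>v. \<i> * of_real (l v) * (c * exp (\<i> * of_real (l x))))) (at x)"
    by (simp only: mult_ac)
  then show ?thesis by (simp add: cis_conv_exp)
qed

lemma Ck_on_cis_linear:
  fixes l :: "'a::euclidean_space \<Rightarrow> real"
  assumes "linear l" shows "Ck_on k (\<lambda>x. c * cis (l x)) UNIV"
proof (induction k arbitrary: c)
  case 0
  have "isCont (\<lambda>x. c * cis (l x)) x" for x
    using deriv_cis_linear[OF assms] has_derivative_continuous by blast
  then show ?case by (simp add: continuous_at_imp_continuous_on)
next
  case (Suc k)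
  have "frechet_derivative (\<lambda>x. c * cis (l x)) (at x) = (\<lambda>v. \<i> * of_real (l v) * (c * cis (l x)))" for x
    using frechet_derivative_at[OF deriv_cis_linear[OF assms]] by simp
  moreover have "(\<lambda>x. c * cis (l x)) differentiable (at x)" for x
    using deriv_cis_linear[OF assms] by (auto simp: differentiable_def)
  moreover have "Ck_on k (\<lambda>x. \<i> * of_real (l v) * (c * cis (l x))) UNIV" for v
    using Suc[of "\<i> * of_real (l v) * c"] by (simp add: mult.assoc)
  ultimately show ?case by simp
qed

lemma bilinear_alternating_skew:
  assumes B: "bilinear B" and alt: "\<And>u. B u u = (0::real)"
  shows "B u v = - B v u"
proof -
  have "B (u + v) (u + v) = B u u + B u v + (B v u + B v v)"
    by (simp only: bilinear_ladd[OF B] bilinear_radd[OF B])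
  then show ?thesis by (simp add: alt)
qed

lemma semicharacter_exists:
  fixes B :: "real^'n::finite \<Rightarrow> real^'n \<Rightarrow> real"
  assumes B: "bilinear B" and alt: "\<And>u. B u u = 0"
    and int: "\<And>a b. a \<in> int_lattice \<Longrightarrow> b \<in> int_lattice \<Longrightarrow> B a b \<in> \<int>"
  obtains q :: "real^'n \<Rightarrow> real"
  where "\<And>a b. a \<in> int_lattice \<Longrightarrow> b \<in> int_lattice \<Longrightarrow>
           cis (pi * q (a + b)) = cis (pi * q a) * cis (pi * q b) * cis (pi * B a b)"
proof -
  note skew = bilinear_alternating_skew[OF B alt]
  obtain f :: "'n \<Rightarrow> nat" where f: "inj f"
    using finite_imp_inj_to_nat_seg[of "UNIV :: 'n set"] by auto
  define P where "P = {(i, j). f i < f j}"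
  define c where "c = (\<lambda>i j. B (axis i 1) (axis j 1))"
  define q where "q = (\<lambda>a::real^'n. \<Sum>(i,j)\<in>P. c i j * (a $ i) * (a $ j))"
  have finP: "finite P" by (rule finite_subset[OF subset_UNIV]) simp
  have cint: "c i j \<in> \<int>" for i j
    unfolding c_def by (rule int) (auto simp: int_lattice_def axis_def)
  have lin1: "linear (\<lambda>u. B u v)" and lin2: "linear (B u)" for u v
    using B by (auto simp: bilinear_def)
  have expand: "B a b = (\<Sum>i\<in>UNIV. \<Sum>j\<in>UNIV. c i j * (a $ i) * (b $ j))" for a b
  proof -
    have "B a b = B (\<Sum>i\<in>UNIV. (a $ i) *\<^sub>R axis i 1) (\<Sum>j\<in>UNIV. (b $ j) *\<^sub>R axis j 1)"
      using basis_expansion[of a] basis_expansion[of b] by (simp add: scalar_mult_eq_scaleR)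
    also have "\<dots> = (\<Sum>i\<in>UNIV. \<Sum>j\<in>UNIV. c i j * (a $ i) * (b $ j))"
      by (simp add: linear_sum[OF lin1] linear_sum[OF lin2] linear_cmul[OF lin1] linear_cmul[OF lin2]
            c_def mult_ac sum_distrib_left) (rule sum.swap)
    finally show ?thesis .
  qed
  have Bsum: "B a b = (\<Sum>(i,j)\<in>P. c i j * (a $ i * b $ j - a $ j * b $ i))" for a b
  proof -
    define g where "g = (\<lambda>(i, j). c i j * (a $ i) * (b $ j))"
    have U: "(UNIV :: ('n \<times> 'n) set) = (P \<union> prod.swap ` P) \<union> {(i, j). i = j}"
      using f unfolding P_def inj_def by (auto simp: image_iff) (metis linorder_less_linear)
    have "B a b = (\<Sum>p\<in>UNIV. g p)"
      unfolding expand g_def by (simp add: sum.cartesian_product)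
    also have "\<dots> = (\<Sum>p\<in>P \<union> prod.swap ` P. g p) + (\<Sum>p\<in>{(i, j). i = j}. g p)"
      unfolding U by (rule sum.union_disjoint) (auto simp: P_def intro: finite_subset[OF subset_UNIV])
    also have "(\<Sum>p\<in>{(i, j). i = j}. g p) = 0"
      by (rule sum.neutral) (auto simp: g_def c_def alt)
    also have "(\<Sum>p\<in>P \<union> prod.swap ` P. g p) = (\<Sum>p\<in>P. g p) + (\<Sum>p\<in>prod.swap ` P. g p)"
      by (rule sum.union_disjoint) (auto simp: P_def intro: finite_subset[OF subset_UNIV])
    also have "(\<Sum>p\<in>prod.swap ` P. g p) = (\<Sum>p\<in>P. g (prod.swap p))"
      by (subst sum.reindex) (auto simp: inj_on_def)
    also have "(\<Sum>p\<in>P. g p) + (\<Sum>p\<in>P. g (prod.swap p)) + 0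
        = (\<Sum>(i,j)\<in>P. c i j * (a $ i * b $ j - a $ j * b $ i))"
      unfolding add_0_right sum.distrib[symmetric]
    proof (rule sum.cong[OF refl])
      fix p assume "p \<in> P"
      obtain i j where p: "p = (i, j)" by (cases p)
      have "c j i = - c i j" unfolding c_def by (rule skew)
      then show "g p + g (prod.swap p) =
          (case p of (i, j) \<Rightarrow> c i j * (a $ i * b $ j - a $ j * b $ i))"
        by (simp add: g_def p algebra_simps)
    qed
    finally show ?thesis .
  qed
  have "cis (pi * q (a + b)) = cis (pi * q a) * cis (pi * q b) * cis (pi * B a b)"
    if a: "a \<in> int_lattice" and b: "b \<in> int_lattice" for a b
  proof -
    define n where "n = (\<Sum>(i,j)\<in>P. c i j * a $ j * b $ i)"
    have "n \<in> \<int>"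
      unfolding n_def using a b cint by (auto intro!: Ints_sum Ints_mult simp: int_lattice_def)
    then obtain z where z: "n = of_int z" by (auto elim: Ints_cases)
    have "q (a + b) - q a - q b - B a b = 2 * n"
      unfolding q_def Bsum n_def sum_distrib_left sum_subtractf[symmetric]
      by (rule sum.cong) (auto simp: algebra_simps)
    then have "q (a + b) = q a + q b + B a b + 2 * n" by simp
    then have "pi * q (a + b) = (pi * q a + pi * q b + pi * B a b) + 2 * pi * of_int z"
      by (simp add: z algebra_simps)
    then have "cis (pi * q (a + b)) = cis (pi * q a + pi * q b + pi * B a b) * cis (2 * pi * of_int z)"
      by (simp only: cis_mult)
    then show ?thesis by (simp add: cis_mult)
  qed
  then show ?thesis by (rule that)
qed

lemma prequantum_bundle_exists:
  fixes \<omega> :: "(real^'n::finite) bilin_field"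
  assumes "symplectic_structure \<omega>" "translation_invariant \<omega>" "integer_class \<omega>"
  shows "\<exists>e \<theta>. prequantum_bundle \<omega> e \<theta>"
proof -
  define B where "B = \<omega> 0"
  have \<omega>: "\<omega> x = B" for x
    using assms(2) unfolding translation_invariant_def B_def by (metis add_0)
  have B: "bilinear B" and alt: "\<And>u. B u u = 0"
    using assms(1) by (auto simp: symplectic_structure_def field_on_torus_def B_def)
  have int: "B a b \<in> \<int>" if "a \<in> int_lattice" "b \<in> int_lattice" for a b
  proof -
    have "integral (cbox (0, 0) (1, 1)) (\<lambda>(s::real, t::real). B a b) \<in> \<int>"
      using assms(3) that unfolding integer_class_def \<omega> by blast
    then show ?thesis by (simp add: case_prod_unfold content_Pair)
  qed
  obtain q where q: "\<And>a b. a \<in> int_lattice \<Longrightarrow> b \<in> int_lattice \<Longrightarrow>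
      cis (pi * q (a + b)) = cis (pi * q a) * cis (pi * q b) * cis (pi * B a b)"
    using semicharacter_exists[OF B alt int] by blast
  have lin1: "linear (\<lambda>u. B u v)" and lin2: "linear (B u)" for u v
    using B by (auto simp: bilinear_def)
  note skew = bilinear_alternating_skew[OF B alt]
  define e where "e = (\<lambda>\<gamma> x. cis (pi * q \<gamma>) * cis (pi * B \<gamma> x))"
  define \<theta> where "\<theta> = (\<lambda>x v. - pi * B x v)"
  have linpi: "linear (\<lambda>x. pi * B \<gamma> x)" for \<gamma>
    using linear_compose_scale_right[OF lin2, of pi \<gamma>] by simp
  have lin\<theta>1: "linear (\<lambda>x. \<theta> x v)" for v
    unfolding \<theta>_def using linear_compose_scale_right[OF lin1, of "- pi" v] by simp
  have lin\<theta>2: "linear (\<theta> x)" for x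
    unfolding \<theta>_def using linear_compose_scale_right[OF lin2, of "- pi" x] by simp
  have dlin: "frechet_derivative l (at x) = l" if "linear l" for l :: "real^'n \<Rightarrow> real" and x
    using that frechet_derivative_at[of l l x]
    by (simp add: bounded_linear_imp_has_derivative linear_conv_bounded_linear)
  have "hermitian_line_bundle e"
    unfolding hermitian_line_bundle_def smooth_on_def e_def
    using q by (auto simp: Ck_on_cis_linear[OF linpi] norm_mult cis_mult[symmetric] bilinear_ladd[OF B]
        bilinear_radd[OF B] distrib_left mult_ac)
  moreover have "hermitian_connection e \<theta>"
    unfolding hermitian_connection_def
  proof (intro conjI allI ballI)
    show "linear (\<theta> x)" for x by (rule lin\<theta>2)
    show "smooth_on (\<lambda>x. \<theta> x v) UNIV" for v
      unfolding smooth_on_def by (simp add: Ck_on_linear[OF lin\<theta>1])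
    show "frechet_derivative (e \<gamma>) (at x) v + \<i> * of_real (\<theta> (x + \<gamma>) v) * e \<gamma> x
          = e \<gamma> x * (\<i> * of_real (\<theta> x v))" for \<gamma> x v
    proof -
      have "frechet_derivative (e \<gamma>) (at x) v = \<i> * of_real (pi * B \<gamma> v) * e \<gamma> x"
        unfolding e_def
        using frechet_derivative_at[OF deriv_cis_linear[OF linpi], symmetric] by simp
      then show ?thesis by (simp add: \<theta>_def bilinear_ladd[OF B] algebra_simps)
    qed
  qed
  moreover have "curvature \<theta> x u v = - 2 * of_real pi * \<i> * of_real (\<omega> x u v)" for x u v
    using skew[of v u] unfolding curvature_def ext_d1_def \<omega> dlin[OF lin\<theta>1] by (simp add: \<theta>_def)
  ultimately show ?thesis unfolding prequantum_bundle_def by blast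
qed

end

theory Submission
  imports Defs
begin

text \<open>Both systems are quotients of the same flat symplectic vector space by two lattices of the same
  covolume, on which the symplectic form has, up to order, the elementary divisors \<open>(1, 4, 2, \<dots>, 2)\<close> and \<open>(2, 2, 2, \<dots>, 2)\<close>.

  Quantum equivalence: in the Landau gauge the sections of the \<open>k\<close>-th power are the functions
  invariant under the magnetic translations by lattice vectors; an arbitrary bundle and connection are
  brought to this form by a gauge transformation and a translation. The two lattices arise from a
  common sublattice by adjoining \<open>a\<close>, respectively \<open>b\<close>. The commuting involutions given by \<open>a\<close> and \<open>b\<close>
  split the functions invariant under the sublattice into four joint eigenspaces. The
  two spaces of sections share the \<open>(+,+)\<close> part, and their other halves \<open>(+,-)\<close> and \<open>(-,+)\<close> are interchanged
  by a further magnetic translation. As magnetic translations commute with the Laplacian, this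
  transplantation preserves every eigenspace, and no spectrum has to be computed.

  Symplectic inequivalence: all periods of the second form are even, while the first form has a
  period \<open>1\<close>. A symplectomorphism maps a torus in the base to a torus whose lift to the universal
  cover is a linear map plus a periodic one, so it carries the period \<open>1\<close> to a period of the second
  form. This applies verbatim to the cotangent bundle and to the complement of its zero section.\<close>

section \<open>Calculus of smooth functions\<close>

text \<open>The crux is a vector \<open>s\<close> whose magnetic translation anticommutes with those
  by \<open>a\<close> and \<open>b\<close> and commutes with those by the common sublattice. Its
  nonzero coordinates are \<open>1 / (2k)\<close>, so the transplantation changes with
  \<open>k\<close> although the lattices do not. The equality 1 * 4 = 2 * 2 keeps the covolume; it
  takes two coordinate pairs, whence m \<ge> 2. The spectra are compared for all bundles and
  connections, so flat twists have to be removed: they appear as characters of the lattice, and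
  nondegeneracy of the form makes every such character the effect of a translation. A
  symplectomorphism is known only through local lifts. They are patched over one affine plane of the
  cover: it covers a 2-torus, and Stokes' theorem on a square applies to its quasi-periodic image.
  In the cotangent bundle this plane has one fixed covector, so a nonzero choice keeps it off the
  zero section; and the Liouville form vanishes on vectors \<open>(v, 0)\<close>, so the periods
  there are those of the base form.\<close>

lemma frechet_derivative_at_eq: "(f has_derivative f') (at x) \<Longrightarrow> frechet_derivative f (at x) = f'"
  using frechet_derivative_at by metis

lemma frechet_derivative_cong_open:
  assumes "open S" "x \<in> S" "\<And>y. y \<in> S \<Longrightarrow> f y = g y"
  shows "frechet_derivative f (at x) = frechet_derivative g (at x)"
    and "f differentiable (at x) \<longleftrightarrow> g differentiable (at x)"
proof -
  have "(f has_derivative D) (at x) \<longleftrightarrow> (g has_derivative D) (at x)" for D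
    using has_derivative_transform_within_open[of f D x UNIV S g]
      has_derivative_transform_within_open[of g D x UNIV S f] assms by metis
  then show "frechet_derivative f (at x) = frechet_derivative g (at x)"
    and "f differentiable (at x) \<longleftrightarrow> g differentiable (at x)"
    unfolding frechet_derivative_def differentiable_def by simp_all
qed

lemma Ck_on_cong:
  assumes "open S" "\<And>y. y \<in> S \<Longrightarrow> f y = g y"
  shows "Ck_on k f S \<longleftrightarrow> Ck_on k g S"
  using assms(2)
proof (induction k arbitrary: f g)
  case 0
  then show ?case by (simp cong: continuous_on_cong)
next
  case (Suc k)
  note eq = frechet_derivative_cong_open[OF assms(1) _ Suc.prems]
  have "Ck_on k (\<lambda>x. frechet_derivative f (at x) v) S \<longleftrightarrow> Ck_on k (\<lambda>x. frechet_derivative g (at x) v) S" for v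
    by (rule Suc.IH) (simp add: eq(1))
  then show ?case by (simp add: eq(2))
qed

lemma Ck_on_subset: "Ck_on k f S \<Longrightarrow> T \<subseteq> S \<Longrightarrow> Ck_on k f T"
  by (induction k arbitrary: f) (auto intro: continuous_on_subset)

lemma Ck_on_continuous: "Ck_on k f S \<Longrightarrow> continuous_on S f"
  by (cases k) (auto intro!: continuous_at_imp_continuous_on differentiable_imp_continuous_within)

lemma Ck_on_SucD: "Ck_on (Suc k) f S \<Longrightarrow> Ck_on k f S"
proof (induction k arbitrary: f)
  case 0
  then show ?case using Ck_on_continuous[OF 0] by simp
next
  case (Suc k)
  have "Ck_on k (\<lambda>x. frechet_derivative f (at x) v) S" for v
    using Suc.prems by (intro Suc.IH) (simp only: Ck_on.simps(2)[of "Suc k"])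
  moreover have "\<forall>x\<in>S. f differentiable (at x)" using Suc.prems by simp
  ultimately show ?case by (simp only: Ck_on.simps(2)[of k]) blast
qed

text \<open>Serves the global lift of a symplectomorphism, which is known only through a different
  formula near each point.\<close>

lemma Ck_on_local:
  assumes "\<And>x. x \<in> S \<Longrightarrow> \<exists>T. open T \<and> x \<in> T \<and> Ck_on k f T"
  shows "Ck_on k f S"
  using assms
proof (induction k arbitrary: f)
  case 0
  have "isCont f x" if "x \<in> S" for x
    using 0[OF that] by (auto simp: continuous_on_eq_continuous_at)
  then show ?case by (simp add: continuous_at_imp_continuous_on)
next
  case (Suc k)
  have "Ck_on k (\<lambda>x. frechet_derivative f (at x) v) S" for v
  proof (rule Suc.IH)
    fix x assume "x \<in> S"
    from Suc.prems[OF this] obtain T where "open T" "x \<in> T" "Ck_on (Suc k) f T" by blast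
    then show "\<exists>T. open T \<and> x \<in> T \<and> Ck_on k (\<lambda>x. frechet_derivative f (at x) v) T" by auto
  qed
  moreover have "f differentiable (at x)" if "x \<in> S" for x
    using Suc.prems[OF that] by auto
  ultimately show ?case by simp
qed

lemma Ck_on_SucI:
  assumes "open S" "\<And>x. x \<in> S \<Longrightarrow> (f has_derivative f' x) (at x)" "\<And>v. Ck_on k (\<lambda>x. f' x v) S"
  shows "Ck_on (Suc k) f S"
proof -
  have "Ck_on k (\<lambda>x. frechet_derivative f (at x) v) S" for v
    using Ck_on_cong[OF assms(1), of "\<lambda>x. frechet_derivative f (at x) v" "\<lambda>x. f' x v"]
      assms(3) frechet_derivative_at_eq[OF assms(2)] by simp
  then show ?thesis using assms(2) by (auto simp: differentiable_def)
qed

lemma Ck_on_has_derivative: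
  "Ck_on (Suc k) f S \<Longrightarrow> x \<in> S \<Longrightarrow> (f has_derivative frechet_derivative f (at x)) (at x)"
  by (simp add: frechet_derivative_works)

lemma Ck_on_bounded_linear:
  assumes "open S" "bounded_linear L" "Ck_on k f S"
  shows "Ck_on k (\<lambda>x. L (f x)) S"
  using assms(3)
proof (induction k arbitrary: f)
  case 0
  then show ?case using assms by (simp add: bounded_linear.continuous_on)
next
  case (Suc k)
  show ?case
    by (rule Ck_on_SucI[OF assms(1)
          bounded_linear.has_derivative[OF assms(2) Ck_on_has_derivative[OF Suc.prems]]])
      (use Suc in auto)
qed

lemma Ck_on_add:
  assumes "open S" "Ck_on k f S" "Ck_on k g S"
  shows "Ck_on k (\<lambda>x. f x + g x) S"
  using assms(2,3)
proof (induction k arbitrary: f g)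
  case 0
  then show ?case by (simp add: continuous_on_add)
next
  case (Suc k)
  show ?case
    by (rule Ck_on_SucI[OF assms(1) has_derivative_add[OF
            Ck_on_has_derivative[OF Suc.prems(1)] Ck_on_has_derivative[OF Suc.prems(2)]]])
      (use Suc in auto)
qed

lemma Ck_on_mult:
  fixes f g :: "'a::real_normed_vector \<Rightarrow> 'b::real_normed_algebra"
  assumes "open S" "Ck_on k f S" "Ck_on k g S"
  shows "Ck_on k (\<lambda>x. f x * g x) S"
  using assms(2,3)
proof (induction k arbitrary: f g)
  case 0
  then show ?case by (simp add: continuous_on_mult)
next
  case (Suc k)
  show ?case
    by (rule Ck_on_SucI[OF assms(1) has_derivative_mult[OF
            Ck_on_has_derivative[OF Suc.prems(1)] Ck_on_has_derivative[OF Suc.prems(2)]]], assumption+)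
      (intro Ck_on_add[OF assms(1)] Suc.IH Ck_on_SucD[OF Suc.prems(1)] Ck_on_SucD[OF Suc.prems(2)]
        Suc.prems(1)[unfolded Ck_on.simps, THEN conjunct2, rule_format]
        Suc.prems(2)[unfolded Ck_on.simps, THEN conjunct2, rule_format])
qed

lemma has_derivative_cis_compose:
  assumes "(f has_derivative f') (at x)"
  shows "((\<lambda>x. cis (f x)) has_derivative (\<lambda>v. \<i> * of_real (f' v) * cis (f x))) (at x)"
proof -
  have "((\<lambda>x. exp (\<i> * complex_of_real (f x))) has_derivative
          (\<lambda>v. exp (\<i> * of_real (f x)) * (\<i> * of_real (f' v)))) (at x)"
    using has_derivative_compose[OF has_derivative_mult_right[OF
            bounded_linear.has_derivative[OF bounded_linear_of_real assms]]
          DERIV_exp[unfolded has_field_derivative_def]] .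
  then show ?thesis by (simp add: cis_conv_exp mult_ac)
qed

lemma Ck_on_cis:
  assumes "open S" "Ck_on k f S"
  shows "Ck_on k (\<lambda>x. cis (f x)) S"
  using assms(2)
proof (induction k arbitrary: f)
  case 0
  then show ?case by (auto simp: cis_conv_exp intro!: continuous_intros)
next
  case (Suc k)
  have "Ck_on k (\<lambda>x. frechet_derivative f (at x) v) S" for v using Suc.prems by simp
  then show ?case
    by (intro Ck_on_SucI[OF assms(1) has_derivative_cis_compose[OF Ck_on_has_derivative[OF Suc.prems]]])
      (auto intro!: Ck_on_mult[OF assms(1)] Suc.IH Ck_on_SucD[OF Suc.prems]
        Ck_on_bounded_linear[OF assms(1) bounded_linear_of_real]
        Ck_on_subset[OF Ck_on_const subset_UNIV])
qed

lemma has_derivative_affine: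
  assumes "bounded_linear l"
  shows "((\<lambda>z. c + l z) has_derivative l) (at z)"
  using has_derivative_add[OF has_derivative_const bounded_linear_imp_has_derivative[OF assms]] by simp

lemma has_derivative_compose_affine:
  assumes "bounded_linear l" "(f has_derivative f') (at (c + l z))"
  shows "((\<lambda>z. f (c + l z)) has_derivative (\<lambda>v. f' (l v))) (at z)"
  by (rule has_derivative_compose[OF has_derivative_affine[OF assms(1)] assms(2)])

text \<open>With an affine inner map, every directional derivative is again a function composed with
  the same map, so the induction closes without a chain rule of higher order.\<close>

lemma Ck_on_compose_affine:
  assumes "open S" "bounded_linear l" "Ck_on k f S"
  shows "Ck_on k (\<lambda>z. f (c + l z)) ((\<lambda>z. c + l z) -` S)"
  using assms(3)
proof (induction k arbitrary: f)
  case 0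
  have "continuous_on ((\<lambda>z. c + l z) -` S) (\<lambda>z. c + l z)"
    by (intro continuous_intros linear_continuous_on assms)
  from continuous_on_compose2[OF 0[unfolded Ck_on.simps] this] show ?case by auto
next
  case (Suc k)
  have o: "open ((\<lambda>z. c + l z) -` S)"
    by (intro open_vimage assms continuous_intros linear_continuous_on)
  show ?case
    by (rule Ck_on_SucI[OF o has_derivative_compose_affine[OF assms(2)
            Ck_on_has_derivative[OF Suc.prems]]]) (use Suc in auto)
qed

section \<open>Smoothness of all orders\<close>

lemma smooth_on_has_derivative:
  "smooth_on f S \<Longrightarrow> x \<in> S \<Longrightarrow> (f has_derivative frechet_derivative f (at x)) (at x)"
  unfolding smooth_on_def by (rule Ck_on_has_derivative[where k = 0]) blast

lemma smooth_on_deriv: "smooth_on f S \<Longrightarrow> smooth_on (\<lambda>x. frechet_derivative f (at x) v) S"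
  unfolding smooth_on_def using Ck_on.simps(2) by blast

lemma smooth_on_continuous: "smooth_on f S \<Longrightarrow> continuous_on S f"
  unfolding smooth_on_def by (rule Ck_on_continuous[where k = 0]) blast

lemma smooth_on_const: "smooth_on (\<lambda>x. c) UNIV"
  by (simp add: smooth_on_def Ck_on_const)

lemma smooth_on_linear:
  fixes l :: "'a::euclidean_space \<Rightarrow> real"
  shows "linear l \<Longrightarrow> smooth_on l UNIV"
  by (simp add: smooth_on_def Ck_on_linear)

lemma smooth_on_bounded_linear:
  "bounded_linear L \<Longrightarrow> smooth_on f UNIV \<Longrightarrow> smooth_on (\<lambda>x. L (f x)) UNIV"
  by (simp add: smooth_on_def Ck_on_bounded_linear)

lemma smooth_on_add:
  "smooth_on f UNIV \<Longrightarrow> smooth_on g UNIV \<Longrightarrow> smooth_on (\<lambda>x. f x + g x) UNIV"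
  by (simp add: smooth_on_def Ck_on_add)

lemma smooth_on_mult:
  fixes f g :: "'a::real_normed_vector \<Rightarrow> 'b::real_normed_algebra"
  shows "smooth_on f UNIV \<Longrightarrow> smooth_on g UNIV \<Longrightarrow> smooth_on (\<lambda>x. f x * g x) UNIV"
  by (simp add: smooth_on_def Ck_on_mult)

lemma smooth_on_cis: "smooth_on f UNIV \<Longrightarrow> smooth_on (\<lambda>x. cis (f x)) UNIV"
  by (simp add: smooth_on_def Ck_on_cis)

lemma smooth_on_compose_affine:
  "bounded_linear l \<Longrightarrow> smooth_on f UNIV \<Longrightarrow> smooth_on (\<lambda>z. f (c + l z)) UNIV"
  unfolding smooth_on_def using Ck_on_compose_affine[OF open_UNIV] by (metis vimage_UNIV)

text \<open>Meant for a potential of a smooth 1-form, where smoothness is known only for the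
  derivative.\<close>

lemma smooth_onI_derivative:
  assumes "\<And>x. (f has_derivative f' x) (at x)" "\<And>v. smooth_on (\<lambda>x. f' x v) UNIV"
  shows "smooth_on f UNIV"
proof -
  have "Ck_on (Suc k) f UNIV" for k
    by (rule Ck_on_SucI[OF open_UNIV assms(1)]) (use assms(2) in \<open>simp add: smooth_on_def\<close>)
  then show ?thesis unfolding smooth_on_def using Ck_on_SucD by blast
qed

section \<open>Closed forms and periods\<close>

lemma linear_expand_Basis:
  fixes l :: "'a::euclidean_space \<Rightarrow> real"
  assumes "linear l"
  shows "l v = (\<Sum>b\<in>Basis. (v \<bullet> b) * l b)"
proof -
  have "l v = l (\<Sum>b\<in>Basis. (v \<bullet> b) *\<^sub>R b)" by (simp add: euclidean_representation)
  also have "\<dots> = (\<Sum>b\<in>Basis. (v \<bullet> b) * l b)"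
    by (simp add: linear_sum[OF assms] linear_cmul[OF assms])
  finally show ?thesis .
qed

text \<open>Poincare lemma by integration along rays from the origin: closedness turns the
  derivative of the integrand of \<phi> in direction \<open>v\<close> into the
  \<open>t\<close>-derivative of \<open>t * \<alpha> (t *\<^sub>R x) v\<close>.\<close>

lemma closed_one_form_exact:
  fixes \<alpha> :: "'a::euclidean_space one_form"
  assumes lin: "\<And>x. linear (\<alpha> x)" and sm: "\<And>v. smooth_on (\<lambda>x. \<alpha> x v) UNIV"
    and closed: "\<And>x u v. ext_d1 \<alpha> x u v = 0"
  obtains \<phi> where "\<And>x. (\<phi> has_derivative \<alpha> x) (at x)"
proof -
  define E where "E = (\<lambda>v x. frechet_derivative (\<lambda>y. \<alpha> y v) (at x))"
  have dE: "((\<lambda>y. \<alpha> y v) has_derivative E v x) (at x)" for v x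
    unfolding E_def by (rule smooth_on_has_derivative[OF sm]) simp
  have linE: "linear (E v x)" for v x
    using dE by (rule has_derivative_linear)
  have sym: "E v x u = E u x v" for u v x
    using closed[of x u v] by (simp add: ext_d1_def E_def)
  have linE1: "linear (\<lambda>v. E v x u)" for x u
    using linE[of u x] by (simp add: sym[of _ x u])
  have cont\<alpha> [continuous_intros]: "continuous_on UNIV (\<lambda>y. \<alpha> y v)" for v
    by (rule smooth_on_continuous[OF sm])
  have contE [continuous_intros]: "continuous_on UNIV (\<lambda>y. E v y u)" for u v
    unfolding E_def by (rule smooth_on_continuous[OF smooth_on_deriv[OF sm]])
  define f where "f = (\<lambda>x t. \<alpha> (t *\<^sub>R x) x)"
  \<comment> \<open>Differentiation under the integral asks for a continuous family of bounded
    linear maps. Writing the derivative as the inner product with a vector of coordinates reduces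
    this to continuity of real functions.\<close>
  define fx where "fx = (\<lambda>x t. blinfun_inner_right
    (\<Sum>b\<in>Basis. (\<alpha> (t *\<^sub>R x) b + t * (\<Sum>b'\<in>Basis. (x \<bullet> b') * E b (t *\<^sub>R x) b')) *\<^sub>R b))"
  have fx: "blinfun_apply (fx x t) v = \<alpha> (t *\<^sub>R x) v + t * E v (t *\<^sub>R x) x" for x t v
  proof -
    have "blinfun_apply (fx x t) v =
        (\<Sum>b\<in>Basis. (v \<bullet> b) * (\<alpha> (t *\<^sub>R x) b + t * E b (t *\<^sub>R x) x))"
      unfolding fx_def linear_expand_Basis[OF linE, symmetric]
      by (simp add: inner_sum_right mult.commute inner_commute)
    also have "\<dots> = \<alpha> (t *\<^sub>R x) v + t * E v (t *\<^sub>R x) x"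
      by (subst (2) linear_expand_Basis[OF lin], subst (2) linear_expand_Basis[OF linE1])
        (simp add: algebra_simps sum.distrib sum_distrib_left)
    finally show ?thesis .
  qed
  have df: "((\<lambda>x. f x t) has_derivative blinfun_apply (fx x t)) (at x)" for x t
  proof -
    have 1: "((\<lambda>x. \<alpha> (t *\<^sub>R x) b) has_derivative (\<lambda>v. E b (t *\<^sub>R x) (t *\<^sub>R v))) (at x)" for b
      using has_derivative_compose_affine[OF bounded_linear_scaleR_right[of t], of "\<lambda>y. \<alpha> y b" _ 0 x]
        dE[of b "t *\<^sub>R x"] by simp
    have "((\<lambda>x. \<Sum>b\<in>Basis. (x \<bullet> b) * \<alpha> (t *\<^sub>R x) b) has_derivative
       (\<lambda>v. \<Sum>b\<in>Basis. (x \<bullet> b) * E b (t *\<^sub>R x) (t *\<^sub>R v) + (v \<bullet> b) * \<alpha> (t *\<^sub>R x) b)) (at x)"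
      by (intro has_derivative_sum has_derivative_mult 1 derivative_eq_intros) auto
    moreover have "(\<lambda>x. \<Sum>b\<in>Basis. (x \<bullet> b) * \<alpha> (t *\<^sub>R x) b) = (\<lambda>x. f x t)"
      unfolding f_def by (rule ext) (rule linear_expand_Basis[OF lin, symmetric])
    moreover have "(\<lambda>v. \<Sum>b\<in>Basis. (x \<bullet> b) * E b (t *\<^sub>R x) (t *\<^sub>R v) + (v \<bullet> b) * \<alpha> (t *\<^sub>R x) b)
        = blinfun_apply (fx x t)"
    proof
      fix v
      have "E x (t *\<^sub>R x) (t *\<^sub>R v) + \<alpha> (t *\<^sub>R x) v = blinfun_apply (fx x t) v"
        unfolding fx by (simp add: linear_cmul[OF linE] sym)
      then show "(\<Sum>b\<in>Basis. (x \<bullet> b) * E b (t *\<^sub>R x) (t *\<^sub>R v) + (v \<bullet> b) * \<alpha> (t *\<^sub>R x) b)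
          = blinfun_apply (fx x t) v"
        unfolding sum.distrib linear_expand_Basis[OF linE1, symmetric]
          linear_expand_Basis[OF lin, symmetric] .
    qed
    ultimately show ?thesis by simp
  qed
  have contf: "continuous_on (cbox 0 1) (f x)" for x
  proof -
    have "continuous_on (cbox 0 1) (\<lambda>t. \<alpha> (t *\<^sub>R x) x)"
      by (rule continuous_on_compose2[OF cont\<alpha>]) (auto intro!: continuous_intros)
    then show ?thesis unfolding f_def .
  qed
  have contfx: "continuous_on (UNIV \<times> cbox (0::real) 1) (\<lambda>(x, t). fx x t)"
    unfolding fx_def split_beta
    by (intro continuous_intros bounded_linear.continuous_on[OF bounded_linear_blinfun_inner_right]
        continuous_on_compose2[OF cont\<alpha>] continuous_on_compose2[OF contE]) auto
  define \<phi> where "\<phi> = (\<lambda>x. integral (cbox 0 1) (f x))"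
  have "(\<phi> has_derivative \<alpha> x) (at x)" for x
  proof -
    have d: "(\<phi> has_derivative blinfun_apply (integral (cbox 0 1) (fx x))) (at x)"
      unfolding \<phi>_def
      by (rule leibniz_rule[OF df integrable_continuous[OF contf] contfx]) simp_all
    have cx: "continuous_on (cbox 0 1) (fx x)"
      using continuous_on_compose2[OF contfx, of "cbox 0 1" "\<lambda>t. (x, t)"]
      by (simp add: continuous_on_Pair image_subset_iff)
    have "blinfun_apply (integral (cbox 0 1) (fx x)) v = \<alpha> x v" for v
    proof -
      have "blinfun_apply (integral (cbox 0 1) (fx x)) v = integral (cbox 0 1) (\<lambda>t. blinfun_apply (fx x t) v)"
        by (rule blinfun_apply_integral[OF integrable_continuous[OF cx]])
      \<comment> \<open>Boundary values of the primitive
        \<open>t * \<alpha> (t *\<^sub>R x) v\<close>; the factor \<open>t\<close> kills the lower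
        one.\<close>
      also have "\<dots> = 1 * \<alpha> (1 *\<^sub>R x) v - 0 * \<alpha> (0 *\<^sub>R x) v"
        unfolding fx cbox_interval
      proof (rule integral_unique, rule fundamental_theorem_of_calculus)
        fix t :: real
        have "((\<lambda>t. \<alpha> (t *\<^sub>R x) v) has_derivative (\<lambda>r. E v (t *\<^sub>R x) (r *\<^sub>R x))) (at t)"
          using has_derivative_compose_affine[OF bounded_linear_scaleR_left[of x], of "\<lambda>y. \<alpha> y v" _ 0 t]
            dE[of v "t *\<^sub>R x"] by simp
        then have "((\<lambda>t. \<alpha> (t *\<^sub>R x) v) has_vector_derivative E v (t *\<^sub>R x) x) (at t)"
          unfolding has_vector_derivative_def by (simp add: linear_cmul[OF linE])
        then have "((\<lambda>t. t * \<alpha> (t *\<^sub>R x) v) has_vector_derivative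
            (t * E v (t *\<^sub>R x) x + 1 * \<alpha> (t *\<^sub>R x) v)) (at t)"
          by (intro has_vector_derivative_mult has_vector_derivative_id)
        then show "((\<lambda>t. t * \<alpha> (t *\<^sub>R x) v) has_vector_derivative
            (\<alpha> (t *\<^sub>R x) v + t * E v (t *\<^sub>R x) x)) (at t within {0..1})"
          by (simp add: has_vector_derivative_at_within add.commute)
      qed simp
      finally show ?thesis by simp
    qed
    then have "blinfun_apply (integral (cbox 0 1) (fx x)) = \<alpha> x" by blast
    with d show ?thesis by simp
  qed
  then show ?thesis by (rule that)
qed

section \<open>Stokes' theorem on a square for quasi-periodic maps\<close>

lemma smooth_on_partial_derivatives:
  assumes "smooth_on H (UNIV :: (real \<times> real) set)"
  shows "((\<lambda>s. H (s, t)) has_vector_derivative frechet_derivative H (at (s, t)) (1, 0)) (at s)"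
    and "((\<lambda>t. H (s, t)) has_vector_derivative frechet_derivative H (at (s, t)) (0, 1)) (at t)"
proof -
  have d: "(H has_derivative frechet_derivative H (at (s, t))) (at (s, t))"
    by (rule smooth_on_has_derivative[OF assms]) simp
  have lin: "linear (frechet_derivative H (at (s, t)))" by (rule has_derivative_linear[OF d])
  have "((\<lambda>r. (r, t)) has_derivative (\<lambda>r. (r, 0))) (at s)"
    by (rule has_derivative_Pair[OF has_derivative_ident has_derivative_const])
  from has_derivative_compose[OF this d]
  have "((\<lambda>r. H (r, t)) has_derivative (\<lambda>r. frechet_derivative H (at (s, t)) (r, 0))) (at s)" .
  moreover have "((\<lambda>r. (s, r)) has_derivative (\<lambda>r. (0, r))) (at t)"
    by (rule has_derivative_Pair[OF has_derivative_const has_derivative_ident])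
  from has_derivative_compose[OF this d]
  have "((\<lambda>r. H (s, r)) has_derivative (\<lambda>r. frechet_derivative H (at (s, t)) (0, r))) (at t)" .
  moreover have "r *\<^sub>R frechet_derivative H (at (s, t)) (1, 0) = frechet_derivative H (at (s, t)) (r, 0)"
    "r *\<^sub>R frechet_derivative H (at (s, t)) (0, 1) = frechet_derivative H (at (s, t)) (0, r)" for r
    using linear_cmul[OF lin, of r "(1, 0)"] linear_cmul[OF lin, of r "(0, 1)"] by simp_all
  ultimately show "((\<lambda>s. H (s, t)) has_vector_derivative frechet_derivative H (at (s, t)) (1, 0)) (at s)"
    "((\<lambda>t. H (s, t)) has_vector_derivative frechet_derivative H (at (s, t)) (0, 1)) (at t)"
    by (simp_all add: has_vector_derivative_def)
qed

text \<open>Schwarz's theorem through integrals: write \<open>G\<close> as the integral of its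
  \<open>t\<close>-derivative, differentiate in \<open>s\<close> under the integral, then recover
  the integrand by differentiating in the upper limit.\<close>

lemma mixed_partial_derivatives:
  fixes G :: "real \<times> real \<Rightarrow> 'b::banach"
  assumes "smooth_on G UNIV"
  defines "Gs \<equiv> \<lambda>z. frechet_derivative G (at z) (1, 0)"
    and "Gt \<equiv> \<lambda>z. frechet_derivative G (at z) (0, 1)"
  shows "frechet_derivative Gs (at (s, t)) (0, 1) = frechet_derivative Gt (at (s, t)) (1, 0)"
proof -
  have smGs: "smooth_on Gs UNIV" and smGt: "smooth_on Gt UNIV"
    unfolding Gs_def Gt_def by (intro smooth_on_deriv assms)+
  define Gts where "Gts = (\<lambda>z. frechet_derivative Gt (at z) (1, 0))"
  have pG: "((\<lambda>s. G (s, t)) has_vector_derivative Gs (s, t)) (at s)"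
    "((\<lambda>t. G (s, t)) has_vector_derivative Gt (s, t)) (at t)" for s t
    unfolding Gs_def Gt_def by (rule smooth_on_partial_derivatives[OF assms(1)])+
  note pGs = smooth_on_partial_derivatives[OF smGs]
  have pGt: "((\<lambda>s. Gt (s, t)) has_vector_derivative Gts (s, t)) (at s)" for s t
    unfolding Gts_def by (rule smooth_on_partial_derivatives[OF smGt])
  have contt: "continuous_on A (\<lambda>t. Gt (x, t))" for x A
    by (rule continuous_on_compose2[OF smooth_on_continuous[OF smGt]]) (auto intro!: continuous_intros)
  have contts: "continuous_on A Gts" for A
    unfolding Gts_def
    by (rule continuous_on_subset[OF smooth_on_continuous[OF smooth_on_deriv[OF smGt]]]) simp
  \<comment> \<open>Starting the integral strictly below \<open>t\<close> and letting
    \<open>r\<close> run up to \<open>t + 1\<close> puts \<open>t\<close> in the interior, so that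
    the derivative within the interval is a two-sided one.\<close>
  define c where "c = t - 1"
  have int: "G (x, r) = G (x, c) + integral {c..r} (\<lambda>t. Gt (x, t))" if "c \<le> r" for x r
    using integral_unique[OF fundamental_theorem_of_calculus[OF that, of "\<lambda>t. G (x, t)"]]
      pG(2) by (simp add: has_vector_derivative_at_within)
  have Gs_eq: "Gs (s, r) = Gs (s, c) + integral {c..r} (\<lambda>t. Gts (s, t))" if "c \<le> r" for r
  proof -
    have "((\<lambda>x. integral (cbox c r) (\<lambda>t. Gt (x, t))) has_vector_derivative
        integral (cbox c r) (\<lambda>t. Gts (s, t))) (at s within UNIV)"
      by (rule leibniz_rule_vector_derivative[where f = "\<lambda>x t. Gt (x, t)"])
        (auto intro!: pGt integrable_continuous_interval contt contts)
    then have "((\<lambda>x. G (x, c) + integral (cbox c r) (\<lambda>t. Gt (x, t))) has_vector_derivative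
        Gs (s, c) + integral (cbox c r) (\<lambda>t. Gts (s, t))) (at s)"
      by (intro has_vector_derivative_add pG) simp
    then have "((\<lambda>x. G (x, r)) has_vector_derivative
        Gs (s, c) + integral (cbox c r) (\<lambda>t. Gts (s, t))) (at s)"
      using int[OF that] by (simp add: cbox_interval)
    from vector_derivative_unique_at[OF pG(1) this] show ?thesis by (simp add: cbox_interval)
  qed
  have "continuous_on {c..t + 1} (\<lambda>t. Gts (s, t))"
    by (rule continuous_on_compose2[OF contts]) (auto intro!: continuous_intros)
  then have "((\<lambda>r. integral {c..r} (\<lambda>t. Gts (s, t))) has_vector_derivative Gts (s, t)) (at t within {c..t + 1})"
    by (rule integral_has_vector_derivative) (simp add: c_def)
  then have "((\<lambda>r. Gs (s, c) + integral {c..r} (\<lambda>t. Gts (s, t))) has_vector_derivative 0 + Gts (s, t))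
      (at t within {c..t + 1})"
    by (intro has_vector_derivative_add has_vector_derivative_const)
  moreover have "Gs (s, r) = Gs (s, c) + integral {c..r} (\<lambda>t. Gts (s, t))" if "r \<in> {c..t + 1}" for r
    using that by (intro Gs_eq) simp
  moreover have "t \<in> {c..t + 1}" by (simp add: c_def)
  ultimately have "((\<lambda>r. Gs (s, r)) has_vector_derivative Gts (s, t)) (at t within {c..t + 1})"
    unfolding add_0 by (metis (no_types, lifting) has_vector_derivative_transform)
  moreover have "at t within {c..t + 1} = at t"
    by (rule at_within_interior) (simp add: c_def)
  ultimately have "((\<lambda>r. Gs (s, r)) has_vector_derivative Gts (s, t)) (at t)" by simp
  from vector_derivative_unique_at[OF pGs(2) this] show ?thesis by (simp add: Gts_def)
qed

text \<open>Stokes' theorem: \<open>c\<close> is the integral over the unit square of the pullback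
  of \<open>B\<close>, whose primitive is half of \<open>B x dx\<close>, and by quasi-periodicity
  opposite edges differ only by \<open>a\<close> and \<open>b\<close>. The proof evaluates
  \<open>f 1 - f 0\<close> twice, as \<open>2 * c + B b a\<close> and as \<open>B a b\<close>;
  skewness then gives the claim.\<close>

lemma period_of_constant_two_form:
  fixes G :: "real \<times> real \<Rightarrow> 'b::banach" and B :: "'b \<Rightarrow> 'b \<Rightarrow> real"
  assumes sm: "smooth_on G UNIV" and B: "bounded_bilinear B" and skew: "\<And>u v. B u v = - B v u"
    and per1: "\<And>s t. G (s + 1, t) = G (s, t) + a" and per2: "\<And>s t. G (s, t + 1) = G (s, t) + b"
    and const: "\<And>z. B (frechet_derivative G (at z) (1, 0)) (frechet_derivative G (at z) (0, 1)) = c"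
  shows "B a b = c"
proof -
  interpret B: bounded_bilinear B by (rule B)
  define Gs where "Gs = (\<lambda>z. frechet_derivative G (at z) (1, 0))"
  define Gt where "Gt = (\<lambda>z. frechet_derivative G (at z) (0, 1))"
  define Gts where "Gts = (\<lambda>z. frechet_derivative Gt (at z) (1, 0))"
  have smGs: "smooth_on Gs UNIV" and smGt: "smooth_on Gt UNIV"
    unfolding Gs_def Gt_def by (intro smooth_on_deriv sm)+
  have pG: "((\<lambda>s. G (s, t)) has_vector_derivative Gs (s, t)) (at s)"
    "((\<lambda>t. G (s, t)) has_vector_derivative Gt (s, t)) (at t)" for s t
    unfolding Gs_def Gt_def by (rule smooth_on_partial_derivatives[OF sm])+
  have mix: "frechet_derivative Gs (at (s, t)) (0, 1) = Gts (s, t)" for s t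
    unfolding Gts_def Gs_def Gt_def by (rule mixed_partial_derivatives[OF sm])
  note pGs = smooth_on_partial_derivatives(2)[OF smGs, unfolded mix]
  have pGt: "((\<lambda>s. Gt (s, t)) has_vector_derivative Gts (s, t)) (at s)" for s t
    unfolding Gts_def by (rule smooth_on_partial_derivatives[OF smGt])
  have cG: "continuous_on A G" and cGs: "continuous_on A Gs" and cGt: "continuous_on A Gt"
    and cGts: "continuous_on A Gts" for A
    unfolding Gts_def
    by (auto intro!: continuous_on_subset[OF smooth_on_continuous] sm smGs smGt smooth_on_deriv)
  \<comment> \<open>Twice the integral of the primitive along the vertical segment at
    \<open>s\<close>.\<close>
  define f where "f = (\<lambda>s. integral (cbox 0 1) (\<lambda>t. B (G (s, t)) (Gt (s, t))))"
  have int: "(\<lambda>t. B (G (s, t)) (Gt (s, t))) integrable_on cbox 0 1" for s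
    by (intro integrable_continuous B.continuous_on continuous_on_compose2[OF cG[of UNIV]]
        continuous_on_compose2[OF cGt[of UNIV]]) (auto intro!: continuous_intros)
  have df: "(f has_vector_derivative 2 * c + B b (Gs (s, 0))) (at s)" for s
  proof -
    have "(f has_vector_derivative
        integral (cbox 0 1) (\<lambda>t. B (G (s, t)) (Gts (s, t)) + B (Gs (s, t)) (Gt (s, t)))) (at s within UNIV)"
      unfolding f_def
    proof (rule leibniz_rule_vector_derivative[OF _ int])
      show "continuous_on (UNIV \<times> cbox 0 1) (\<lambda>(s, t). B (G (s, t)) (Gts (s, t)) + B (Gs (s, t)) (Gt (s, t)))"
        by (simp add: split_beta) (intro continuous_intros B.continuous_on cG cGs cGt cGts)
    qed (auto intro!: B.has_vector_derivative pG pGt)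
    \<comment> \<open>Trading \<open>B Gs Gt\<close> for \<open>2 * c + B Gt Gs\<close> leaves the
      \<open>t\<close>-derivative of \<open>B G Gs\<close>, which integrates to boundary
      terms.\<close>
    also have "integral (cbox 0 1) (\<lambda>t. B (G (s, t)) (Gts (s, t)) + B (Gs (s, t)) (Gt (s, t)))
        = integral {0..1} (\<lambda>t. 2 * c + (B (G (s, t)) (Gts (s, t)) + B (Gt (s, t)) (Gs (s, t))))"
    proof -
      have "B (Gs z) (Gt z) = c" "B (Gt z) (Gs z) = - c" for z
        using const[of z] skew[of "Gt z" "Gs z"] by (simp_all add: Gs_def Gt_def)
      then show ?thesis by (simp add: cbox_interval algebra_simps)
    qed
    also have "\<dots> = (2 * c * 1 + B (G (s, 1)) (Gs (s, 1))) - (2 * c * 0 + B (G (s, 0)) (Gs (s, 0)))"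
      by (rule integral_unique, rule fundamental_theorem_of_calculus,
          simp, intro has_vector_derivative_add has_vector_derivative_at_within[OF B.has_vector_derivative]
            pG pGs) (auto intro!: derivative_eq_intros has_vector_derivative_eq_rhs[OF
              has_real_derivative_iff_has_vector_derivative[THEN iffD1]])
    also have "\<dots> = 2 * c + B b (Gs (s, 0))"
    proof -
      have "((\<lambda>s. G (s, 0) + b) has_vector_derivative Gs (s, 0) + 0) (at s)"
        by (intro has_vector_derivative_add has_vector_derivative_const pG)
      then have "((\<lambda>s. G (s, 1)) has_vector_derivative Gs (s, 0)) (at s)"
        using per2[of _ 0] by simp
      then have "Gs (s, 1) = Gs (s, 0)" using vector_derivative_unique_at pG(1) by blast
      then show ?thesis using per2[of s 0] by (simp add: B.add_left)
    qed
    finally show ?thesis by simp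
  qed
  \<comment> \<open>First evaluation: the subtracted function has the derivative just found, so the
    difference is constant.\<close>
  have "((\<lambda>s. f s - (s * (2 * c) + B b (G (s, 0)))) has_vector_derivative
      (2 * c + B b (Gs (s, 0))) - ((s * 0 + 1 * (2 * c)) + (B b (Gs (s, 0)) + B 0 (G (s, 0))))) (at s)" for s
    by (intro has_vector_derivative_diff has_vector_derivative_add has_vector_derivative_mult
        has_vector_derivative_const has_vector_derivative_id df B.has_vector_derivative pG)
  then have "((\<lambda>s. f s - (s * (2 * c) + B b (G (s, 0)))) has_derivative (\<lambda>h. 0)) (at s within UNIV)" for s
    by (simp add: has_vector_derivative_def B.zero_left)
  from has_derivative_zero_constant[OF convex_UNIV this]
  obtain C where "f s - (s * (2 * c) + B b (G (s, 0))) = C" for s by auto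
  from this[of 1] this[of 0]
  have "f 1 - (1 * (2 * c) + B b (G (1, 0))) = f 0 - (0 * (2 * c) + B b (G (0, 0)))" by simp
  moreover have "B b (G (1, 0)) = B b (G (0, 0)) + B b a"
    using per1[of 0 0] by (simp add: B.add_right)
  \<comment> \<open>Second evaluation: the integrands at \<open>s = 1\<close> and
    \<open>s = 0\<close> differ by \<open>B a Gt\<close>, the \<open>t\<close>-derivative of
    \<open>B a G\<close>.\<close>
  moreover have "f 1 - f 0 = B a b"
  proof -
    have Gt1: "Gt (1, t) = Gt (0, t)" for t
    proof -
      have "((\<lambda>t. G (0, t) + a) has_vector_derivative Gt (0, t) + 0) (at t)"
        by (intro has_vector_derivative_add has_vector_derivative_const pG)
      then have "((\<lambda>t. G (1, t)) has_vector_derivative Gt (0, t)) (at t)"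
        using per1[of 0] by simp
      then show ?thesis using vector_derivative_unique_at pG(2) by blast
    qed
    have "f 1 - f 0 = integral (cbox 0 1) (\<lambda>t. B (G (1, t)) (Gt (1, t)) - B (G (0, t)) (Gt (0, t)))"
      unfolding f_def by (rule integral_diff[OF int int, symmetric])
    also have "\<dots> = integral {0..1} (\<lambda>t. B a (Gt (0, t)) + B 0 (G (0, t)))"
      using per1[of 0] Gt1 by (simp add: B.add_left B.zero_left cbox_interval)
    also have "\<dots> = B a (G (0, 1)) - B a (G (0, 0))"
      by (rule integral_unique, rule fundamental_theorem_of_calculus, simp,
          intro has_vector_derivative_at_within[OF B.has_vector_derivative] pG has_vector_derivative_const)
    also have "\<dots> = B a b" using per2[of 0 0] by (simp add: B.add_right)
    finally show ?thesis .
  qed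
  ultimately show ?thesis using skew[of b a] by simp
qed

section \<open>Lifting maps to the torus and periods of symplectic forms\<close>

lemma int_lattice_0: "0 \<in> int_lattice"
  by (simp add: int_lattice_def)

lemma int_lattice_add: "a \<in> int_lattice \<Longrightarrow> b \<in> int_lattice \<Longrightarrow> a + b \<in> int_lattice"
  by (simp add: int_lattice_def)

lemma int_lattice_diff: "a \<in> int_lattice \<Longrightarrow> b \<in> int_lattice \<Longrightarrow> a - b \<in> int_lattice"
  by (simp add: int_lattice_def)

lemma int_lattice_minus: "a \<in> int_lattice \<Longrightarrow> - a \<in> int_lattice"
  by (simp add: int_lattice_def)

lemma int_lattice_axis: "axis i 1 \<in> int_lattice"
  by (simp add: int_lattice_def axis_def)

lemma cis_2pi_eq_iff: "cis (2 * pi * x) = cis (2 * pi * y) \<longleftrightarrow> x - y \<in> \<int>"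
proof
  assume "cis (2 * pi * x) = cis (2 * pi * y)"
  then obtain n :: int where "2 * pi * x = 2 * pi * y + 2 * pi * n"
    using sin_cos_eq_iff[of "2 * pi * x" "2 * pi * y"] by (auto simp: complex_eq_iff)
  then have "2 * pi * (x - y) = 2 * pi * n" by (simp add: algebra_simps)
  then have "x - y = n" by simp
  then show "x - y \<in> \<int>" by simp
next
  assume "x - y \<in> \<int>"
  then have "cis (2 * pi * y + 2 * pi * (x - y)) = cis (2 * pi * y)"
    by (simp only: cis_mult[symmetric] cis_multiple_2pi mult_1_right)
  then show "cis (2 * pi * x) = cis (2 * pi * y)" by (simp add: algebra_simps)
qed

lemma continuous_int_lattice_constant:
  fixes f :: "'a::topological_space \<Rightarrow> real^'n::finite"
  assumes "connected S" "continuous_on S f" "\<And>x. x \<in> S \<Longrightarrow> f x \<in> int_lattice" "x \<in> S" "y \<in> S"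
  shows "f x = f y"
proof (rule vec_eq_iff[THEN iffD2], rule allI)
  fix i
  have "(\<lambda>x. f x $ i) constant_on S"
  proof (rule continuous_discrete_range_constant[OF assms(1)])
    show "continuous_on S (\<lambda>x. f x $ i)" by (intro continuous_intros assms(2))
    fix x assume x: "x \<in> S"
    have "1 \<le> norm (f y $ i - f x $ i)" if "y \<in> S" "f y $ i \<noteq> f x $ i" for y
      using Ints_nonzero_abs_ge1[of "f y $ i - f x $ i"] that assms(3)[OF x] assms(3)[OF that(1)]
      by (simp add: int_lattice_def)
    then show "\<exists>e>0. \<forall>y. y \<in> S \<and> f y $ i \<noteq> f x $ i \<longrightarrow> e \<le> norm (f y $ i - f x $ i)"
      by (intro exI[of _ 1]) simp
  qed
  then show "f x $ i = f y $ i" using assms(4,5) by (auto simp: constant_on_def)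
qed

text \<open>Here \<open>u\<close> itself may jump; only its class modulo the lattice is continuous.
  Each coordinate therefore gives a continuous map to the circle, which has a continuous logarithm
  because the domain is contractible.\<close>

lemma continuous_lift_int_lattice:
  fixes u :: "'a::real_normed_vector \<Rightarrow> real^'n::finite"
  assumes "\<And>z. \<exists>N f. open N \<and> z \<in> N \<and> continuous_on N f \<and> (\<forall>w\<in>N. u w - f w \<in> int_lattice)"
  obtains h where "continuous_on UNIV h" "\<And>z. h z - u z \<in> int_lattice"
proof -
  have "\<exists>h. continuous_on UNIV h \<and> (\<forall>z. h z - u z $ i \<in> \<int>)" for i
  proof -
    have "isCont (\<lambda>z. cis (2 * pi * u z $ i)) z" for z
    proof -
      obtain N f where N: "open N" "z \<in> N" "continuous_on N f" "\<And>w. w \<in> N \<Longrightarrow> u w - f w \<in> int_lattice"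
        using assms[of z] by blast
      have "continuous_on N (\<lambda>z. cis (2 * pi * f z $ i))"
        unfolding cis_conv_exp by (intro continuous_intros N)
      moreover have "cis (2 * pi * u w $ i) = cis (2 * pi * f w $ i)" if "w \<in> N" for w
        using N(4)[OF that] by (simp only: cis_2pi_eq_iff) (simp add: int_lattice_def)
      ultimately have "continuous_on N (\<lambda>z. cis (2 * pi * u z $ i))"
        by (simp cong: continuous_on_cong)
      then show ?thesis using N by (simp add: continuous_on_eq_continuous_at)
    qed
    then have "continuous_on UNIV (\<lambda>z. cis (2 * pi * u z $ i))"
      by (simp add: continuous_at_imp_continuous_on)
    then obtain g where g: "continuous_on UNIV g" "\<And>z. cis (2 * pi * u z $ i) = exp (g z)"
      by (rule continuous_logarithm_on_contractible[OF _ contractible_UNIV]) auto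
    define h where "h = (\<lambda>z. Im (g z) / (2 * pi))"
    have "h z - u z $ i \<in> \<int>" for z
    proof -
      have "norm (exp (g z)) = 1" by (simp flip: g(2))
      then have "Re (g z) = 0" by simp
      then have "g z = \<i> * of_real (2 * pi * h z)" by (simp add: complex_eq_iff h_def)
      then have "cis (2 * pi * h z) = cis (2 * pi * u z $ i)"
        using g(2)[of z] by (simp add: cis_conv_exp)
      then show ?thesis by (simp only: cis_2pi_eq_iff)
    qed
    moreover have "continuous_on UNIV h" unfolding h_def by (intro continuous_intros g) simp
    ultimately show ?thesis by blast
  qed
  then obtain h where h: "\<And>i. continuous_on UNIV (h i)" "\<And>i z. h i z - u z $ i \<in> \<int>" by metis
  show ?thesis
    by (rule that[of "\<lambda>z. \<chi> i. h i z"]) (auto intro!: continuous_intros h simp: int_lattice_def)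
qed

lemma orbit_eq:
  fixes j :: "real^'n::finite \<Rightarrow> 'x::real_normed_vector"
  assumes "bounded_linear j" "n \<in> int_lattice"
  shows "orbit (j ` int_lattice) (x + j n) = orbit (j ` int_lattice) x"
proof -
  interpret bounded_linear j by (rule assms)
  have "(\<lambda>m. x + j n + j m) ` int_lattice = (\<lambda>m. x + j m) ` int_lattice"
  proof (intro equalityI image_subsetI)
    fix m :: "real^'n" assume m: "m \<in> int_lattice"
    show "x + j n + j m \<in> (\<lambda>m. x + j m) ` int_lattice"
      using m assms(2) by (intro image_eqI[of _ _ "n + m"]) (simp_all add: add int_lattice_add)
    show "x + j m \<in> (\<lambda>m. x + j n + j m) ` int_lattice"
      using m assms(2) by (intro image_eqI[of _ _ "m - n"]) (simp_all add: diff int_lattice_diff)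
  qed
  then show ?thesis by (simp add: orbit_def image_image)
qed

text \<open>Stated for an embedding \<open>j\<close> of the lattice with retraction
  \<open>p\<close>, so that it covers the torus (\<open>j\<close> the identity) and the cotangent
  bundle (\<open>j v = (v, 0)\<close>, \<open>p = fst\<close>). The open set \<open>U\<close>
  matters only through the translate of the range of \<open>j\<close> in which the plane
  \<open>y\<close> lies.\<close>

lemma symplectomorphic_periods:
  fixes j :: "real^'n::finite \<Rightarrow> 'x::euclidean_space"
  assumes j: "bounded_linear j" and p: "bounded_linear p" and pj: "\<And>v. p (j v) = v"
    and U: "\<And>v. x0 + j v \<in> U"
    and B2: "bounded_bilinear B2" and skew: "\<And>u v. B2 u v = - B2 v u"
    and sym: "symplectomorphic (j ` int_lattice) U (\<lambda>_. B1) (\<lambda>_. B2)"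
    and a: "a \<in> int_lattice" and b: "b \<in> int_lattice"
  obtains a' b' where "a' \<in> int_lattice" "b' \<in> int_lattice" "B2 (j a') (j b') = B1 (j a) (j b)"
proof -
  interpret j: bounded_linear j by (rule j)
  interpret p: bounded_linear p by (rule p)
  define \<Gamma> where "\<Gamma> = j ` int_lattice"
  obtain \<phi> where \<phi>: "diffeo \<Gamma> U \<phi>"
    and pull': "\<forall>W F. smooth_lift \<Gamma> U \<phi> W F \<longrightarrow>
      (\<forall>x\<in>W. \<forall>u v. pullback F (\<lambda>_. B2) x u v = B1 u v)"
    using sym unfolding symplectomorphic_def \<Gamma>_def[symmetric] by (elim exE conjE) (rule that)
  have pull: "pullback F (\<lambda>_. B2) x u v = B1 u v" if "smooth_lift \<Gamma> U \<phi> W F" "x \<in> W" for W F x u v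
    using pull'[THEN spec, THEN spec, THEN mp, OF that(1)] that(2) by simp
  define l where "l = (\<lambda>z. j (fst z *\<^sub>R a + snd z *\<^sub>R b))"
  define y where "y = (\<lambda>z. x0 + l z)"
  \<comment> \<open>An arbitrary, possibly discontinuous choice of a point in the image orbit. It
    depends on the orbit of \<open>y z\<close> alone, which later makes \<open>G\<close>
    quasi-periodic.\<close>
  define r where "r = (\<lambda>z. SOME x. x \<in> \<phi> (orbit \<Gamma> (y z)))"
  have l: "bounded_linear l"
    unfolding l_def by (intro bounded_linear_compose[OF j] bounded_linear_intros)
  have conty: "continuous_on A y" for A
    unfolding y_def by (intro continuous_intros linear_continuous_on l)
  have lift: "\<exists>W F. y z \<in> W \<and> smooth_lift \<Gamma> U \<phi> W F" for z
    using \<phi> U unfolding diffeo_def smooth_map_def y_def l_def by blast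
  have r: "\<exists>n\<in>int_lattice. r z = F (y z) + j n" if "smooth_lift \<Gamma> U \<phi> W F" "y z \<in> W" for z W F
  proof -
    have eq: "\<phi> (orbit \<Gamma> (y z)) = orbit \<Gamma> (F (y z))" using that by (simp add: smooth_lift_def)
    have "F (y z) + j 0 \<in> \<phi> (orbit \<Gamma> (y z))"
      unfolding eq unfolding orbit_def \<Gamma>_def image_image by (rule imageI) (rule int_lattice_0)
    then have "r z \<in> orbit \<Gamma> (F (y z))" unfolding r_def eq by (rule someI)
    then show ?thesis by (auto simp: orbit_def \<Gamma>_def)
  qed
  obtain h where conth: "continuous_on UNIV h" and h: "\<And>z. h z - p (r z) \<in> int_lattice"
  proof (rule continuous_lift_int_lattice[of "\<lambda>z. p (r z)"])
    fix z
    obtain W F where WF: "y z \<in> W" "smooth_lift \<Gamma> U \<phi> W F" using lift by blast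
    then have W: "open W" "smooth_on F W" by (auto simp: smooth_lift_def)
    have "open (y -` W)" by (rule open_vimage[OF W(1) conty])
    moreover have "continuous_on (y -` W) (\<lambda>z. p (F (y z)))"
      by (intro p.continuous_on continuous_on_compose2[OF smooth_on_continuous[OF W(2)]] conty) auto
    moreover have "p (r w) - p (F (y w)) \<in> int_lattice" if w: "w \<in> y -` W" for w
    proof -
      have "y w \<in> W" using w by simp
      from r[OF WF(2) this] show ?thesis by (auto simp: p.add pj)
    qed
    ultimately show "\<exists>N f. open N \<and> z \<in> N \<and> continuous_on N f \<and> (\<forall>w\<in>N. p (r w) - f w \<in> int_lattice)"
      using WF(1) by (intro exI[of _ "y -` W"] exI[of _ "\<lambda>z. p (F (y z))"]) auto
  qed blast
  \<comment> \<open>The correction by a group element makes \<open>p (G z)\<close> equal to the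
    continuous function \<open>h z\<close>; as the jumps of \<open>r\<close> lie in the group and
    are seen by \<open>p\<close>, this removes them.\<close>
  define G where "G = (\<lambda>z. r z + j (h z - p (r z)))"
  have G: "G z = F (y z) + j (h z - p (F (y z)))" "h z - p (F (y z)) \<in> int_lattice"
    if WF: "smooth_lift \<Gamma> U \<phi> W F" "y z \<in> W" for W F z
  proof -
    obtain n where n: "n \<in> int_lattice" "r z = F (y z) + j n" using r[OF WF] by blast
    show "G z = F (y z) + j (h z - p (F (y z)))"
      by (simp add: G_def n(2) p.add pj j.diff j.add)
    show "h z - p (F (y z)) \<in> int_lattice"
      using int_lattice_add[OF h[of z] n(1)] by (simp add: n(2) p.add pj)
  qed
  \<comment> \<open>\<open>G\<close> and a local smooth lift differ by \<open>j\<close> of a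
    continuous integer vector, hence by a constant on a ball. Smoothness and the derivative of
    \<open>G\<close> are read off from this.\<close>
  have local: "\<exists>W F T c. smooth_lift \<Gamma> U \<phi> W F \<and> y z \<in> W \<and> open T \<and> z \<in> T \<and> T \<subseteq> y -` W \<and>
      (\<forall>w\<in>T. G w = F (y w) + c)" for z
  proof -
    obtain W F where WF: "y z \<in> W" "smooth_lift \<Gamma> U \<phi> W F" using lift by blast
    then have W: "open W" "smooth_on F W" by (auto simp: smooth_lift_def)
    have "open (y -` W)" by (rule open_vimage[OF W(1) conty])
    then obtain e where e: "e > 0" "ball z e \<subseteq> y -` W"
      using WF(1) by (meson open_contains_ball vimageI)
    have cont: "continuous_on (ball z e) (\<lambda>w. h w - p (F (y w)))"
      by (intro continuous_on_diff continuous_on_subset[OF conth] p.continuous_on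
          continuous_on_compose2[OF smooth_on_continuous[OF W(2)]] conty) (use e in auto)
    have "h w - p (F (y w)) = h z - p (F (y z))" if "w \<in> ball z e" for w
      by (rule continuous_int_lattice_constant[OF connected_ball cont])
        (use e G(2)[OF WF(2)] that in auto)
    then have "G w = F (y w) + j (h z - p (F (y z)))" if "w \<in> ball z e" for w
      using G(1)[OF WF(2), of w] e(2) that by (metis subsetD vimageD)
    then show ?thesis using e(1) WF e(2) by (intro exI[of _ W] exI[of _ F] exI[of _ "ball z e"]) auto
  qed
  have smG: "smooth_on G UNIV"
    unfolding smooth_on_def
  proof (intro allI Ck_on_local)
    fix k z
    obtain W F T c where *: "smooth_lift \<Gamma> U \<phi> W F" "open T" "z \<in> T" "T \<subseteq> y -` W"
      "\<forall>w\<in>T. G w = F (y w) + c" using local[of z] by blast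
    have "Ck_on k (\<lambda>w. F (y w)) (y -` W)"
      unfolding y_def by (rule Ck_on_compose_affine[OF _ l]) (use *(1) in \<open>auto simp: smooth_lift_def smooth_on_def\<close>)
    then have "Ck_on k (\<lambda>w. F (y w) + c) T"
      by (intro Ck_on_add *(2) Ck_on_subset[OF Ck_on_const] subset_UNIV) (rule Ck_on_subset[OF _ *(4)])
    then have "Ck_on k G T" using Ck_on_cong[OF *(2), of G "\<lambda>w. F (y w) + c"] *(5) by simp
    then show "\<exists>T. open T \<and> z \<in> T \<and> Ck_on k G T" using * by blast
  qed
  have DG: "B2 (frechet_derivative G (at z) (1, 0)) (frechet_derivative G (at z) (0, 1)) = B1 (j a) (j b)" for z
  proof -
    obtain W F T c where *: "smooth_lift \<Gamma> U \<phi> W F" "y z \<in> W" "open T" "z \<in> T" "T \<subseteq> y -` W"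
      "\<forall>w\<in>T. G w = F (y w) + c" using local[of z] by blast
    have dF: "(F has_derivative frechet_derivative F (at (y z))) (at (y z))"
      by (rule smooth_on_has_derivative[OF _ *(2)]) (use *(1) in \<open>simp add: smooth_lift_def\<close>)
    have "frechet_derivative G (at z) = frechet_derivative (\<lambda>w. F (y w) + c) (at z)"
      by (rule frechet_derivative_cong_open(1)[OF *(3,4)]) (use *(6) in blast)
    also have "\<dots> = (\<lambda>v. frechet_derivative F (at (y z)) (l v))"
    proof (rule frechet_derivative_at_eq)
      have "((\<lambda>w. F (y w)) has_derivative (\<lambda>v. frechet_derivative F (at (y z)) (l v))) (at z)"
        unfolding y_def by (rule has_derivative_compose_affine[OF l dF[unfolded y_def]])
      from has_derivative_add[OF this has_derivative_const[of c]]
      show "((\<lambda>w. F (y w) + c) has_derivative (\<lambda>v. frechet_derivative F (at (y z)) (l v))) (at z)" by simp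
    qed
    finally show ?thesis
      using pull[OF *(1,2), of "j a" "j b"] by (simp add: l_def pullback_def)
  qed
  \<comment> \<open>A shift by a period leaves the orbit and therefore \<open>r\<close> unchanged,
    so \<open>G\<close> moves by \<open>j\<close> of an increment of \<open>h\<close>. That
    increment is an integer vector continuous in \<open>z\<close>, hence independent of
    \<open>z\<close>.\<close>
  have per: "G (z + e) = G z + j (h e - h 0)" "h e - h 0 \<in> int_lattice"
    if le: "\<And>z. y (z + e) = y z + j n" "n \<in> int_lattice" for z e n
  proof -
    have re: "r (z + e) = r z" for z
      unfolding r_def le(1) \<Gamma>_def orbit_eq[OF j le(2)] ..
    have lat: "h (z + e) - h z \<in> int_lattice" for z
      using int_lattice_diff[OF h[of "z + e"] h[of z]] by (simp add: re)
    have he: "h (z + e) - h z = h (0 + e) - h 0" for z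
    proof (rule continuous_int_lattice_constant[OF connected_UNIV _ lat])
      show "continuous_on UNIV (\<lambda>z. h (z + e) - h z)"
        by (intro continuous_on_diff conth continuous_on_compose2[OF conth]) (auto intro!: continuous_intros)
    qed auto
    have "h (z + e) - p (r z) = (h z - p (r z)) + (h e - h 0)"
      using he[of z] by (simp add: algebra_simps)
    then show "G (z + e) = G z + j (h e - h 0)"
      by (simp only: G_def re j.add add.assoc)
    show "h e - h 0 \<in> int_lattice" using lat[of 0] by simp
  qed
  have y1: "y (z + (1, 0)) = y z + j a" and y2: "y (z + (0, 1)) = y z + j b" for z
    by (simp_all add: y_def l_def j.add j.scaleR algebra_simps)
  note per1 = per[OF y1 a] and per2 = per[OF y2 b]
  have "B2 (j (h (1, 0) - h 0)) (j (h (0, 1) - h 0)) = B1 (j a) (j b)"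
  proof (rule period_of_constant_two_form[OF smG B2 skew _ _ DG])
    show "G (s + 1, t) = G (s, t) + j (h (1, 0) - h 0)" for s t
      using per1(1)[of "(s, t)"] by simp
    show "G (s, t + 1) = G (s, t) + j (h (0, 1) - h 0)" for s t
      using per2(1)[of "(s, t)"] by simp
  qed
  with per1(2) per2(2) show ?thesis by (rule that)
qed

section \<open>Gauge transformations and dimensions of eigenspaces\<close>

text \<open>\<open>V\<close> and \<open>W\<close> are mere sets here. The relation between the two
  maps is first extended linearly to the span of a basis of \<open>V\<close>, which makes \<Phi>
  injective there and lets it carry the basis over.\<close>

lemma dim_eq_of_mutual_inverse:
  fixes \<Phi> :: "('a \<Rightarrow> complex) \<Rightarrow> 'b \<Rightarrow> complex" and \<Psi> :: "('b \<Rightarrow> complex) \<Rightarrow> 'a \<Rightarrow> complex"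
  assumes add: "\<And>f g. \<Phi> (f + g) = \<Phi> f + \<Phi> g" and scale: "\<And>c f. \<Phi> (\<lambda>x. c * f x) = (\<lambda>x. c * \<Phi> f x)"
    and add': "\<And>f g. \<Psi> (f + g) = \<Psi> f + \<Psi> g" and scale': "\<And>c f. \<Psi> (\<lambda>x. c * f x) = (\<lambda>x. c * \<Psi> f x)"
    and \<Phi>: "\<And>f. f \<in> V \<Longrightarrow> \<Phi> f \<in> W \<and> \<Psi> (\<Phi> f) = f"
    and \<Psi>: "\<And>g. g \<in> W \<Longrightarrow> \<Psi> g \<in> V \<and> \<Phi> (\<Psi> g) = g"
  shows "vector_space.dim (\<lambda>(c::complex) f x. c * f x) V = vector_space.dim (\<lambda>(c::complex) f x. c * f x) W"
proof -
  interpret A: vector_space "\<lambda>(c::complex) (f::'a \<Rightarrow> complex) x. c * f x"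
    by (rule vector_space_complex_functions)
  interpret B: vector_space "\<lambda>(c::complex) (f::'b \<Rightarrow> complex) x. c * f x"
    by (rule vector_space_complex_functions)
  interpret L: Vector_Spaces.linear "\<lambda>(c::complex) (f::'a \<Rightarrow> complex) x. c * f x"
    "\<lambda>(c::complex) (f::'b \<Rightarrow> complex) x. c * f x" \<Phi>
    by unfold_locales (simp_all add: add scale)
  obtain S where S: "S \<subseteq> V" "A.independent S" "V \<subseteq> A.span S" "card S = A.dim V"
    using A.basis_exists .
  have inv: "\<Psi> (\<Phi> f) = f" if "f \<in> A.span S" for f
    using that
  proof (induction rule: A.span_induct_alt)
    case base
    show ?case using scale[of 0] scale'[of 0] by (simp add: zero_fun_def)
  next
    case (step c f g)
    then have "\<Psi> (\<Phi> f) = f" using \<Phi> S(1) by blast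
    with step(2) show ?case by (simp only: add scale add' scale')
  qed
  have inj: "inj_on \<Phi> (A.span S)" by (rule inj_on_inverseI[of _ \<Psi>]) (rule inv)
  have "B.dim W = card S"
  proof (rule B.dim_unique)
    show "\<Phi> ` S \<subseteq> W" using \<Phi> S(1) by blast
    show "B.independent (\<Phi> ` S)" by (rule L.independent_injective_image[OF S(2) inj])
    show "card (\<Phi> ` S) = card S"
      by (rule card_image) (rule inj_on_subset[OF inj A.span_superset])
    show "W \<subseteq> B.span (\<Phi> ` S)"
    proof
      fix g assume g: "g \<in> W"
      then have "\<Phi> (\<Psi> g) \<in> \<Phi> ` A.span S" using \<Psi> S(3) by blast
      then show "g \<in> B.span (\<Phi> ` S)" using \<Psi>[OF g] by (simp add: L.span_image)
    qed
  qed
  then show ?thesis using S(4) by simp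
qed

section \<open>Diagonal coordinate changes and the model Laplacian\<close>

definition diag_scale :: "('n::finite \<Rightarrow> real) \<Rightarrow> real^'n \<Rightarrow> real^'n" where
  "diag_scale c x = (\<chi> i. c i * x $ i)"

lemma diag_scale_nth [simp]: "diag_scale c x $ i = c i * x $ i"
  by (simp add: diag_scale_def)

lemma linear_diag_scale: "linear (diag_scale c)"
  by (rule linearI) (simp_all add: vec_eq_iff algebra_simps)

lemma bounded_linear_diag_scale: "bounded_linear (diag_scale c)"
  by (rule linear_conv_bounded_linear[THEN iffD1, OF linear_diag_scale])

lemma diag_scale_add: "diag_scale c (x + y) = diag_scale c x + diag_scale c y"
  by (simp add: vec_eq_iff algebra_simps)

lemma diag_scale_diff: "diag_scale c (x - y) = diag_scale c x - diag_scale c y"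
  by (simp add: vec_eq_iff algebra_simps)

lemma diag_scale_inverse:
  "(\<And>i. c i \<noteq> 0) \<Longrightarrow> diag_scale c (diag_scale (\<lambda>i. 1 / c i) x) = x"
  "(\<And>i. c i \<noteq> 0) \<Longrightarrow> diag_scale (\<lambda>i. 1 / c i) (diag_scale c x) = x"
  by (simp_all add: vec_eq_iff)

lemma diag_scale_axis: "diag_scale c (axis i 1) = c i *\<^sub>R axis i 1"
  by (simp add: vec_eq_iff axis_def)

definition smooth_connection :: "(real^'n::finite) one_form \<Rightarrow> bool" where
  "smooth_connection \<theta> \<longleftrightarrow> (\<forall>x. linear (\<theta> x)) \<and> (\<forall>v. smooth_on (\<lambda>x. \<theta> x v) UNIV)"

text \<open>The trace of the second covariant derivative for an inverse metric with diagonal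
  \<open>r\<close>. The sign and the factor \<open>1 / (2 * k^2)\<close> of the Hamiltonian are put
  into the eigenvalue, which becomes \<open>- 2 * of_nat k ^ 2 * \<mu>\<close>.\<close>

definition lap ::
    "('n::finite \<Rightarrow> real) \<Rightarrow> (real^'n) one_form \<Rightarrow> (real^'n \<Rightarrow> complex) \<Rightarrow> real^'n \<Rightarrow> complex" where
  "lap r \<theta> f x =
    (\<Sum>i\<in>UNIV. of_real (r i) * cov_deriv \<theta> (axis i 1) (cov_deriv \<theta> (axis i 1) f) x)"

text \<open>The choice \<open>L = {}\<close> imposes no periodicity and gives the ambient space on
  which all magnetic translations act.\<close>

definition eigen ::
    "('n::finite \<Rightarrow> real) \<Rightarrow> (real^'n) one_form \<Rightarrow> (real^'n) set \<Rightarrow> (real^'n \<Rightarrow> real^'n \<Rightarrow> complex) \<Rightarrow>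
      complex \<Rightarrow> (real^'n \<Rightarrow> complex) set" where
  "eigen r \<theta> L m \<nu> = {f. smooth_on f UNIV \<and> (\<forall>\<gamma>\<in>L. \<forall>x. f (x + \<gamma>) = m \<gamma> x * f x) \<and>
     (\<forall>x. lap r \<theta> f x = \<nu> * f x)}"

lemma smooth_on_cov_deriv:
  assumes "smooth_connection \<theta>" "smooth_on f UNIV"
  shows "smooth_on (cov_deriv \<theta> v f) UNIV"
proof -
  have "smooth_on (\<lambda>x. frechet_derivative f (at x) v + \<i> * of_real (\<theta> x v) * f x) UNIV"
    using assms unfolding smooth_connection_def
    by (intro smooth_on_add smooth_on_mult smooth_on_deriv smooth_on_const
        smooth_on_bounded_linear[OF bounded_linear_of_real]) auto
  then show ?thesis by (simp add: cov_deriv_def[abs_def])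
qed

lemma cov_deriv_linear:
  assumes "smooth_on f UNIV" "smooth_on g UNIV"
  shows "cov_deriv \<theta> v (\<lambda>x. a * f x + b * g x) = (\<lambda>x. a * cov_deriv \<theta> v f x + b * cov_deriv \<theta> v g x)"
proof
  fix x
  have "((\<lambda>x. a * f x + b * g x) has_derivative
      (\<lambda>v. a * frechet_derivative f (at x) v + b * frechet_derivative g (at x) v)) (at x)"
    by (intro has_derivative_add has_derivative_mult_right smooth_on_has_derivative[OF assms(1)]
        smooth_on_has_derivative[OF assms(2)] UNIV_I)
  from frechet_derivative_at_eq[OF this]
  show "cov_deriv \<theta> v (\<lambda>x. a * f x + b * g x) x = a * cov_deriv \<theta> v f x + b * cov_deriv \<theta> v g x"
    by (simp add: cov_deriv_def algebra_simps)
qed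

lemma cov_deriv_scaleR_direction:
  assumes "smooth_connection \<theta>" "smooth_on f UNIV"
  shows "cov_deriv \<theta> (a *\<^sub>R v) f = (\<lambda>x. of_real a * cov_deriv \<theta> v f x)"
proof
  fix x
  have "linear (frechet_derivative f (at x))"
    by (rule has_derivative_linear[OF smooth_on_has_derivative[OF assms(2) UNIV_I]])
  then have "frechet_derivative f (at x) (a *\<^sub>R v) = of_real a * frechet_derivative f (at x) v"
    unfolding scaleR_conv_of_real[of a "frechet_derivative f (at x) v", symmetric] by (rule linear_cmul)
  moreover have "\<theta> x (a *\<^sub>R v) = a * \<theta> x v"
    using assms(1) by (simp add: smooth_connection_def linear_cmul)
  ultimately show "cov_deriv \<theta> (a *\<^sub>R v) f x = of_real a * cov_deriv \<theta> v f x"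
    by (simp add: cov_deriv_def distrib_left)
qed

lemma lap_linear:
  assumes "smooth_connection \<theta>" "smooth_on f UNIV" "smooth_on g UNIV"
  shows "lap r \<theta> (\<lambda>x. a * f x + b * g x) x = a * lap r \<theta> f x + b * lap r \<theta> g x"
  by (simp add: lap_def cov_deriv_linear smooth_on_cov_deriv assms sum.distrib sum_distrib_left algebra_simps)

lemma eigen_linear:
  assumes "smooth_connection \<theta>" "f \<in> eigen r \<theta> L m \<nu>" "g \<in> eigen r \<theta> L m \<nu>"
  shows "(\<lambda>x. a * f x + b * g x) \<in> eigen r \<theta> L m \<nu>"
  using assms
  by (auto simp: eigen_def lap_linear algebra_simps intro!: smooth_on_add smooth_on_mult smooth_on_const)

text \<open>A gauge transformation combined with an affine change of coordinates.\<close>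

definition xform ::
    "(real^'n \<Rightarrow> real) \<Rightarrow> ('n::finite \<Rightarrow> real) \<Rightarrow> real^'n \<Rightarrow> (real^'n \<Rightarrow> complex) \<Rightarrow> real^'n \<Rightarrow> complex" where
  "xform \<xi> c w f y = cis (\<xi> y) * f (diag_scale c (y + w))"

lemma xform_has_derivative:
  assumes "(\<xi> has_derivative \<xi>') (at y)" "smooth_on f UNIV"
  shows "(xform \<xi> c w f has_derivative (\<lambda>v.
     cis (\<xi> y) * frechet_derivative f (at (diag_scale c (y + w))) (diag_scale c v) +
     \<i> * of_real (\<xi>' v) * xform \<xi> c w f y)) (at y)"
proof -
  have "((\<lambda>z. f (diag_scale c w + diag_scale c z)) has_derivative
      (\<lambda>v. frechet_derivative f (at (diag_scale c w + diag_scale c y)) (diag_scale c v))) (at y)"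
    by (intro has_derivative_compose_affine bounded_linear_diag_scale smooth_on_has_derivative[OF assms(2)] UNIV_I)
  from has_derivative_mult[OF has_derivative_cis_compose[OF assms(1)] this]
  show ?thesis by (simp add: xform_def[abs_def] diag_scale_add add.commute mult.assoc)
qed

lemma smooth_on_xform:
  assumes "smooth_on \<xi> UNIV" "smooth_on f UNIV"
  shows "smooth_on (xform \<xi> c w f) UNIV"
proof -
  have "smooth_on (\<lambda>y. cis (\<xi> y) * f (diag_scale c w + diag_scale c y)) UNIV"
    by (intro smooth_on_mult smooth_on_cis smooth_on_compose_affine bounded_linear_diag_scale assms)
  then show ?thesis by (simp add: xform_def[abs_def] diag_scale_add add.commute)
qed

text \<open>By the last assumption the affine map pulls \<theta> back to \<theta>' plus the
  differential of \<xi>; differentiating the phase \<open>cis (\<xi> y)\<close> supplies exactly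
  this exact part.\<close>

lemma cov_deriv_xform:
  assumes "\<And>y. (\<xi> has_derivative \<xi>' y) (at y)" "smooth_on f UNIV"
    and "\<And>y v. \<theta> (diag_scale c (y + w)) (diag_scale c v) = \<theta>' y v + \<xi>' y v"
  shows "cov_deriv \<theta>' v (xform \<xi> c w f) = xform \<xi> c w (cov_deriv \<theta> (diag_scale c v) f)"
proof
  fix y
  show "cov_deriv \<theta>' v (xform \<xi> c w f) y = xform \<xi> c w (cov_deriv \<theta> (diag_scale c v) f) y"
    unfolding cov_deriv_def frechet_derivative_at_eq[OF xform_has_derivative[OF assms(1,2)]]
      xform_def assms(3) by (simp add: algebra_simps)
qed

lemma xform_cmult: "xform \<xi> c w (\<lambda>x. a * f x) = (\<lambda>x. a * xform \<xi> c w f x)"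
  by (simp add: xform_def fun_eq_iff)

lemma xform_add: "xform \<xi> c w (f + g) = xform \<xi> c w f + xform \<xi> c w g"
  by (simp add: xform_def fun_eq_iff algebra_simps)

lemma lap_xform:
  assumes "\<And>y. (\<xi> has_derivative \<xi>' y) (at y)" "smooth_on f UNIV" "smooth_connection \<theta>"
    and "\<And>y v. \<theta> (diag_scale c (y + w)) (diag_scale c v) = \<theta>' y v + \<xi>' y v"
    and r: "\<And>i. r i = (c i)\<^sup>2 * r' i"
  shows "lap r' \<theta>' (xform \<xi> c w f) = xform \<xi> c w (lap r \<theta> f)"
proof -
  have sm: "smooth_on (cov_deriv \<theta> v f) UNIV" for v by (rule smooth_on_cov_deriv[OF assms(3,2)])
  have "cov_deriv \<theta>' (axis i 1) (cov_deriv \<theta>' (axis i 1) (xform \<xi> c w f))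
      = xform \<xi> c w (\<lambda>x. of_real ((c i)\<^sup>2) * cov_deriv \<theta> (axis i 1) (cov_deriv \<theta> (axis i 1) f) x)" for i
  proof -
    have "cov_deriv \<theta>' (axis i 1) (cov_deriv \<theta>' (axis i 1) (xform \<xi> c w f))
        = xform \<xi> c w (cov_deriv \<theta> (diag_scale c (axis i 1)) (cov_deriv \<theta> (diag_scale c (axis i 1)) f))"
      by (simp only: cov_deriv_xform[OF assms(1) assms(2) assms(4)] cov_deriv_xform[OF assms(1) sm assms(4)])
    also have "cov_deriv \<theta> (diag_scale c (axis i 1)) (cov_deriv \<theta> (diag_scale c (axis i 1)) f)
        = (\<lambda>x. of_real ((c i)\<^sup>2) * cov_deriv \<theta> (axis i 1) (cov_deriv \<theta> (axis i 1) f) x)"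
      using cov_deriv_linear[OF sm sm, of \<theta> _ "of_real (c i)" _ 0]
      by (simp add: diag_scale_axis cov_deriv_scaleR_direction assms sm power2_eq_square fun_eq_iff)
    finally show ?thesis .
  qed
  then show ?thesis
    by (simp add: fun_eq_iff lap_def xform_def r sum_distrib_left mult_ac)
qed

text \<open>The multipliers have to agree only up to the coboundary of \<xi>, which is what the
  phase contributes under a lattice shift.\<close>

lemma xform_eigen:
  assumes \<xi>: "smooth_on \<xi> UNIV" "\<And>y. (\<xi> has_derivative \<xi>' y) (at y)" and \<theta>: "smooth_connection \<theta>"
    and compat: "\<And>y v. \<theta> (diag_scale c (y + w)) (diag_scale c v) = \<theta>' y v + \<xi>' y v"
    and r: "\<And>i. r i = (c i)\<^sup>2 * r' i"
    and L: "\<And>\<gamma>. \<gamma> \<in> L' \<Longrightarrow> diag_scale c \<gamma> \<in> L"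
    and m: "\<And>\<gamma> y. \<gamma> \<in> L' \<Longrightarrow> m (diag_scale c \<gamma>) (diag_scale c (y + w)) = cis (\<xi> y - \<xi> (y + \<gamma>)) * m' \<gamma> y"
    and f: "f \<in> eigen r \<theta> L m \<nu>"
  shows "xform \<xi> c w f \<in> eigen r' \<theta>' L' m' \<nu>"
proof -
  have f': "smooth_on f UNIV" "\<And>\<gamma> x. \<gamma> \<in> L \<Longrightarrow> f (x + \<gamma>) = m \<gamma> x * f x" "\<And>x. lap r \<theta> f x = \<nu> * f x"
    using f by (auto simp: eigen_def)
  have "xform \<xi> c w f (y + \<gamma>) = m' \<gamma> y * xform \<xi> c w f y" if "\<gamma> \<in> L'" for \<gamma> y
  proof -
    have "diag_scale c (y + \<gamma> + w) = diag_scale c (y + w) + diag_scale c \<gamma>"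
      by (simp add: diag_scale_add)
    then have "xform \<xi> c w f (y + \<gamma>) = cis (\<xi> (y + \<gamma>)) * (m (diag_scale c \<gamma>) (diag_scale c (y + w))
        * f (diag_scale c (y + w)))"
      by (simp add: xform_def f'(2)[OF L[OF that]])
    also have "\<dots> = (cis (\<xi> (y + \<gamma>)) * cis (\<xi> y - \<xi> (y + \<gamma>))) * m' \<gamma> y * f (diag_scale c (y + w))"
      by (simp only: m[OF that] mult_ac)
    finally show ?thesis by (simp add: cis_mult xform_def)
  qed
  moreover have "lap r' \<theta>' (xform \<xi> c w f) x = \<nu> * xform \<xi> c w f x" for x
    unfolding lap_xform[OF \<xi>(2) f'(1) \<theta> compat r] by (simp add: xform_def f'(3))
  ultimately show ?thesis using smooth_on_xform[OF \<xi>(1) f'(1)] by (simp add: eigen_def)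
qed

lemma dim_eigen_xform:
  assumes \<xi>: "smooth_on \<xi> UNIV" "\<And>y. (\<xi> has_derivative \<xi>' y) (at y)"
    and \<theta>: "smooth_connection \<theta>" "smooth_connection \<theta>'"
    and compat: "\<And>y v. \<theta> (diag_scale c (y + w)) (diag_scale c v) = \<theta>' y v + \<xi>' y v"
    and c: "\<And>i. c i \<noteq> 0" and r: "\<And>i. r i = (c i)\<^sup>2 * r' i"
    and L: "L = diag_scale c ` L'"
    and m: "\<And>\<gamma> y. \<gamma> \<in> L' \<Longrightarrow> m (diag_scale c \<gamma>) (diag_scale c (y + w)) = cis (\<xi> y - \<xi> (y + \<gamma>)) * m' \<gamma> y"
  shows "vector_space.dim (\<lambda>(c::complex) f x. c * f x) (eigen r \<theta> L m \<nu>) =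
    vector_space.dim (\<lambda>(c::complex) f x. c * f x) (eigen r' \<theta>' L' m' \<nu>)"
proof -
  \<comment> \<open>The inverse is of the same kind: solving \<open>x = diag_scale c (y + w)\<close>
    for \<open>y\<close> gives the scaling \<open>c'\<close> after the shift \<open>w'\<close>, and
    the phase is the negative of \<xi> at the solution \<open>p x\<close>.\<close>
  define c' where "c' = (\<lambda>i. 1 / c i)"
  define w' where "w' = - diag_scale c w"
  define p where "p = (\<lambda>x. - w + diag_scale c' x)"
  define \<eta> where "\<eta> = (\<lambda>x. - \<xi> (p x))"
  have cc [simp]: "diag_scale c (diag_scale c' x) = x" "diag_scale c' (diag_scale c x) = x" for x
    unfolding c'_def using c by (simp_all add: diag_scale_inverse)
  have p: "diag_scale c' (x + w') = p x" for x
    by (simp add: p_def w'_def diag_scale_diff)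
  have cp: "diag_scale c (p x + w) = x" for x by (simp add: p_def)
  have pc: "p (diag_scale c (y + w)) = y" for y by (simp add: p_def)
  have sm\<eta>: "smooth_on \<eta> UNIV"
    unfolding \<eta>_def p_def
    by (intro smooth_on_bounded_linear[OF bounded_linear_minus[OF bounded_linear_ident]]
        smooth_on_compose_affine bounded_linear_diag_scale \<xi>)
  have d\<eta>: "(\<eta> has_derivative (\<lambda>v. - \<xi>' (p x) (diag_scale c' v))) (at x)" for x
    unfolding \<eta>_def p_def
    by (intro has_derivative_minus has_derivative_compose_affine bounded_linear_diag_scale \<xi>)
  show ?thesis
  proof (rule dim_eq_of_mutual_inverse[where \<Phi> = "xform \<xi> c w" and \<Psi> = "xform \<eta> c' w'"])
    fix f assume "f \<in> eigen r \<theta> L m \<nu>"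
    then have "xform \<xi> c w f \<in> eigen r' \<theta>' L' m' \<nu>"
      by (rule xform_eigen[OF \<xi> \<theta>(1) compat r _ m, rotated -1]) (use L in auto)
    moreover have "xform \<eta> c' w' (xform \<xi> c w f) = f"
      by (simp add: fun_eq_iff xform_def[of \<eta>] p) (simp add: xform_def cp \<eta>_def cis_mult flip: mult.assoc)
    ultimately show "xform \<xi> c w f \<in> eigen r' \<theta>' L' m' \<nu> \<and> xform \<eta> c' w' (xform \<xi> c w f) = f" ..
  next
    fix g assume g: "g \<in> eigen r' \<theta>' L' m' \<nu>"
    have "xform \<eta> c' w' g \<in> eigen r \<theta> L m \<nu>"
    proof (rule xform_eigen[OF sm\<eta> d\<eta> \<theta>(2) _ _ _ _ g])
      show "\<theta>' (diag_scale c' (x + w')) (diag_scale c' v) = \<theta> x v + - \<xi>' (p x) (diag_scale c' v)" for x v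
        using compat[of "p x" "diag_scale c' v"] by (simp add: p cp)
      show "r' i = (c' i)\<^sup>2 * r i" for i using c[of i] by (simp add: r c'_def power_divide)
      show "diag_scale c' \<gamma> \<in> L'" if "\<gamma> \<in> L" for \<gamma> using that L by auto
      fix \<gamma> x assume "\<gamma> \<in> L"
      then have \<gamma>: "diag_scale c' \<gamma> \<in> L'" using L by auto
      have "p (x + \<gamma>) = p x + diag_scale c' \<gamma>" by (simp add: p_def diag_scale_add)
      then show "m' (diag_scale c' \<gamma>) (diag_scale c' (x + w')) = cis (\<eta> x - \<eta> (x + \<gamma>)) * m \<gamma> x"
        using m[OF \<gamma>, of "p x"] by (simp add: p cp \<eta>_def cis_mult flip: mult.assoc)
    qed
    moreover have "xform \<xi> c w (xform \<eta> c' w' g) = g"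
      by (simp add: fun_eq_iff xform_def[of \<xi>])
        (simp add: xform_def p pc \<eta>_def cis_mult flip: mult.assoc)
    ultimately show "xform \<eta> c' w' g \<in> eigen r \<theta> L m \<nu> \<and> xform \<xi> c w (xform \<eta> c' w' g) = g" ..
  qed (simp_all add: xform_add xform_cmult)
qed

section \<open>Magnetic translations and transplantation\<close>

text \<open>The phase is matched to the Landau connection defined next. Invariance under
  \<open>mtrans \<beta> \<gamma>\<close> is the automorphy condition with multiplier
  \<open>cis (\<beta> \<gamma> y)\<close>.\<close>

definition mtrans ::
    "(real^'n::finite \<Rightarrow> real^'n \<Rightarrow> real) \<Rightarrow> real^'n \<Rightarrow> (real^'n \<Rightarrow> complex) \<Rightarrow> real^'n \<Rightarrow> complex" where
  "mtrans \<beta> v f y = cis (- \<beta> v y) * f (y + v)"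

definition landau :: "(real^'n::finite \<Rightarrow> real^'n \<Rightarrow> real) \<Rightarrow> (real^'n) one_form" where
  "landau \<beta> y v = - \<beta> y v"

definition landau_eigen ::
    "(real^'n::finite \<Rightarrow> real^'n \<Rightarrow> real) \<Rightarrow> (real^'n) set \<Rightarrow> complex \<Rightarrow> (real^'n \<Rightarrow> complex) set" where
  "landau_eigen \<beta> L \<nu> = eigen (\<lambda>i. 1) (landau \<beta>) L (\<lambda>\<gamma> y. cis (\<beta> \<gamma> y)) \<nu>"

lemma smooth_connection_landau: "bilinear \<beta> \<Longrightarrow> smooth_connection (landau \<beta>)"
  unfolding smooth_connection_def landau_def[abs_def]
  by (auto intro!: smooth_on_linear linear_compose_neg simp: bilinear_def)

lemma landau_eigen_iff:
  "f \<in> landau_eigen \<beta> L \<nu> \<longleftrightarrow> f \<in> landau_eigen \<beta> {} \<nu> \<and> (\<forall>\<gamma>\<in>L. mtrans \<beta> \<gamma> f = f)"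
proof -
  have "f (x + \<gamma>) = cis (\<beta> \<gamma> x) * f x \<longleftrightarrow> mtrans \<beta> \<gamma> f x = f x" for \<gamma> x
  proof -
    have "mtrans \<beta> \<gamma> f x = f x \<longleftrightarrow> cis (\<beta> \<gamma> x) * mtrans \<beta> \<gamma> f x = cis (\<beta> \<gamma> x) * f x"
      by (simp add: cis_neq_zero)
    then show ?thesis by (simp add: mtrans_def cis_mult flip: mult.assoc)
  qed
  then show ?thesis by (auto simp: landau_eigen_def eigen_def fun_eq_iff)
qed

lemma landau_eigen_linear:
  assumes "bilinear \<beta>" "f \<in> landau_eigen \<beta> L \<nu>" "g \<in> landau_eigen \<beta> L \<nu>"
  shows "(\<lambda>x. a * f x + b * g x) \<in> landau_eigen \<beta> L \<nu>"
  using eigen_linear[OF smooth_connection_landau] assms by (simp add: landau_eigen_def)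

text \<open>Shifting the base point by \<open>v\<close> changes the Landau connection by the
  constant form \<open>- \<beta> v\<close>, the differential of the phase; thus a magnetic
  translation is an \<open>xform\<close> with trivial scaling that preserves the connection.\<close>

lemma mtrans_landau_eigen:
  assumes \<beta>: "bilinear \<beta>" and f: "f \<in> landau_eigen \<beta> {} \<nu>"
  shows "mtrans \<beta> v f \<in> landau_eigen \<beta> {} \<nu>"
proof -
  have lin: "linear (\<lambda>y. - \<beta> v y)" using \<beta> by (auto intro!: linear_compose_neg simp: bilinear_def)
  have "diag_scale (\<lambda>i. 1) x = x" for x :: "real^'a" by (simp add: vec_eq_iff)
  then have "mtrans \<beta> v f = xform (\<lambda>y. - \<beta> v y) (\<lambda>i. 1) v f"
    by (simp add: fun_eq_iff mtrans_def xform_def)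
  moreover have "xform (\<lambda>y. - \<beta> v y) (\<lambda>i. 1) v f \<in> landau_eigen \<beta> {} \<nu>"
    unfolding landau_eigen_def
  proof (rule xform_eigen[OF smooth_on_linear[OF lin] _ smooth_connection_landau[OF \<beta>] _ _ _ _ f[unfolded landau_eigen_def]])
    show "((\<lambda>y. - \<beta> v y) has_derivative (\<lambda>y. - \<beta> v y)) (at y)" for y
      using lin by (simp add: bounded_linear_imp_has_derivative linear_conv_bounded_linear)
    show "landau \<beta> (diag_scale (\<lambda>i. 1) (y + v)) (diag_scale (\<lambda>i. 1) u) = landau \<beta> y u + - \<beta> v u" for y u
      using \<open>\<And>x. diag_scale (\<lambda>i. 1) x = x\<close> by (simp add: landau_def bilinear_ladd[OF \<beta>])
  qed simp_all
  ultimately show ?thesis by simp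
qed

lemma mtrans_linear: "mtrans \<beta> v (\<lambda>y. a * f y + b * g y) = (\<lambda>y. a * mtrans \<beta> v f y + b * mtrans \<beta> v g y)"
  by (simp add: mtrans_def fun_eq_iff algebra_simps)

lemma mtrans_mtrans:
  assumes "bilinear \<beta>"
  shows "mtrans \<beta> u (mtrans \<beta> v f) = (\<lambda>y. cis (- \<beta> v u) * mtrans \<beta> (u + v) f y)"
proof
  fix y
  have "mtrans \<beta> u (mtrans \<beta> v f) y = (cis (- \<beta> u y) * cis (- \<beta> v (y + u))) * f (y + u + v)"
    by (simp add: mtrans_def mult.assoc)
  also have "cis (- \<beta> u y) * cis (- \<beta> v (y + u)) = cis (- \<beta> v u) * cis (- \<beta> (u + v) y)"
    by (simp add: cis_mult bilinear_ladd[OF assms] bilinear_radd[OF assms] algebra_simps)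
  finally show "mtrans \<beta> u (mtrans \<beta> v f) y = cis (- \<beta> v u) * mtrans \<beta> (u + v) f y"
    by (simp add: mtrans_def add.assoc)
qed

text \<open>The Heisenberg relation: translations commute up to a phase that depends only on the
  alternating part of \<beta>, that is, on the symplectic form.\<close>

lemma mtrans_commute:
  assumes "bilinear \<beta>"
  shows "mtrans \<beta> u (mtrans \<beta> v f) = (\<lambda>y. cis (\<beta> u v - \<beta> v u) * mtrans \<beta> v (mtrans \<beta> u f) y)"
proof
  fix y
  have "cis (- \<beta> v u) = cis (\<beta> u v - \<beta> v u) * cis (- \<beta> u v)" by (simp add: cis_mult)
  then show "mtrans \<beta> u (mtrans \<beta> v f) y = cis (\<beta> u v - \<beta> v u) * mtrans \<beta> v (mtrans \<beta> u f) y"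
    by (simp only: mtrans_mtrans[OF assms] add.commute[of v u] mult.assoc)
qed

text \<open>The projections to the eigenspaces of the involution given by \<open>b\<close>. They are
  written as combinations \<open>a * f y + b * g y\<close> to fit the linearity lemmas; for the same
  reason \<open>transplant\<close> carries factors \<open>1\<close>.\<close>

definition even_part where
  "even_part \<beta> b f = (\<lambda>y. (1/2) * f y + (1/2) * mtrans \<beta> b f y)"

definition odd_part where
  "odd_part \<beta> b f = (\<lambda>y. (1/2) * f y + (-1/2) * mtrans \<beta> b f y)"

text \<open>A magnetic translation by \<open>s\<close> interchanges the two eigenspaces \<open>\<plusminus>1\<close> of \<open>mtrans \<beta> b\<close>, so moving
  only the odd part makes a function invariant under \<open>b\<close>.\<close>

definition transplant ::
    "(real^'n::finite \<Rightarrow> real^'n \<Rightarrow> real) \<Rightarrow> real^'n \<Rightarrow> real^'n \<Rightarrow> (real^'n \<Rightarrow> complex) \<Rightarrow> real^'n \<Rightarrow> complex" where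
  "transplant \<beta> b s f = (\<lambda>y. 1 * even_part \<beta> b f y + 1 * mtrans \<beta> s (odd_part \<beta> b f) y)"

text \<open>The first line makes \<open>mtrans \<beta> b\<close> an involution on functions
  invariant under \<open>L\<close>, and \<open>mtrans \<beta> (- s)\<close> an inverse of
  \<open>mtrans \<beta> s\<close>. The second says that \<open>a\<close> and \<open>b\<close>
  commute while \<open>s\<close> anticommutes with both. The rest says that \<open>L'\<close>
  consists of elements of \<open>L\<close> commuting with \<open>b\<close> and \<open>s\<close>, up
  to adding \<open>b\<close>.\<close>

definition transplantable ::
    "(real^'n::finite \<Rightarrow> real^'n \<Rightarrow> real) \<Rightarrow> real^'n \<Rightarrow> real^'n \<Rightarrow> real^'n \<Rightarrow> (real^'n) set \<Rightarrow> (real^'n) set \<Rightarrow> bool"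
  where
  "transplantable \<beta> a b s L L' \<longleftrightarrow>
     a \<in> L \<and> b + b \<in> L \<and> cis (\<beta> b b) = 1 \<and> cis (\<beta> s s) = 1 \<and>
     cis (\<beta> a b - \<beta> b a) = 1 \<and> cis (\<beta> a s - \<beta> s a) = -1 \<and> cis (\<beta> b s - \<beta> s b) = -1 \<and>
     (\<forall>\<gamma>\<in>L'. \<exists>\<gamma>0\<in>L. cis (\<beta> \<gamma>0 b - \<beta> b \<gamma>0) = 1 \<and> cis (\<beta> \<gamma>0 s - \<beta> s \<gamma>0) = 1 \<and>
        (\<gamma> = \<gamma>0 \<or> \<gamma> = \<gamma>0 + b \<and> cis (\<beta> b \<gamma>0) = 1))"

text \<open>Under \<open>b\<close> two signs cancel: one from the odd part, one from moving
  \<open>b\<close> past \<open>s\<close>. An element \<gamma>0 commutes with \<open>b\<close> and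
  \<open>s\<close>, so it fixes both parts and the moved one.\<close>

lemma transplant_invariant:
  assumes \<beta>: "bilinear \<beta>" and t: "transplantable \<beta> a b s L L'" and f: "\<And>\<gamma>. \<gamma> \<in> L \<Longrightarrow> mtrans \<beta> \<gamma> f = f"
    and \<gamma>: "\<gamma> \<in> L'"
  shows "mtrans \<beta> \<gamma> (transplant \<beta> b s f) = transplant \<beta> b s f"
proof -
  note t' = t[unfolded transplantable_def]
  have "cis (- \<beta> b b) = 1" using t' cis_cnj[of "\<beta> b b"] by simp
  then have bb: "mtrans \<beta> b (mtrans \<beta> b f) = f"
    using t' f[of "b + b"] by (simp add: mtrans_mtrans[OF \<beta>])
  have b_even: "mtrans \<beta> b (even_part \<beta> b f) = even_part \<beta> b f"
    unfolding even_part_def mtrans_linear bb by (simp add: fun_eq_iff)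
  have b_odd: "mtrans \<beta> b (odd_part \<beta> b f) = (\<lambda>y. - odd_part \<beta> b f y)"
    unfolding odd_part_def mtrans_linear bb by (simp add: fun_eq_iff)
  have b_inv: "mtrans \<beta> b (transplant \<beta> b s f) = transplant \<beta> b s f"
    unfolding transplant_def mtrans_linear b_even mtrans_commute[OF \<beta>, of b s] b_odd
    using t' by (simp add: fun_eq_iff mtrans_def)
  from t' \<gamma> obtain \<gamma>0 where \<gamma>0: "\<gamma>0 \<in> L" "cis (\<beta> \<gamma>0 b - \<beta> b \<gamma>0) = 1" "cis (\<beta> \<gamma>0 s - \<beta> s \<gamma>0) = 1"
    "\<gamma> = \<gamma>0 \<or> \<gamma> = \<gamma>0 + b \<and> cis (\<beta> b \<gamma>0) = 1" by blast
  have \<gamma>0b: "mtrans \<beta> \<gamma>0 (mtrans \<beta> b f) = mtrans \<beta> b f"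
    unfolding mtrans_commute[OF \<beta>, of \<gamma>0 b] by (simp add: \<gamma>0 f)
  have "mtrans \<beta> \<gamma>0 (even_part \<beta> b f) = even_part \<beta> b f" "mtrans \<beta> \<gamma>0 (odd_part \<beta> b f) = odd_part \<beta> b f"
    unfolding even_part_def odd_part_def mtrans_linear \<gamma>0b f[OF \<gamma>0(1)] by simp_all
  then have \<gamma>0_inv: "mtrans \<beta> \<gamma>0 (transplant \<beta> b s f) = transplant \<beta> b s f"
    unfolding transplant_def mtrans_linear mtrans_commute[OF \<beta>, of \<gamma>0 s] by (simp add: \<gamma>0)
  from \<gamma>0(4) show ?thesis
  proof
    assume "\<gamma> = \<gamma>0 + b \<and> cis (\<beta> b \<gamma>0) = 1"
    moreover from this have "cis (- \<beta> b \<gamma>0) = 1" using cis_cnj[of "\<beta> b \<gamma>0"] by simp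
    ultimately show ?thesis using mtrans_mtrans[OF \<beta>, of \<gamma>0 b "transplant \<beta> b s f"]
      by (simp add: b_inv \<gamma>0_inv)
  qed (simp add: \<gamma>0_inv)
qed

text \<open>As \<open>f\<close> is invariant under \<open>a\<close>, so are its two parts; since
  \<open>s\<close> anticommutes with \<open>a\<close>, the moved part becomes odd for
  \<open>a\<close>. Hence splitting the transplant along \<open>a\<close> returns its two summands,
  and \<open>- s\<close> moves the odd one back.\<close>

lemma transplant_inverse:
  assumes \<beta>: "bilinear \<beta>" and t: "transplantable \<beta> a b s L L'" and f: "\<And>\<gamma>. \<gamma> \<in> L \<Longrightarrow> mtrans \<beta> \<gamma> f = f"
  shows "transplant \<beta> a (- s) (transplant \<beta> b s f) = f"
proof -
  note t' = t[unfolded transplantable_def]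
  have fa: "mtrans \<beta> a f = f" using t' f by blast
  have ab: "mtrans \<beta> a (mtrans \<beta> b f) = mtrans \<beta> b f"
    unfolding mtrans_commute[OF \<beta>, of a b] fa using t' by simp
  have a_even: "mtrans \<beta> a (even_part \<beta> b f) = even_part \<beta> b f"
    and a_odd: "mtrans \<beta> a (odd_part \<beta> b f) = odd_part \<beta> b f"
    unfolding even_part_def odd_part_def mtrans_linear ab fa by simp_all
  have as: "mtrans \<beta> a (mtrans \<beta> s (odd_part \<beta> b f)) = (\<lambda>y. - mtrans \<beta> s (odd_part \<beta> b f) y)"
    unfolding mtrans_commute[OF \<beta>, of a s] a_odd using t' by simp
  have "even_part \<beta> a (transplant \<beta> b s f) = even_part \<beta> b f"
    "odd_part \<beta> a (transplant \<beta> b s f) = mtrans \<beta> s (odd_part \<beta> b f)"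
    unfolding even_part_def[of _ a] odd_part_def[of _ a] transplant_def mtrans_linear a_even as
    by (simp_all add: fun_eq_iff algebra_simps)
  moreover have "mtrans \<beta> (- s) (mtrans \<beta> s (odd_part \<beta> b f)) = odd_part \<beta> b f"
    unfolding mtrans_mtrans[OF \<beta>] using t'
    by (simp add: mtrans_def bilinear_rneg[OF \<beta>] bilinear_lzero[OF \<beta>])
  ultimately show ?thesis
    by (simp add: transplant_def[of \<beta> a] fun_eq_iff) (simp add: even_part_def odd_part_def)
qed

lemma transplant_landau_eigen:
  assumes \<beta>: "bilinear \<beta>" and t: "transplantable \<beta> a b s L L'" and f: "f \<in> landau_eigen \<beta> L \<nu>"
  shows "transplant \<beta> b s f \<in> landau_eigen \<beta> L' \<nu> \<and> transplant \<beta> a (- s) (transplant \<beta> b s f) = f"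
proof -
  have f': "f \<in> landau_eigen \<beta> {} \<nu>" "\<And>\<gamma>. \<gamma> \<in> L \<Longrightarrow> mtrans \<beta> \<gamma> f = f"
    using f landau_eigen_iff[of f \<beta> L] by auto
  have "transplant \<beta> b s f \<in> landau_eigen \<beta> {} \<nu>"
    unfolding transplant_def even_part_def odd_part_def
    by (intro landau_eigen_linear[OF \<beta>] mtrans_landau_eigen[OF \<beta>] f')
  then show ?thesis
    using transplant_invariant[OF \<beta> t f'(2)] transplant_inverse[OF \<beta> t f'(2)] landau_eigen_iff by blast
qed

lemma transplant_add: "transplant \<beta> b s (f + g) = transplant \<beta> b s f + transplant \<beta> b s g"
  by (simp add: transplant_def even_part_def odd_part_def mtrans_def fun_eq_iff algebra_simps
      add_divide_distrib diff_divide_distrib)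

lemma transplant_cmult: "transplant \<beta> b s (\<lambda>x. c * f x) = (\<lambda>x. c * transplant \<beta> b s f x)"
  by (simp add: transplant_def even_part_def odd_part_def mtrans_def fun_eq_iff algebra_simps
      add_divide_distrib diff_divide_distrib)

lemma dim_landau_eigen_transplant:
  assumes \<beta>: "bilinear \<beta>" and t: "transplantable \<beta> a b s L L'" and t': "transplantable \<beta> b a (- s) L' L"
  shows "vector_space.dim (\<lambda>(c::complex) f x. c * f x) (landau_eigen \<beta> L \<nu>) =
    vector_space.dim (\<lambda>(c::complex) f x. c * f x) (landau_eigen \<beta> L' \<nu>)"
  by (rule dim_eq_of_mutual_inverse[where \<Phi> = "transplant \<beta> b s" and \<Psi> = "transplant \<beta> a (- s)"])
    (use transplant_landau_eigen[OF \<beta> t] transplant_landau_eigen[OF \<beta> t'] in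
      \<open>auto simp: transplant_add transplant_cmult\<close>)

section \<open>Characters of the integer lattice\<close>

lemma character_int_lattice:
  fixes \<kappa> :: "real^'n::finite \<Rightarrow> complex"
  assumes norm: "\<And>\<gamma>. \<gamma> \<in> int_lattice \<Longrightarrow> norm (\<kappa> \<gamma>) = 1"
    and mult: "\<And>\<gamma> \<delta>. \<gamma> \<in> int_lattice \<Longrightarrow> \<delta> \<in> int_lattice \<Longrightarrow> \<kappa> (\<gamma> + \<delta>) = \<kappa> \<gamma> * \<kappa> \<delta>"
  obtains t where "\<And>\<gamma>. \<gamma> \<in> int_lattice \<Longrightarrow> \<kappa> \<gamma> = cis (t \<bullet> \<gamma>)"
proof -
  define t where "t = (\<chi> i. Arg (\<kappa> (axis i 1)))"
  \<comment> \<open>The quotient by the candidate character, a homomorphism on the lattice that is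
    trivial on the unit vectors and hence everywhere.\<close>
  define \<rho> where "\<rho> = (\<lambda>\<gamma>. \<kappa> \<gamma> * cis (- (t \<bullet> \<gamma>)))"
  have \<rho>_mult: "\<rho> (\<gamma> + \<delta>) = \<rho> \<gamma> * \<rho> \<delta>" if "\<gamma> \<in> int_lattice" "\<delta> \<in> int_lattice" for \<gamma> \<delta>
  proof -
    have "cis (- (t \<bullet> (\<gamma> + \<delta>))) = cis (- (t \<bullet> \<gamma>)) * cis (- (t \<bullet> \<delta>))"
      by (simp add: cis_mult inner_add_right)
    then show ?thesis using that by (simp add: \<rho>_def mult)
  qed
  have "\<rho> 0 * \<rho> 0 = \<rho> 0" using \<rho>_mult[of 0 0] by (simp add: int_lattice_0)
  moreover have "\<rho> 0 \<noteq> 0" using norm[OF int_lattice_0] by (auto simp: \<rho>_def)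
  ultimately have \<rho>0: "\<rho> 0 = 1" by simp
  have \<rho>_axis: "\<rho> (axis i 1) = 1" for i
  proof -
    have "\<kappa> (axis i 1) = cis (Arg (\<kappa> (axis i 1)))"
      using rcis_cmod_Arg[of "\<kappa> (axis i 1)"] norm[OF int_lattice_axis] by (simp add: rcis_def)
    then have "\<kappa> (axis i 1) * cis (- Arg (\<kappa> (axis i 1))) = 1"
      by (metis add.right_inverse cis_mult cis_zero)
    then show ?thesis by (simp add: \<rho>_def t_def inner_axis)
  qed
  have nat: "\<rho> (of_nat n *\<^sub>R axis i 1) = 1" for n i
  proof (induction n)
    case (Suc n)
    have "of_nat n *\<^sub>R axis i 1 \<in> int_lattice" by (simp add: int_lattice_def axis_def)
    then show ?case
      using Suc \<rho>_mult[OF int_lattice_axis, of "of_nat n *\<^sub>R axis i 1" i] by (simp add: \<rho>_axis scaleR_left_distrib)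
  qed (simp add: \<rho>0)
  have int: "\<rho> (of_int n *\<^sub>R axis i 1) = 1" for n i
  proof (cases n)
    case (neg m)
    have l: "of_nat (Suc m) *\<^sub>R axis i 1 \<in> int_lattice" by (simp add: int_lattice_def axis_def)
    have "\<rho> (- (of_nat (Suc m) *\<^sub>R axis i 1)) * \<rho> (of_nat (Suc m) *\<^sub>R axis i 1) = 1"
      using \<rho>_mult[OF int_lattice_minus[OF l] l] by (simp add: \<rho>0)
    then show ?thesis by (simp only: nat neg of_int_minus of_int_of_nat_eq scaleR_minus_left mult_1_right)
  qed (use nat in simp)
  have sum: "\<rho> (\<Sum>i\<in>S. \<gamma> $ i *\<^sub>R axis i 1) = 1 \<and> (\<Sum>i\<in>S. \<gamma> $ i *\<^sub>R axis i 1) \<in> int_lattice"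
    if \<gamma>: "\<gamma> \<in> int_lattice" "finite S" for \<gamma> and S :: "'n set"
    using \<gamma>(2)
  proof (induction S)
    case (insert i S)
    obtain n where n: "\<gamma> $ i = of_int n" using \<gamma>(1) by (auto simp: int_lattice_def elim: Ints_cases)
    have "\<gamma> $ i *\<^sub>R axis i 1 \<in> int_lattice" by (simp add: n int_lattice_def axis_def)
    with insert show ?case by (simp add: \<rho>_mult int_lattice_add) (simp add: n int)
  qed (simp add: \<rho>0 int_lattice_0)
  show ?thesis
  proof (rule that[of t])
    fix \<gamma> :: "real^'n" assume "\<gamma> \<in> int_lattice"
    from sum[OF this, of UNIV] have "\<rho> \<gamma> = 1"
      using basis_expansion[of \<gamma>] by (simp add: scalar_mult_eq_scaleR)
    then have "\<kappa> \<gamma> * (cis (- (t \<bullet> \<gamma>)) * cis (t \<bullet> \<gamma>)) = cis (t \<bullet> \<gamma>)"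
      unfolding \<rho>_def by (simp flip: mult.assoc)
    then show "\<kappa> \<gamma> = cis (t \<bullet> \<gamma>)" by (simp add: cis_mult)
  qed
qed

section \<open>Reduction of a prequantum bundle to the Landau gauge\<close>

lemma matrix_inv_eqI:
  fixes A B :: "'a::semiring_1^'n::finite^'n"
  assumes "A ** B = mat 1" "B ** A = mat 1"
  shows "matrix_inv A = B"
proof -
  have "A ** matrix_inv A = mat 1 \<and> matrix_inv A ** A = mat 1"
    unfolding matrix_inv_def by (rule someI[of _ B]) (simp add: assms)
  then have "matrix_inv A = matrix_inv A ** (A ** B)" by (simp add: assms)
  also have "\<dots> = B" using \<open>_ \<and> _\<close> by (simp add: matrix_mul_assoc)
  finally show ?thesis .
qed

text \<open>The pullback of the Euclidean metric along \<open>diag_scale d\<close>;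
  \<open>pulled_form\<close> is likewise the pullback of the alternation of \<beta>. The torus
  thereby becomes the quotient of a fixed flat symplectic space by the image lattice, and only the
  lattice varies.\<close>

definition pulled_metric :: "('n::finite \<Rightarrow> real) \<Rightarrow> (real^'n) bilin_field" where
  "pulled_metric d x u v = diag_scale d u \<bullet> diag_scale d v"

definition pulled_form ::
    "(real^'n::finite \<Rightarrow> real^'n \<Rightarrow> real) \<Rightarrow> ('n \<Rightarrow> real) \<Rightarrow> (real^'n) bilin_field" where
  "pulled_form \<beta> d x u v = \<beta> (diag_scale d u) (diag_scale d v) - \<beta> (diag_scale d v) (diag_scale d u)"

lemma inverse_gram_pulled_metric:
  assumes "\<And>i. d i \<noteq> 0"
  shows "matrix_inv (gram_matrix (pulled_metric d) x) = (\<chi> i j. if i = j then (1 / d i)\<^sup>2 else 0)"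
proof (rule matrix_inv_eqI)
  have gram: "gram_matrix (pulled_metric d) x = (\<chi> i j. if i = j then (d i)\<^sup>2 else 0)"
    by (simp add: vec_eq_iff gram_matrix_def pulled_metric_def diag_scale_axis inner_axis_axis power2_eq_square)
  have [simp]: "(if c then a else 0) * z = (if c then a * z else 0)" for c and a z :: real by simp
  show "gram_matrix (pulled_metric d) x ** (\<chi> i j. if i = j then (1 / d i)\<^sup>2 else 0) = mat 1"
    "(\<chi> i j. if i = j then (1 / d i)\<^sup>2 else 0) ** gram_matrix (pulled_metric d) x = mat 1"
    using assms unfolding gram
    by (auto simp: vec_eq_iff matrix_matrix_mult_def mat_def power_divide)
qed

lemma eigensections_eq_eigen:
  assumes d: "\<And>i. d i \<noteq> 0" and k: "k \<ge> 1"
  shows "eigensections (pulled_metric d) e \<theta> k \<mu> =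
    eigen (\<lambda>i. (1 / d i)\<^sup>2) (power_connection k \<theta>) int_lattice (power_bundle k e) (- 2 * of_nat k ^ 2 * \<mu>)"
proof -
  have [simp]: "of_real (if c then a else 0) * z = (if c then of_real a * z else 0)" for c a and z :: complex
    by simp
  have bl: "bundle_laplacian (pulled_metric d) \<theta>' f x = - lap (\<lambda>i. (1 / d i)\<^sup>2) \<theta>' f x" for \<theta>' f x
    by (simp add: bundle_laplacian_def inverse_gram_pulled_metric[OF d] lap_def)
  have qh: "quantum_hamiltonian (pulled_metric d) \<theta> k f x = \<mu> * f x \<longleftrightarrow>
      lap (\<lambda>i. (1 / d i)\<^sup>2) (power_connection k \<theta>) f x = - 2 * of_nat k ^ 2 * \<mu> * f x" for f x
  proof -
    have K: "complex_of_nat k \<noteq> 0" using k by simp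
    have "of_real ((1 / real k)\<^sup>2 / 2) * - l = z \<longleftrightarrow> l = - 2 * of_nat k ^ 2 * z" for l z :: complex
    proof -
      have "of_real ((1 / real k)\<^sup>2 / 2) * - l = z \<longleftrightarrow> - l = 2 * of_nat k ^ 2 * z"
        using K by (auto simp: field_simps)
      also have "\<dots> \<longleftrightarrow> l = - (2 * of_nat k ^ 2 * z)" by (auto simp: minus_equation_iff[of l])
      finally show ?thesis by simp
    qed
    then show ?thesis unfolding quantum_hamiltonian_def bl by (simp only: mult.assoc)
  qed
  show ?thesis by (simp add: eigensections_def eigen_def smooth_sections_def qh)
qed

text \<open>A nondegenerate form identifies vectors with functionals, since an injective
  endomorphism is surjective. It provides the translation that cancels a given character.\<close>

lemma alternating_form_representation:
  fixes \<beta> :: "real^'n::finite \<Rightarrow> real^'n \<Rightarrow> real"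
  assumes \<beta>: "bilinear \<beta>" and nondeg: "\<And>w. (\<And>u. \<beta> u w - \<beta> w u = 0) \<Longrightarrow> w = 0"
  obtains w where "\<And>u. \<beta> u w - \<beta> w u = u \<bullet> s"
proof -
  define A where "A = (\<lambda>w. \<chi> i. \<beta> (axis i 1) w - \<beta> w (axis i 1))"
  have lin: "linear (\<lambda>u. \<beta> u w - \<beta> w u)" "linear (\<lambda>w. \<beta> u w - \<beta> w u)" for u w
    using \<beta> by (auto intro!: linear_compose_sub simp: bilinear_def)
  have A: "\<beta> u w - \<beta> w u = u \<bullet> A w" for u w
  proof -
    have "u = (\<Sum>i\<in>UNIV. (u $ i) *\<^sub>R axis i 1)" using basis_expansion[of u] by (simp add: scalar_mult_eq_scaleR)
    then have "\<beta> u w - \<beta> w u = (\<lambda>u. \<beta> u w - \<beta> w u) (\<Sum>i\<in>UNIV. (u $ i) *\<^sub>R axis i 1)" by simp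
    also have "\<dots> = u \<bullet> A w"
      by (simp only: linear_sum[OF lin(1)] linear_cmul[OF lin(1)]) (simp add: inner_vec_def A_def)
    finally show ?thesis .
  qed
  have "linear A"
    by (rule linearI) (simp_all add: A_def vec_eq_iff linear_add[OF lin(2)] linear_cmul[OF lin(2), simplified])
  moreover have "inj A"
  proof (rule linear_injective_0[THEN iffD2, OF \<open>linear A\<close>], intro allI impI)
    fix w assume "A w = 0"
    then show "w = 0" using nondeg[of w] A by simp
  qed
  ultimately have "surj A" by (rule linear_injective_imp_surjective) simp
  then obtain w where "A w = s" by (metis surjD)
  then show ?thesis using that[of w] A by simp
qed

text \<open>Equal curvature makes the given connection differ from the Landau one by an exact form.
  The multipliers then differ by a coboundary and a character, and a translation removes the
  character. The right-hand side is free of \<open>e\<close> and \<theta>, so independence of the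
  bundle and connection is included.\<close>

lemma spectrum_mult_eq_landau:
  fixes \<beta>0 :: "real^'n::finite \<Rightarrow> real^'n \<Rightarrow> real"
  assumes \<beta>0: "bilinear \<beta>0" and nondeg: "\<And>w. (\<And>u. \<beta>0 u w - \<beta>0 w u = 0) \<Longrightarrow> w = 0"
    and d: "\<And>i. d i \<noteq> 0"
    and int: "\<And>\<gamma> \<delta>. \<gamma> \<in> int_lattice \<Longrightarrow> \<delta> \<in> int_lattice \<Longrightarrow> \<beta>0 (diag_scale d \<gamma>) (diag_scale d \<delta>) \<in> \<int>"
    and pq: "prequantum_bundle (pulled_form \<beta>0 d) e \<theta>" and k: "k \<ge> 1"
  shows "spectrum_mult (pulled_metric d) e \<theta> k \<mu> =
    vector_space.dim (\<lambda>(c::complex) f x. c * f x)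
      (landau_eigen (\<lambda>u v. 2 * pi * real k * \<beta>0 u v) (diag_scale d ` int_lattice) (- 2 * of_nat k ^ 2 * \<mu>))"
proof -
  define \<beta> where "\<beta> = (\<lambda>u v. 2 * pi * real k * \<beta>0 u v)"
  define D where "D = diag_scale d"
  define D' where "D' = diag_scale (\<lambda>i. 1 / d i)"
  define \<Theta> where "\<Theta> = power_connection k \<theta>"
  have DD [simp]: "D (D' x) = x" "D' (D x) = x" for x
    unfolding D_def D'_def using d by (simp_all add: diag_scale_inverse)
  have linD: "linear D" and bD': "bounded_linear D'"
    by (simp_all add: D_def D'_def linear_diag_scale bounded_linear_diag_scale)
  have D_add: "D (x + y) = D x + D y" for x y by (simp add: D_def diag_scale_add)
  have \<beta>: "bilinear \<beta>"
  proof -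
    have "linear (\<lambda>v. 2 * pi * real k * g v)" if "linear g" for g :: "real^'n \<Rightarrow> real"
      using linear_compose_scale_right[OF that, of "2 * pi * real k"] by simp
    then show ?thesis using \<beta>0 by (simp add: bilinear_def \<beta>_def)
  qed
  note \<beta>_add = bilinear_ladd[OF \<beta>] bilinear_radd[OF \<beta>]
  have lin: "linear (\<lambda>v. \<beta> (D x) (D v))" "linear (\<lambda>v. \<beta> (D v) (D x))" "linear (\<beta> x)" for x
    using \<beta> linear_compose[OF linD, of "\<beta> (D x)"] linear_compose[OF linD, of "\<lambda>v. \<beta> v (D x)"]
    by (simp_all add: bilinear_def o_def)
  have hlb: "\<And>\<gamma>. \<gamma> \<in> int_lattice \<Longrightarrow> smooth_on (e \<gamma>) UNIV" "\<And>\<gamma> x. \<gamma> \<in> int_lattice \<Longrightarrow> norm (e \<gamma> x) = 1"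
    "\<And>\<gamma> \<delta> x. \<gamma> \<in> int_lattice \<Longrightarrow> \<delta> \<in> int_lattice \<Longrightarrow> e (\<gamma> + \<delta>) x = e \<gamma> (x + \<delta>) * e \<delta> x"
    using pq by (auto simp: prequantum_bundle_def hermitian_line_bundle_def)
  have hc: "smooth_connection \<theta>" "\<And>\<gamma> x v. \<gamma> \<in> int_lattice \<Longrightarrow>
      frechet_derivative (e \<gamma>) (at x) v + \<i> * of_real (\<theta> (x + \<gamma>) v) * e \<gamma> x = e \<gamma> x * (\<i> * of_real (\<theta> x v))"
    using pq by (auto simp: prequantum_bundle_def hermitian_connection_def smooth_connection_def)
  have curv: "ext_d1 \<theta> x u v = - 2 * pi * (\<beta>0 (D u) (D v) - \<beta>0 (D v) (D u))" for x u v
  proof -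
    have "\<i> * of_real (ext_d1 \<theta> x u v) = \<i> * complex_of_real (- 2 * pi * (\<beta>0 (D u) (D v) - \<beta>0 (D v) (D u)))"
      using pq by (simp add: prequantum_bundle_def curvature_def pulled_form_def D_def mult_ac)
    then show ?thesis by (simp only: mult_cancel_left complex_i_not_zero simp_thms of_real_eq_iff)
  qed
  have \<Theta>: "smooth_connection \<Theta>"
    using hc(1) linear_compose_scale_right[of "\<theta> _" "real k"]
    by (auto simp: smooth_connection_def \<Theta>_def power_connection_def[abs_def]
        intro!: smooth_on_mult smooth_on_const)
  \<comment> \<open>The difference between the connection on the power and the pulled-back Landau
    connection; the minus sign in \<open>landau\<close> turns it into a sum.\<close>
  define \<alpha> where "\<alpha> = (\<lambda>x v. \<Theta> x v + \<beta> (D x) (D v))"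
  have sm\<alpha>: "smooth_on (\<lambda>x. \<alpha> x v) UNIV" for v
    unfolding \<alpha>_def
    by (rule smooth_on_add[OF _ smooth_on_linear[OF lin(2)]]) (use \<Theta> in \<open>simp add: smooth_connection_def\<close>)
  obtain \<psi> where d\<psi>: "\<And>x. (\<psi> has_derivative \<alpha> x) (at x)"
  proof (rule closed_one_form_exact[of \<alpha>])
    show "linear (\<alpha> x)" for x
      unfolding \<alpha>_def using \<Theta> by (intro linear_compose_add lin) (simp add: smooth_connection_def)
    show "smooth_on (\<lambda>x. \<alpha> x v) UNIV" for v by (rule sm\<alpha>)
    fix x u v
    have "frechet_derivative (\<lambda>y. \<alpha> y v) (at x) u = real k * frechet_derivative (\<lambda>y. \<theta> y v) (at x) u + \<beta> (D u) (D v)"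
      for u v
    proof -
      have "((\<lambda>y. \<theta> y v) has_derivative frechet_derivative (\<lambda>y. \<theta> y v) (at x)) (at x)"
        by (rule smooth_on_has_derivative[where S = UNIV]) (use hc(1) in \<open>simp_all add: smooth_connection_def\<close>)
      moreover have "((\<lambda>y. \<beta> (D y) (D v)) has_derivative (\<lambda>u. \<beta> (D u) (D v))) (at x)"
        using lin by (simp add: bounded_linear_imp_has_derivative linear_conv_bounded_linear)
      ultimately have "((\<lambda>y. real k * \<theta> y v + \<beta> (D y) (D v)) has_derivative
          (\<lambda>u. real k * frechet_derivative (\<lambda>y. \<theta> y v) (at x) u + \<beta> (D u) (D v))) (at x)"
        by (intro has_derivative_add has_derivative_mult_right)
      from frechet_derivative_at_eq[OF this] show ?thesis
        by (simp add: \<alpha>_def \<Theta>_def power_connection_def)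
    qed
    then have "ext_d1 \<alpha> x u v = real k * ext_d1 \<theta> x u v + (\<beta> (D u) (D v) - \<beta> (D v) (D u))"
      by (simp add: ext_d1_def algebra_simps)
    then show "ext_d1 \<alpha> x u v = 0" by (simp add: curv \<beta>_def algebra_simps)
  qed blast
  have sm\<psi>: "smooth_on \<psi> UNIV"
    by (rule smooth_onI_derivative[OF d\<psi> sm\<alpha>])
  \<comment> \<open>The multiplier compared with the Landau one after the gauge change by \<psi>.
    The compatibility of \<theta> with \<open>e\<close> forces its derivative to vanish.\<close>
  define E where "E = (\<lambda>\<gamma> x. e \<gamma> x ^ k * cis (\<psi> (x + \<gamma>) - \<psi> x - \<beta> (D \<gamma>) (D x)))"
  have E_const: "E \<gamma> x = E \<gamma> 0" if \<gamma>: "\<gamma> \<in> int_lattice" for \<gamma> x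
  proof -
    have "(E \<gamma> has_derivative (\<lambda>v. 0)) (at x)" for x
    proof -
      have de: "frechet_derivative (e \<gamma>) (at x) v = \<i> * of_real (\<theta> x v - \<theta> (x + \<gamma>) v) * e \<gamma> x" for v
        using hc(2)[OF \<gamma>, of x v] by (simp add: algebra_simps)
      have "((\<lambda>x. \<psi> (\<gamma> + x)) has_derivative \<alpha> (\<gamma> + x)) (at x)"
        using has_derivative_compose_affine[OF bounded_linear_ident d\<psi>] .
      then have "((\<lambda>x. \<psi> (x + \<gamma>) - \<psi> x - \<beta> (D \<gamma>) (D x)) has_derivative
          (\<lambda>v. \<alpha> (x + \<gamma>) v - \<alpha> x v - \<beta> (D \<gamma>) (D v))) (at x)"
        using lin(1)[of \<gamma>] d\<psi>
        by (intro has_derivative_diff) (simp_all add: add.commute bounded_linear_imp_has_derivative linear_conv_bounded_linear)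
      moreover have "(e \<gamma> has_derivative frechet_derivative (e \<gamma>) (at x)) (at x)"
        by (rule smooth_on_has_derivative[OF hlb(1)[OF \<gamma>] UNIV_I])
      ultimately have dE: "(E \<gamma> has_derivative (\<lambda>v.
          e \<gamma> x ^ k * (\<i> * of_real (\<alpha> (x + \<gamma>) v - \<alpha> x v - \<beta> (D \<gamma>) (D v)) *
            cis (\<psi> (x + \<gamma>) - \<psi> x - \<beta> (D \<gamma>) (D x))) +
          of_nat k * frechet_derivative (e \<gamma>) (at x) v * e \<gamma> x ^ (k - 1) *
            cis (\<psi> (x + \<gamma>) - \<psi> x - \<beta> (D \<gamma>) (D x)))) (at x)"
        unfolding E_def by (intro has_derivative_mult has_derivative_power has_derivative_cis_compose)
      have h: "of_nat k * (\<i> * of_real (\<theta> x v - \<theta> (x + \<gamma>) v) * e \<gamma> x) * e \<gamma> x ^ (k - 1)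
          = - (e \<gamma> x ^ k * (\<i> * of_real (\<alpha> (x + \<gamma>) v - \<alpha> x v - \<beta> (D \<gamma>) (D v))))" for v
      proof -
        have h1: "\<alpha> (x + \<gamma>) v - \<alpha> x v - \<beta> (D \<gamma>) (D v) = real k * (\<theta> (x + \<gamma>) v - \<theta> x v)"
          by (simp add: \<alpha>_def \<Theta>_def power_connection_def D_add \<beta>_add algebra_simps)
        have h2: "e \<gamma> x ^ k = e \<gamma> x * e \<gamma> x ^ (k - 1)" using k by (simp add: power_eq_if)
        show ?thesis unfolding h1 h2 by (simp add: algebra_simps)
      qed
      show ?thesis using dE unfolding de h by (simp add: mult.assoc)
    qed
    then obtain c where "\<And>x. E \<gamma> x = c"
      using has_derivative_zero_constant[OF convex_UNIV, of "E \<gamma>"] by auto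
    then show ?thesis by simp
  qed
  define \<kappa> where "\<kappa> = (\<lambda>\<gamma>. E \<gamma> 0)"
  have e: "e \<gamma> x ^ k = \<kappa> \<gamma> * cis (\<psi> x - \<psi> (x + \<gamma>) + \<beta> (D \<gamma>) (D x))" if "\<gamma> \<in> int_lattice" for \<gamma> x
  proof -
    have "\<kappa> \<gamma> * cis (\<psi> x - \<psi> (x + \<gamma>) + \<beta> (D \<gamma>) (D x)) = e \<gamma> x ^ k *
        (cis (\<psi> (x + \<gamma>) - \<psi> x - \<beta> (D \<gamma>) (D x)) * cis (\<psi> x - \<psi> (x + \<gamma>) + \<beta> (D \<gamma>) (D x)))"
      unfolding \<kappa>_def E_const[OF that, of x, symmetric] by (simp add: E_def)
    then show ?thesis by (simp add: cis_mult)
  qed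
  obtain t where t: "\<And>\<gamma>. \<gamma> \<in> int_lattice \<Longrightarrow> \<kappa> \<gamma> = cis (t \<bullet> \<gamma>)"
  proof (rule character_int_lattice[of \<kappa>])
    show "norm (\<kappa> \<gamma>) = 1" if "\<gamma> \<in> int_lattice" for \<gamma>
      using hlb(2)[OF that] by (simp add: \<kappa>_def E_def norm_mult norm_power)
    fix \<gamma> \<delta> :: "real^'n" assume \<gamma>: "\<gamma> \<in> int_lattice" and \<delta>: "\<delta> \<in> int_lattice"
    \<comment> \<open>Integrality of \<beta>0 itself, and not just of its alternation, is what makes
      \<kappa> multiplicative without a sign correction.\<close>
    obtain n where n: "\<beta>0 (D \<gamma>) (D \<delta>) = of_int n"
      using int[OF \<gamma> \<delta>] by (auto simp: D_def elim: Ints_cases)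
    have "cis (\<beta> (D \<gamma>) (D \<delta>)) = cis (2 * pi * real_of_int (int k * n))"
      by (simp add: \<beta>_def n mult_ac)
    then have c1: "cis (\<beta> (D \<gamma>) (D \<delta>)) = 1" by (simp only: cis_multiple_2pi Ints_of_int)
    have D0: "D 0 = 0" by (simp add: linear_0[OF linD])
    have "\<kappa> (\<gamma> + \<delta>) = e \<gamma> (0 + \<delta>) ^ k * e \<delta> 0 ^ k * cis (\<psi> (\<gamma> + \<delta>) - \<psi> 0)"
      by (simp add: \<kappa>_def E_def D0 bilinear_rzero[OF \<beta>] hlb(3)[OF \<gamma> \<delta>] power_mult_distrib flip: add.assoc)
    also have "\<dots> = \<kappa> \<gamma> * \<kappa> \<delta> * (cis (\<psi> (0 + \<delta>) - \<psi> (0 + \<delta> + \<gamma>) + \<beta> (D \<gamma>) (D (0 + \<delta>))) *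
        cis (\<psi> 0 - \<psi> (0 + \<delta>) + \<beta> (D \<delta>) (D 0)) * cis (\<psi> (\<gamma> + \<delta>) - \<psi> 0))"
      unfolding e[OF \<gamma>, of "0 + \<delta>"] e[OF \<delta>, of 0] by (simp only: mult_ac)
    also have "\<dots> = \<kappa> \<gamma> * \<kappa> \<delta>"
      by (simp add: cis_mult D0 bilinear_rzero[OF \<beta>] c1 add.commute[of \<delta>])
    finally show "\<kappa> (\<gamma> + \<delta>) = \<kappa> \<gamma> * \<kappa> \<delta>" .
  qed blast
  \<comment> \<open>Translation by \<open>w\<close> changes the multiplier at
    \<open>D \<gamma>\<close> by the phase
    \<open>\<beta> (D \<gamma>) w - \<beta> w (D \<gamma>)\<close>. The vector
    \<open>D' (- t)\<close> is chosen because its inner product with \<open>D \<gamma>\<close> is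
    \<open>- (t \<bullet> \<gamma>)\<close>.\<close>
  obtain w where w: "\<And>u. \<beta> u w - \<beta> w u = u \<bullet> D' (- t)"
  proof (rule alternating_form_representation[OF \<beta>])
    fix w assume "\<And>u. \<beta> u w - \<beta> w u = 0"
    then have "\<beta>0 u w - \<beta>0 w u = 0" for u
      using k by (simp add: \<beta>_def flip: right_diff_distrib)
    then show "w = 0" by (rule nondeg)
  qed blast
  have tw: "t \<bullet> \<gamma> + \<beta> (D \<gamma>) w - \<beta> w (D \<gamma>) = 0" for \<gamma>
  proof -
    have "D \<gamma> \<bullet> D' (- t) = - (t \<bullet> \<gamma>)"
      using d by (simp add: D_def D'_def inner_vec_def sum_negf mult.commute)
    then show ?thesis using w[of "D \<gamma>"] by simp
  qed
  \<comment> \<open>The term with \<psi> is the gauge change at the translated point;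
    \<open>\<beta> w y\<close> makes up for the change of the Landau connection under the
    translation.\<close>
  define \<xi> where "\<xi> = (\<lambda>y. \<psi> (D' w + D' y) - \<beta> w y)"
  define \<xi>' where "\<xi>' = (\<lambda>y v. \<alpha> (D' w + D' y) (D' v) - \<beta> w v)"
  have D'_add: "D' (y + w) = D' w + D' y" for y by (simp add: D'_def diag_scale_add)
  have "vector_space.dim (\<lambda>(c::complex) f x. c * f x)
      (eigen (\<lambda>i. (1 / d i)\<^sup>2) \<Theta> int_lattice (power_bundle k e) (- 2 * of_nat k ^ 2 * \<mu>)) =
    vector_space.dim (\<lambda>(c::complex) f x. c * f x) (landau_eigen \<beta> (D ` int_lattice) (- 2 * of_nat k ^ 2 * \<mu>))"
    unfolding landau_eigen_def
  proof (rule dim_eigen_xform[where \<xi> = \<xi> and \<xi>' = \<xi>' and w = w and c = "\<lambda>i. 1 / d i"])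
    have "smooth_on (\<lambda>y. \<psi> (D' w + D' y) + - \<beta> w y) UNIV"
      by (rule smooth_on_add[OF smooth_on_compose_affine[OF bD' sm\<psi>]
            smooth_on_linear[OF linear_compose_neg[OF lin(3)]]])
    then show "smooth_on \<xi> UNIV" by (simp add: \<xi>_def)
    show "(\<xi> has_derivative \<xi>' y) (at y)" for y
      unfolding \<xi>_def \<xi>'_def using lin(3)[of w]
      by (intro has_derivative_diff has_derivative_compose_affine bD' d\<psi>)
        (simp add: bounded_linear_imp_has_derivative linear_conv_bounded_linear)
    show "\<Theta> (diag_scale (\<lambda>i. 1 / d i) (y + w)) (diag_scale (\<lambda>i. 1 / d i) v) = landau \<beta> y v + \<xi>' y v" for y v
      unfolding D'_def[symmetric] D'_add
      by (simp add: \<xi>'_def \<alpha>_def landau_def D_add \<beta>_add)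
    show "int_lattice = diag_scale (\<lambda>i. 1 / d i) ` D ` int_lattice"
      unfolding D'_def[symmetric] by (simp add: image_image)
    fix \<gamma> y assume "\<gamma> \<in> D ` int_lattice"
    then obtain n where n: "n \<in> int_lattice" "\<gamma> = D n" by auto
    have "power_bundle k e (D' \<gamma>) (D' (y + w)) =
        cis (t \<bullet> n + (\<psi> (D' (y + w)) - \<psi> (D' (y + w) + n) + \<beta> (D n) (y + w)))"
      by (simp add: power_bundle_def n e t cis_mult)
    also have "t \<bullet> n + (\<psi> (D' (y + w)) - \<psi> (D' (y + w) + n) + \<beta> (D n) (y + w))
        = (\<xi> y - \<xi> (y + \<gamma>)) + \<beta> \<gamma> y"
    proof -
      have "D' w + D' (y + \<gamma>) = D' (y + w) + n"
        by (simp add: n D'_def diag_scale_add) (simp flip: D'_def add: D_def[symmetric])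
      then show ?thesis using tw[of n] by (simp add: \<xi>_def n \<beta>_add D'_add add.assoc)
    qed
    finally show "power_bundle k e (diag_scale (\<lambda>i. 1 / d i) \<gamma>) (diag_scale (\<lambda>i. 1 / d i) (y + w)) =
        cis (\<xi> y - \<xi> (y + \<gamma>)) * cis (\<beta> \<gamma> y)"
      by (simp only: cis_mult D'_def)
  qed (use d in \<open>simp_all add: \<Theta> smooth_connection_landau[OF \<beta>]\<close>)
  then show ?thesis
    unfolding spectrum_mult_def eigensections_eq_eigen[OF d k] \<beta>_def \<Theta>_def D_def .
qed

section \<open>Translation-invariant structures\<close>

lemma riemannian_metric_pulled_metric:
  assumes "\<And>i. d i \<noteq> 0"
  shows "riemannian_metric (pulled_metric d)"
proof -
  have "bilinear (pulled_metric d x)" for x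
    by (auto simp: bilinear_def pulled_metric_def diag_scale_add inner_add_left inner_add_right
        linear_cmul[OF linear_diag_scale] intro!: linearI)
  moreover have "0 < pulled_metric d x u u" if "u \<noteq> 0" for x u
  proof -
    have "diag_scale d u \<noteq> 0" using that assms by (auto simp: vec_eq_iff)
    then show ?thesis by (simp add: pulled_metric_def)
  qed
  ultimately show ?thesis
    by (auto simp: riemannian_metric_def field_on_torus_def pulled_metric_def smooth_on_const
        inner_commute fun_eq_iff)
qed

lemma bilinear_pulled_form:
  assumes "bilinear \<beta>"
  shows "bilinear (pulled_form \<beta> d x)"
  by (auto simp: bilinear_def pulled_form_def diag_scale_add bilinear_ladd[OF assms] bilinear_radd[OF assms]
      linear_cmul[OF linear_diag_scale] bilinear_lmul[OF assms] bilinear_rmul[OF assms] right_diff_distrib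
      intro!: linearI)

lemma symplectic_structure_pulled_form:
  assumes \<beta>: "bilinear \<beta>" and nondeg: "\<And>w. (\<And>u. \<beta> u w - \<beta> w u = 0) \<Longrightarrow> w = 0"
    and d: "\<And>i. d i \<noteq> 0"
  shows "symplectic_structure (pulled_form \<beta> d)"
proof -
  have "u = 0" if "\<forall>v. pulled_form \<beta> d x u v = 0" for x u
  proof -
    have "\<beta> v (diag_scale d u) - \<beta> (diag_scale d u) v = 0" for v
      using that[rule_format, of "diag_scale (\<lambda>i. 1 / d i) v"] d
      by (simp add: pulled_form_def diag_scale_inverse)
    then have "diag_scale d u = 0" by (rule nondeg)
    then show ?thesis using d by (simp add: vec_eq_iff)
  qed
  moreover have "frechet_derivative (\<lambda>y. pulled_form \<beta> d y v w) (at x) = (\<lambda>u. 0)" for v w x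
    by (rule frechet_derivative_at_eq) (simp add: pulled_form_def)
  moreover have "smooth_on (\<lambda>x. pulled_form \<beta> d x u v) UNIV" for u v
    unfolding pulled_form_def by (rule smooth_on_const)
  ultimately show ?thesis
    using bilinear_pulled_form[OF \<beta>]
    by (auto simp: symplectic_structure_def field_on_torus_def ext_d2_def)
      (simp_all add: pulled_form_def fun_eq_iff)
qed

lemma integer_class_pulled_form:
  assumes "\<And>\<gamma> \<delta>. \<gamma> \<in> int_lattice \<Longrightarrow> \<delta> \<in> int_lattice \<Longrightarrow> \<beta> (diag_scale d \<gamma>) (diag_scale d \<delta>) \<in> \<int>"
  shows "integer_class (pulled_form \<beta> d)"
  using assms by (simp add: integer_class_def pulled_form_def case_prod_unfold content_Pair)

lemma quantum_equivalent_pulled: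
  fixes \<beta> :: "real^'n::finite \<Rightarrow> real^'n \<Rightarrow> real"
  assumes \<beta>: "bilinear \<beta>" and nondeg: "\<And>w. (\<And>u. \<beta> u w - \<beta> w u = 0) \<Longrightarrow> w = 0"
    and d: "\<And>i. d i \<noteq> 0" "\<And>i. d' i \<noteq> 0"
    and int: "\<And>\<gamma> \<delta>. \<gamma> \<in> int_lattice \<Longrightarrow> \<delta> \<in> int_lattice \<Longrightarrow> \<beta> (diag_scale d \<gamma>) (diag_scale d \<delta>) \<in> \<int>"
      "\<And>\<gamma> \<delta>. \<gamma> \<in> int_lattice \<Longrightarrow> \<delta> \<in> int_lattice \<Longrightarrow> \<beta> (diag_scale d' \<gamma>) (diag_scale d' \<delta>) \<in> \<int>"
    and t: "\<And>k. k \<ge> 1 \<Longrightarrow> \<exists>a b s.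
      transplantable (\<lambda>u v. 2 * pi * real k * \<beta> u v) a b s (diag_scale d ` int_lattice) (diag_scale d' ` int_lattice) \<and>
      transplantable (\<lambda>u v. 2 * pi * real k * \<beta> u v) b a (- s) (diag_scale d' ` int_lattice) (diag_scale d ` int_lattice)"
  shows "quantum_equivalent (pulled_metric d) (pulled_form \<beta> d) (pulled_metric d') (pulled_form \<beta> d')"
  unfolding quantum_equivalent_def
proof (intro allI impI ext)
  fix k :: nat and e1 \<theta>1 e2 \<theta>2 \<mu>
  assume k: "1 \<le> k" and p: "prequantum_bundle (pulled_form \<beta> d) e1 \<theta>1" "prequantum_bundle (pulled_form \<beta> d') e2 \<theta>2"
  have lin: "linear (\<lambda>v. c * g v)" if "linear g" for g :: "real^'n \<Rightarrow> real" and c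
    using linear_compose_scale_right[OF that, of c] by simp
  have "bilinear (\<lambda>u v. 2 * pi * real k * \<beta> u v)"
    using \<beta> by (auto simp: bilinear_def intro: lin)
  then have "vector_space.dim (\<lambda>(c::complex) f x. c * f x)
      (landau_eigen (\<lambda>u v. 2 * pi * real k * \<beta> u v) (diag_scale d ` int_lattice) \<nu>) =
    vector_space.dim (\<lambda>(c::complex) f x. c * f x)
      (landau_eigen (\<lambda>u v. 2 * pi * real k * \<beta> u v) (diag_scale d' ` int_lattice) \<nu>)" for \<nu>
    using t[OF k] dim_landau_eigen_transplant by blast
  moreover note spectrum_mult_eq_landau[OF \<beta> _ d(1) int(1) p(1) k, OF nondeg, of \<mu>]
    spectrum_mult_eq_landau[OF \<beta> _ d(2) int(2) p(2) k, OF nondeg, of \<mu>]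
  ultimately show "spectrum_mult (pulled_metric d) e1 \<theta>1 k \<mu> = spectrum_mult (pulled_metric d') e2 \<theta>2 k \<mu>"
    by simp
qed

section \<open>The symplectic form of the phase space and its periods\<close>

definition phase_bilinear :: "(real^'n::finite) bilin_field \<Rightarrow> (real^'n) \<times> (real^'n) \<Rightarrow> (real^'n) \<times> (real^'n) \<Rightarrow> real" where
  "phase_bilinear \<omega> \<zeta> \<eta> = fst \<zeta> \<bullet> snd \<eta> - snd \<zeta> \<bullet> fst \<eta> + \<omega> 0 (fst \<zeta>) (fst \<eta>)"

lemma phase_form_translation_invariant:
  assumes "translation_invariant \<omega>"
  shows "phase_form \<omega> = (\<lambda>_. phase_bilinear \<omega>)"
proof (intro ext)
  fix z \<zeta> \<eta> :: "(real^'a) \<times> (real^'a)"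
  have "((\<lambda>y. canonical_one_form y \<xi>) has_derivative (\<lambda>v. snd v \<bullet> fst \<xi>)) (at z)" for \<xi>
    unfolding canonical_one_form_def by (auto intro!: derivative_eq_intros)
  note d = frechet_derivative_at_eq[OF this]
  have f: "frechet_derivative fst (at z) = fst"
    by (rule frechet_derivative_at_eq) (rule has_derivative_fst[OF has_derivative_ident])
  have "\<omega> (fst z) = \<omega> 0" using assms unfolding translation_invariant_def by (metis add_0)
  then show "phase_form \<omega> z \<zeta> \<eta> = phase_bilinear \<omega> \<zeta> \<eta>"
    by (simp add: phase_form_def liouville_form_def ext_d1_def pullback_def d f phase_bilinear_def inner_commute)
qed

lemma bilinear_phase_bilinear:
  assumes "bilinear (\<omega> 0)"
  shows "bilinear (phase_bilinear \<omega>)"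
  by (auto simp: bilinear_def phase_bilinear_def bilinear_ladd[OF assms] bilinear_radd[OF assms]
      bilinear_lmul[OF assms] bilinear_rmul[OF assms] inner_add_left inner_add_right algebra_simps
      intro!: linearI)

text \<open>On vectors \<open>(v, 0)\<close> the phase form reduces to the form on the torus, so one
  missing period excludes a symplectomorphism in all three cases.\<close>

lemma not_symplectomorphic_by_periods:
  fixes \<omega>1 \<omega>2 :: "(real^'n::finite) bilin_field"
  assumes inv: "translation_invariant \<omega>1" "translation_invariant \<omega>2"
    and bil: "bilinear (\<omega>2 0)" and alt: "\<And>u. \<omega>2 0 u u = 0"
    and ab: "a \<in> int_lattice" "b \<in> int_lattice"
    and per: "\<And>a' b'. a' \<in> int_lattice \<Longrightarrow> b' \<in> int_lattice \<Longrightarrow> \<omega>2 0 a' b' \<noteq> \<omega>1 0 a b"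
  shows "\<not> symplectomorphic int_lattice UNIV \<omega>1 \<omega>2"
    and "\<not> symplectomorphic cotangent_group UNIV (phase_form \<omega>1) (phase_form \<omega>2)"
    and "\<not> symplectomorphic cotangent_group nonzero_covectors (phase_form \<omega>1) (phase_form \<omega>2)"
proof -
  have c: "\<omega>1 = (\<lambda>_. \<omega>1 0)" "\<omega>2 = (\<lambda>_. \<omega>2 0)"
    using inv unfolding translation_invariant_def by (metis add_0)+
  note skew = bilinear_alternating_skew[OF bil alt]
  show "\<not> symplectomorphic int_lattice UNIV \<omega>1 \<omega>2"
  proof
    assume "symplectomorphic int_lattice UNIV \<omega>1 \<omega>2"
    then have "symplectomorphic ((\<lambda>x. x) ` int_lattice) UNIV (\<lambda>_. \<omega>1 0) (\<lambda>_. \<omega>2 0)"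
      using c by simp
    from symplectomorphic_periods[OF bounded_linear_ident bounded_linear_ident refl UNIV_I
        bilinear_conv_bounded_bilinear[THEN iffD1, OF bil] skew this ab]
    show False using per by metis
  qed
  have j: "bounded_linear (\<lambda>v::real^'n. (v, 0::real^'n))"
    by (intro bounded_linear_Pair bounded_linear_ident bounded_linear_zero)
  have group: "cotangent_group = (\<lambda>v::real^'n. (v, 0::real^'n)) ` int_lattice"
    by (auto simp: cotangent_group_def)
  have bil': "bounded_bilinear (phase_bilinear \<omega>2)"
    using bilinear_phase_bilinear[of \<omega>2, OF bil] by (simp add: bilinear_conv_bounded_bilinear)
  have skew': "phase_bilinear \<omega>2 u v = - phase_bilinear \<omega>2 v u" for u v
    using skew[of "fst u" "fst v"] by (simp add: phase_bilinear_def inner_commute)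
  have "\<not> symplectomorphic cotangent_group U (phase_form \<omega>1) (phase_form \<omega>2)"
    if U: "\<And>v. x0 + (v, 0) \<in> U" for x0 U
  proof
    assume "symplectomorphic cotangent_group U (phase_form \<omega>1) (phase_form \<omega>2)"
    from symplectomorphic_periods[OF j bounded_linear_fst _ U bil' skew'
        this[unfolded group phase_form_translation_invariant[OF inv(1)] phase_form_translation_invariant[OF inv(2)]] ab]
    obtain a' b' where "a' \<in> int_lattice" "b' \<in> int_lattice"
      "phase_bilinear \<omega>2 (a', 0) (b', 0) = phase_bilinear \<omega>1 (a, 0) (b, 0)" by auto
    then show False using per by (simp add: phase_bilinear_def)
  qed
  note * = this
  show "\<not> symplectomorphic cotangent_group UNIV (phase_form \<omega>1) (phase_form \<omega>2)"
    by (rule *) simp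
  show "\<not> symplectomorphic cotangent_group nonzero_covectors (phase_form \<omega>1) (phase_form \<omega>2)"
    \<comment> \<open>Here \<open>1\<close> is the covector with all coordinates 1; it is nonzero
      and stays fixed along the plane.\<close>
    by (rule *[of "(0, 1)"]) (simp add: nonzero_covectors_def)
qed

section \<open>The two lattices in a standard symplectic space\<close>

text \<open>One half of the standard symplectic form, which is its alternation: \<sigma> pairs the
  coordinates in \<open>P\<close> with those outside, and each of the two coordinate subspaces is
  Lagrangian. This is a Landau gauge that takes integer values on integer vectors.\<close>

definition split_form :: "'n set \<Rightarrow> ('n \<Rightarrow> 'n) \<Rightarrow> real^'n::finite \<Rightarrow> real^'n \<Rightarrow> real" where
  "split_form P \<sigma> u v = (\<Sum>i\<in>P. u $ i * v $ \<sigma> i)"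

lemma bilinear_split_form: "bilinear (split_form P \<sigma>)"
  by (auto simp: bilinear_def split_form_def algebra_simps sum.distrib sum_distrib_left intro!: linearI)

lemma split_form_axis:
  assumes "bij_betw \<sigma> P (- P)" "i \<in> P"
  shows "split_form P \<sigma> (axis i 1) v = v $ \<sigma> i" and "split_form P \<sigma> (axis (\<sigma> i) 1) v = 0"
    and "split_form P \<sigma> u (axis (\<sigma> i) 1) = u $ i" and "split_form P \<sigma> u (axis i 1) = 0"
proof -
  have \<sigma>: "\<sigma> j \<notin> P" if "j \<in> P" for j using assms(1) that by (auto simp: bij_betw_def)
  have inj: "\<sigma> j = \<sigma> i \<longleftrightarrow> j = i" if "j \<in> P" for j
    using assms that by (auto simp: bij_betw_def inj_on_def)
  have "split_form P \<sigma> (axis i 1) v = (\<Sum>j\<in>P. if j = i then v $ \<sigma> i else 0)"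
    unfolding split_form_def by (rule sum.cong) (auto simp: axis_def)
  then show "split_form P \<sigma> (axis i 1) v = v $ \<sigma> i" using assms(2) by simp
  have "split_form P \<sigma> u (axis (\<sigma> i) 1) = (\<Sum>j\<in>P. if j = i then u $ i else 0)"
    unfolding split_form_def by (rule sum.cong) (auto simp: axis_def inj)
  then show "split_form P \<sigma> u (axis (\<sigma> i) 1) = u $ i" using assms(2) by simp
  show "split_form P \<sigma> (axis (\<sigma> i) 1) v = 0" "split_form P \<sigma> u (axis i 1) = 0"
    unfolding split_form_def using \<sigma> assms(2) by (auto intro!: sum.neutral simp: axis_def)
qed

lemma split_form_nondegenerate:
  assumes \<sigma>: "bij_betw \<sigma> P (- P)" and w: "\<And>u. split_form P \<sigma> u w - split_form P \<sigma> w u = 0"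
  shows "w = 0"
proof (rule vec_eq_iff[THEN iffD2], rule allI)
  fix j
  show "w $ j = 0 $ j"
  proof (cases "j \<in> P")
    case True
    then show ?thesis using w[of "axis (\<sigma> j) 1"] split_form_axis[OF \<sigma> True] by simp
  next
    case False
    then obtain i where "i \<in> P" "j = \<sigma> i" using \<sigma> by (auto simp: bij_betw_def)
    then show ?thesis using w[of "axis i 1"] split_form_axis[OF \<sigma>] by simp
  qed
qed

lemma split_form_integral:
  assumes "\<And>i. d i \<in> \<int>" "\<gamma> \<in> int_lattice" "\<delta> \<in> int_lattice"
  shows "split_form P \<sigma> (diag_scale d \<gamma>) (diag_scale d \<delta>) \<in> \<int>"
  using assms by (auto simp: split_form_def int_lattice_def intro!: Ints_sum Ints_mult)

lemma mem_diag_scale_int_lattice: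
  assumes "\<And>i. d i \<noteq> 0"
  shows "x \<in> diag_scale d ` int_lattice \<longleftrightarrow> (\<forall>i. x $ i / d i \<in> \<int>)"
proof
  assume "\<forall>i. x $ i / d i \<in> \<int>"
  then have "diag_scale (\<lambda>i. 1 / d i) x \<in> int_lattice" by (simp add: int_lattice_def)
  then show "x \<in> diag_scale d ` int_lattice"
    using assms by (intro image_eqI[of _ _ "diag_scale (\<lambda>i. 1 / d i) x"]) (simp_all add: diag_scale_inverse)
qed (use assms in \<open>auto simp: int_lattice_def\<close>)

lemma half_integer_cases:
  assumes "(x::real) \<in> \<int>"
  shows "x / 2 \<in> \<int> \<or> (x - 1) / 2 \<in> \<int>"
proof -
  obtain n :: int where n: "x = n" using assms by (auto elim: Ints_cases)
  show ?thesis
  proof (cases "even n")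
    case True
    then obtain q where "n = 2 * q" by (auto elim: evenE)
    then show ?thesis by (simp add: n)
  next
    case False
    then obtain q where "n = 2 * q + 1" by (auto elim: oddE)
    then show ?thesis by (simp add: n)
  qed
qed

text \<open>The elementary divisors are the products of the scales at \<open>i\<close> and
  \<open>\<sigma> i\<close>: 1 at \<open>i1\<close>, 4 at \<open>i2\<close>, and 2 at the other
  pairs; with \<open>scale2\<close> they are all 2. The two lattices differ only in the coordinates
  \<open>i1\<close> and \<open>\<sigma> i2\<close>, and both contain with index two the sublattice
  where both of these are even.\<close>

definition scale1 :: "'n set \<Rightarrow> ('n \<Rightarrow> 'n) \<Rightarrow> 'n \<Rightarrow> 'n \<Rightarrow> 'n \<Rightarrow> real" where
  "scale1 P \<sigma> i1 i2 i = (if i \<in> P \<and> i \<noteq> i1 \<or> i = \<sigma> i2 then 2 else 1)"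

definition scale2 :: "'n set \<Rightarrow> 'n \<Rightarrow> real" where
  "scale2 P i = (if i \<in> P then 2 else 1)"

text \<open>The vectors \<open>a\<close> and \<open>b\<close> generate the two lattices over the
  common sublattice; they commute because \<sigma> does not pair their coordinates. The entries of
  \<open>s\<close> sit at the partners of these coordinates, and the size
  \<open>1 / (2 * real k)\<close> turns the factor \<open>2 * pi * real k\<close> into
  \<open>pi\<close>: this gives the sign -1 against \<open>a\<close> and \<open>b\<close>, and the
  phase 1 against vectors with both coordinates even.\<close>

lemma transplantable_split_form:
  fixes P :: "'n::finite set"
  assumes \<sigma>: "bij_betw \<sigma> P (- P)" and i: "i1 \<in> P" "i2 \<in> P" "i1 \<noteq> i2" and k: "k \<ge> 1"
  defines "\<beta> \<equiv> \<lambda>u v. 2 * pi * real k * split_form P \<sigma> u v"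
    and "a \<equiv> axis i1 1" and "b \<equiv> axis (\<sigma> i2) 1"
    and "s \<equiv> (1 / (2 * real k)) *\<^sub>R (axis (\<sigma> i1) 1 + axis i2 1)"
    and "L1 \<equiv> diag_scale (scale1 P \<sigma> i1 i2) ` int_lattice" and "L2 \<equiv> diag_scale (scale2 P) ` int_lattice"
  shows "transplantable \<beta> a b s L1 L2" and "transplantable \<beta> b a (- s) L2 L1"
proof -
  have \<sigma>P: "\<sigma> j \<notin> P" if "j \<in> P" for j using \<sigma> that by (auto simp: bij_betw_def)
  have \<sigma>inj: "\<sigma> i1 \<noteq> \<sigma> i2" using \<sigma> i by (auto simp: bij_betw_def inj_on_def)
  have ne: "i1 \<noteq> \<sigma> i2" "i2 \<noteq> \<sigma> i1" "i1 \<noteq> \<sigma> i1" "i2 \<noteq> \<sigma> i2" using \<sigma>P i by metis+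
  note bil = bilinear_split_form[of P \<sigma>]
  note ax = split_form_axis[OF \<sigma> i(1)] split_form_axis[OF \<sigma> i(2)]
  have \<beta>a: "\<beta> a v = 2 * pi * real k * v $ \<sigma> i1" "\<beta> v a = 0" for v by (simp_all add: \<beta>_def a_def ax)
  have \<beta>b: "\<beta> b v = 0" "\<beta> v b = 2 * pi * real k * v $ i2" for v by (simp_all add: \<beta>_def b_def ax)
  have \<beta>s: "\<beta> s v = pi * v $ \<sigma> i2" "\<beta> v s = pi * v $ i1" for v
    using k by (simp_all add: \<beta>_def s_def bilinear_ladd[OF bil] bilinear_radd[OF bil]
        bilinear_lmul[OF bil] bilinear_rmul[OF bil] ax)
  have s_nth: "s $ i1 = 0" "s $ i2 = 1 / (2 * real k)" "s $ \<sigma> i1 = 1 / (2 * real k)" "s $ \<sigma> i2 = 0"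
    using i ne \<sigma>inj by (auto simp: s_def axis_def)
  have a_nth: "a $ j = (if j = i1 then 1 else 0)" and b_nth: "b $ j = (if j = \<sigma> i2 then 1 else 0)" for j
    by (auto simp: a_def b_def axis_def)
  have \<beta>neg: "\<beta> u (- v) = - \<beta> u v" "\<beta> (- u) v = - \<beta> u v" for u v
    by (simp_all add: \<beta>_def bilinear_lneg[OF bil] bilinear_rneg[OF bil])
  have cis_minus_pi: "cis (- pi) = - 1" by (simp add: complex_eq_iff)
  have cis_int: "cis (2 * pi * real k * x) = 1" if "x \<in> \<int>" for x
    using cis_multiple_2pi[of "real k * x"] that by (simp add: mult.assoc)
  have cis_even: "cis (pi * x - pi * y) = 1" if "x / 2 \<in> \<int>" "y / 2 \<in> \<int>" for x y
  proof -
    have "x / 2 - y / 2 \<in> \<int>" using that by (rule Ints_diff)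
    moreover have "pi * x - pi * y = 2 * pi * (x / 2 - y / 2)" by (simp add: algebra_simps)
    ultimately show ?thesis by (simp only: cis_multiple_2pi)
  qed
  have L1: "x \<in> L1 \<longleftrightarrow> (\<forall>j. x $ j / scale1 P \<sigma> i1 i2 j \<in> \<int>)" for x
    unfolding L1_def by (rule mem_diag_scale_int_lattice) (simp add: scale1_def)
  have L2: "x \<in> L2 \<longleftrightarrow> (\<forall>j. x $ j / scale2 P j \<in> \<int>)" for x
    unfolding L2_def by (rule mem_diag_scale_int_lattice) (simp add: scale2_def)
  have half: "x \<in> \<int>" if "x / 2 \<in> \<int>" for x :: real
    using Ints_mult[OF that, of 2] by simp
  have L1_nth: "x $ i1 \<in> \<int>" "x $ i2 / 2 \<in> \<int>" "x $ \<sigma> i1 \<in> \<int>" "x $ \<sigma> i2 / 2 \<in> \<int>" if "x \<in> L1" for x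
    using that[unfolded L1, rule_format, of i1] that[unfolded L1, rule_format, of i2]
      that[unfolded L1, rule_format, of "\<sigma> i1"] that[unfolded L1, rule_format, of "\<sigma> i2"] i ne \<sigma>P \<sigma>inj
    by (auto simp: scale1_def)
  have L2_nth: "x $ i1 / 2 \<in> \<int>" "x $ i2 / 2 \<in> \<int>" "x $ \<sigma> i1 \<in> \<int>" "x $ \<sigma> i2 \<in> \<int>" if "x \<in> L2" for x
    using that[unfolded L2, rule_format, of i1] that[unfolded L2, rule_format, of i2]
      that[unfolded L2, rule_format, of "\<sigma> i1"] that[unfolded L2, rule_format, of "\<sigma> i2"] i \<sigma>P
    by (auto simp: scale2_def)
  have mem: "a \<in> L1" "b + b \<in> L1" "b \<in> L2" "a + a \<in> L2"
    using i \<sigma>P ne by (auto simp: L1 L2 a_nth b_nth scale1_def scale2_def)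
  have L1I: "x \<in> L1" if "x \<in> L2" "x $ \<sigma> i2 / 2 \<in> \<int>" for x
    unfolding L1
  proof
    fix j
    show "x $ j / scale1 P \<sigma> i1 i2 j \<in> \<int>"
      using that(2) that(1)[unfolded L2, rule_format, of j] half
      by (auto simp: scale1_def scale2_def split: if_splits)
  qed
  have L2I: "x \<in> L2" if "x \<in> L1" "x $ i1 / 2 \<in> \<int>" for x
    unfolding L2
  proof
    fix j
    show "x $ j / scale2 P j \<in> \<int>"
      using that(2) that(1)[unfolded L1, rule_format, of j] half
      by (auto simp: scale1_def scale2_def split: if_splits)
  qed
  \<comment> \<open>The parity of the coordinate at \<open>\<sigma> i2\<close> decides whether
    \<open>b\<close> has to be subtracted to reach the common sublattice.\<close>
  have "\<exists>\<gamma>0\<in>L1. \<gamma>0 \<in> L2 \<and> (\<gamma> = \<gamma>0 \<or> \<gamma> = \<gamma>0 + b)" if \<gamma>: "\<gamma> \<in> L2" for \<gamma>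
    using half_integer_cases[OF L2_nth(4)[OF \<gamma>]]
  proof
    assume h: "(\<gamma> $ \<sigma> i2 - 1) / 2 \<in> \<int>"
    have "\<gamma> - b \<in> L2" using \<gamma> mem(3) by (auto simp: L2 diff_divide_distrib)
    then show ?thesis using h L1I[of "\<gamma> - b"] by (intro bexI[of _ "\<gamma> - b"]) (auto simp: b_nth)
  qed (use L1I \<gamma> in blast)
  note split1 = this
  have "\<exists>\<gamma>0\<in>L1. cis (\<beta> \<gamma>0 b - \<beta> b \<gamma>0) = 1 \<and> cis (\<beta> \<gamma>0 s - \<beta> s \<gamma>0) = 1 \<and>
      (\<gamma> = \<gamma>0 \<or> \<gamma> = \<gamma>0 + b \<and> cis (\<beta> b \<gamma>0) = 1)" if "\<gamma> \<in> L2" for \<gamma>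
  proof -
    from split1[OF that] obtain \<gamma>0 where *: "\<gamma>0 \<in> L1" "\<gamma>0 \<in> L2" "\<gamma> = \<gamma>0 \<or> \<gamma> = \<gamma>0 + b" by blast
    have "cis (\<beta> \<gamma>0 b - \<beta> b \<gamma>0) = 1"
      using half L2_nth[OF *(2)] by (simp add: \<beta>b cis_int)
    moreover have "cis (\<beta> \<gamma>0 s - \<beta> s \<gamma>0) = 1"
      unfolding \<beta>s by (rule cis_even[OF L2_nth(1)[OF *(2)] L1_nth(4)[OF *(1)]])
    ultimately show ?thesis using * by (intro bexI[of _ \<gamma>0]) (auto simp: \<beta>b)
  qed
  moreover have "cis (\<beta> b b) = 1" "cis (\<beta> s s) = 1" "cis (\<beta> a b - \<beta> b a) = 1"
    "cis (\<beta> a s - \<beta> s a) = - 1" "cis (\<beta> b s - \<beta> s b) = - 1"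
    using ne \<sigma>inj i k by (simp_all add: \<beta>a \<beta>b \<beta>s(1)[of s] s_nth a_nth b_nth cis_minus_pi)
  ultimately show "transplantable \<beta> a b s L1 L2"
    unfolding transplantable_def using mem by blast
  have "\<exists>\<gamma>0\<in>L2. \<gamma>0 \<in> L1 \<and> (\<gamma> = \<gamma>0 \<or> \<gamma> = \<gamma>0 + a)" if \<gamma>: "\<gamma> \<in> L1" for \<gamma>
    using half_integer_cases[OF L1_nth(1)[OF \<gamma>]]
  proof
    assume h: "(\<gamma> $ i1 - 1) / 2 \<in> \<int>"
    have "\<gamma> - a \<in> L1" using \<gamma> mem(1) by (auto simp: L1 diff_divide_distrib)
    then show ?thesis using h L2I[of "\<gamma> - a"] by (intro bexI[of _ "\<gamma> - a"]) (auto simp: a_nth)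
  qed (use L2I \<gamma> in blast)
  note split2 = this
  have "\<exists>\<gamma>0\<in>L2. cis (\<beta> \<gamma>0 a - \<beta> a \<gamma>0) = 1 \<and> cis (\<beta> \<gamma>0 (- s) - \<beta> (- s) \<gamma>0) = 1 \<and>
      (\<gamma> = \<gamma>0 \<or> \<gamma> = \<gamma>0 + a \<and> cis (\<beta> a \<gamma>0) = 1)" if "\<gamma> \<in> L1" for \<gamma>
  proof -
    from split2[OF that] obtain \<gamma>0 where *: "\<gamma>0 \<in> L2" "\<gamma>0 \<in> L1" "\<gamma> = \<gamma>0 \<or> \<gamma> = \<gamma>0 + a" by blast
    \<comment> \<open>The two directions are not symmetric: \<open>\<beta> b\<close> vanishes
      identically, whereas \<open>\<beta> a \<gamma>0\<close> is an integer multiple of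
      \<open>2 * pi * real k\<close>.\<close>
    have c: "cis (\<beta> a \<gamma>0) = 1" using L2_nth(3)[OF *(1)] by (simp add: \<beta>a cis_int)
    then have "cis (\<beta> \<gamma>0 a - \<beta> a \<gamma>0) = 1"
      using cis_cnj[of "\<beta> a \<gamma>0"] by (simp add: \<beta>a(2))
    moreover have "\<beta> \<gamma>0 (- s) - \<beta> (- s) \<gamma>0 = pi * \<gamma>0 $ \<sigma> i2 - pi * \<gamma>0 $ i1"
      by (simp add: \<beta>neg \<beta>s)
    then have "cis (\<beta> \<gamma>0 (- s) - \<beta> (- s) \<gamma>0) = 1"
      using cis_even[OF L1_nth(4)[OF *(2)] L2_nth(1)[OF *(1)]] by simp
    ultimately show ?thesis using * c by (intro bexI[of _ \<gamma>0]) auto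
  qed
  moreover have "cis (\<beta> a a) = 1" "cis (\<beta> (- s) (- s)) = 1" "cis (\<beta> b a - \<beta> a b) = 1"
    "cis (\<beta> b (- s) - \<beta> (- s) b) = - 1" "cis (\<beta> a (- s) - \<beta> (- s) a) = - 1"
    using ne \<sigma>inj i k by (simp_all add: \<beta>neg \<beta>a \<beta>b \<beta>s(1)[of s] s_nth a_nth b_nth cis_minus_pi)
  ultimately show "transplantable \<beta> b a (- s) L2 L1"
    unfolding transplantable_def using mem by blast
qed

lemma pulled_form_scale2_even:
  assumes "bij_betw \<sigma> P (- P)" "a \<in> int_lattice" "b \<in> int_lattice"
  shows "pulled_form (split_form P \<sigma>) (scale2 P) x a b / 2 \<in> \<int>"
proof -
  have "split_form P \<sigma> (diag_scale (scale2 P) u) (diag_scale (scale2 P) v) = 2 * (\<Sum>i\<in>P. u $ i * v $ \<sigma> i)" for u v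
    unfolding split_form_def sum_distrib_left
    using assms(1) by (intro sum.cong) (auto simp: scale2_def bij_betw_def)
  then have "pulled_form (split_form P \<sigma>) (scale2 P) x a b / 2 = (\<Sum>i\<in>P. a $ i * b $ \<sigma> i) - (\<Sum>i\<in>P. b $ i * a $ \<sigma> i)"
    by (simp add: pulled_form_def)
  also have "\<dots> \<in> \<int>" using assms by (auto simp: int_lattice_def intro!: Ints_diff Ints_sum Ints_mult)
  finally show ?thesis .
qed

theorem theorem1p3:
  fixes m :: nat
  assumes "m \<ge> 2" and "CARD('n::finite) = 2 * m"
  shows "\<exists>(h1 :: (real^'n) bilin_field) \<omega>1 h2 \<omega>2.
    riemannian_metric h1 \<and> translation_invariant h1 \<and>
    riemannian_metric h2 \<and> translation_invariant h2 \<and>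
    symplectic_structure \<omega>1 \<and> translation_invariant \<omega>1 \<and> integer_class \<omega>1 \<and>
    symplectic_structure \<omega>2 \<and> translation_invariant \<omega>2 \<and> integer_class \<omega>2 \<and>
    quantum_equivalent h1 \<omega>1 h2 \<omega>2 \<and>
    \<not> symplectomorphic int_lattice UNIV \<omega>1 \<omega>2 \<and>
    \<not> symplectomorphic cotangent_group UNIV (phase_form \<omega>1) (phase_form \<omega>2) \<and>
    \<not> symplectomorphic cotangent_group nonzero_covectors (phase_form \<omega>1) (phase_form \<omega>2)"
proof -
  obtain P :: "'n set" where P: "card P = m"
    using obtain_subset_with_card_n[of m "UNIV :: 'n set"] assms(2) by auto
  then have "card (- P) = card P" using assms(2) P by (simp add: Compl_eq_Diff_UNIV card_Diff_subset)
  then obtain \<sigma> where \<sigma>: "bij_betw \<sigma> P (- P)"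
    using finite_same_card_bij[of P "- P"] by auto
  \<comment> \<open>The hypothesis \<open>m \<ge> 2\<close> enters here: one pair carries the
    divisor 1 and a different one the divisor 4.\<close>
  obtain i1 i2 where i: "i1 \<in> P" "i2 \<in> P" "i1 \<noteq> i2"
    using P assms(1) card_le_Suc0_iff_eq[of P] by fastforce
  define \<beta> where "\<beta> = split_form P \<sigma>"
  define d1 where "d1 = scale1 P \<sigma> i1 i2"
  define d2 where "d2 = scale2 P"
  have \<beta>: "bilinear \<beta>" unfolding \<beta>_def by (rule bilinear_split_form)
  have nondeg: "w = 0" if "\<And>u. \<beta> u w - \<beta> w u = 0" for w
    using split_form_nondegenerate[OF \<sigma>] that unfolding \<beta>_def by blast
  have d: "d1 j \<noteq> 0" "d2 j \<noteq> 0" "d1 j \<in> \<int>" "d2 j \<in> \<int>" for j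
    by (simp_all add: d1_def d2_def scale1_def scale2_def)
  have int: "\<beta> (diag_scale d1 \<gamma>) (diag_scale d1 \<delta>) \<in> \<int>" "\<beta> (diag_scale d2 \<gamma>) (diag_scale d2 \<delta>) \<in> \<int>"
    if "\<gamma> \<in> int_lattice" "\<delta> \<in> int_lattice" for \<gamma> \<delta>
    unfolding \<beta>_def using that d by (simp_all add: split_form_integral)
  have inv: "translation_invariant (pulled_form \<beta> c)" "translation_invariant (pulled_metric c)" for c
    by (simp_all add: translation_invariant_def pulled_form_def pulled_metric_def fun_eq_iff)
  have qe: "quantum_equivalent (pulled_metric d1) (pulled_form \<beta> d1) (pulled_metric d2) (pulled_form \<beta> d2)"
    using transplantable_split_form[OF \<sigma> i, folded \<beta>_def d1_def d2_def]
    by (intro quantum_equivalent_pulled \<beta> nondeg d int) blast+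
  have "\<sigma> i1 \<noteq> \<sigma> i2" "\<sigma> i1 \<notin> P" "i1 \<noteq> \<sigma> i2"
    using \<sigma> i by (auto simp: bij_betw_def inj_on_def)
  \<comment> \<open>The pair of \<open>i1\<close> is left unscaled in \<open>d1\<close>, which
    produces the odd period.\<close>
  then have "pulled_form \<beta> d1 0 (axis i1 1) (axis (\<sigma> i1) 1) = 1"
    using i bilinear_lmul[OF \<beta>] bilinear_rmul[OF \<beta>] split_form_axis[OF \<sigma> i(1)]
    by (simp add: pulled_form_def diag_scale_axis d1_def scale1_def \<beta>_def)
  moreover have "pulled_form \<beta> d2 0 a b \<noteq> 1" if "a \<in> int_lattice" "b \<in> int_lattice" for a b
    using pulled_form_scale2_even[OF \<sigma> that, of 0] by (auto simp: \<beta>_def d2_def)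
  ultimately have per: "pulled_form \<beta> d2 0 a b \<noteq> pulled_form \<beta> d1 0 (axis i1 1) (axis (\<sigma> i1) 1)"
    if "a \<in> int_lattice" "b \<in> int_lattice" for a b using that by simp
  have alt: "pulled_form \<beta> d2 0 u u = 0" for u by (simp add: pulled_form_def)
  have nonsymp: "\<not> symplectomorphic int_lattice UNIV (pulled_form \<beta> d1) (pulled_form \<beta> d2)"
    "\<not> symplectomorphic cotangent_group UNIV (phase_form (pulled_form \<beta> d1)) (phase_form (pulled_form \<beta> d2))"
    "\<not> symplectomorphic cotangent_group nonzero_covectors
      (phase_form (pulled_form \<beta> d1)) (phase_form (pulled_form \<beta> d2))"
    by (rule not_symplectomorphic_by_periods[OF inv(1) inv(1) bilinear_pulled_form[OF \<beta>] alt
          int_lattice_axis int_lattice_axis per], assumption+)+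
  show ?thesis
    by (rule exI[of _ "pulled_metric d1"], rule exI[of _ "pulled_form \<beta> d1"],
        rule exI[of _ "pulled_metric d2"], rule exI[of _ "pulled_form \<beta> d2"], intro conjI)
      (fact qe nonsymp inv | intro riemannian_metric_pulled_metric symplectic_structure_pulled_form
        integer_class_pulled_form \<beta> nondeg d int; assumption)+
qed

end
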